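(* Let $(G,\mathfrak S)$ be a hierarchically hyperbolic group, and let $H<G$ be a subgroup with set of eyries $\mathcal E(H)$. Assume that, for each $W\in\mathcal E(H)$, there is an element of $H$ (stabilising $W$ and) acting loxodromically on $\mathcal C W$. Then there is an element $h\in H$ with $\operatorname{Big}(h)=\mathcal E(H)$.
   Context: **Hierarchically hyperbolic spaces (HHSs).** Let $X$ be a quasigeodesic metric space. An HHS structure $(X,\mathfrak S)$ consists of a set $\mathfrak S$ of *domains*, a constant $E\ge 1$, and for each $U\in\mathfrak S$ a geodesic $E$-hyperbolic space $\mathcal C U$, with the following data and axioms. (Distance between sets means infimal distance. One writes $d_U$ for distance in $\mathcal C U$ and suppresses $\pi_U$: $d_U(x,y)=d_{\mathcal C U}(\pi_U(x),\pi_U(y))$ for $x,y\in X$, $d_U(x,A)=d_{\mathcal C U}(\pi_U(x),A)$ for $A\subseteq\mathcal C U$.) 1. *Projections.* Maps $\pi_U:X\to\mathcal C U$ with $d_U(x,y)\le E\,d_X(x,y)+E$, and every point of $\mathcal C U$ is within $E$ of $\pi_U(X)$. 2. *Nesting.* A partial order $\sqsubseteq$ on $\mathfrak S$ with a unique maximal element (if $\mathfrak S\neq\varnothing$). $V\sqsubset W$ means $V\sqsubseteq W$, $V\ne W$ ("properly nested"). $\mathfrak S_W=\{V:V\sqsubseteq W\}$. If $V\sqsubset W$ there are a specified nonempty $\rho^V_W\subseteq\mathcal C W$ of diameter $\le E$ and a map $\rho^W_V:\mathcal C W\to 2^{\mathcal C V}$. 3. *Orthogonality.* A symmetric antireflexive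 relation $\bot$. If $V\sqsubseteq W$ and $W\bot U$ then $V\bot U$. If $V\bot W$ then $V,W$ are not $\sqsubseteq$-comparable. For each $T\in\mathfrak S$ and $U\in\mathfrak S_T$ with $\{V\in\mathfrak S_T:V\bot U\}\ne\varnothing$ there is $W\in\mathfrak S_T\smallsetminus\{T\}$ such that $V\sqsubseteq W$ whenever $V\in\mathfrak S_T$, $V\bot U$. 4. *Transversality and consistency.* If $V,W$ are distinct, not orthogonal and not $\sqsubseteq$-comparable they are *transverse*, $V\pitchfork W$; then there are nonempty sets $\rho^V_W\subseteq\mathcal C W$, $\rho^W_V\subseteq\mathcal C V$ of diameter $\le E$ with $\min\{d_W(x,\rho^V_W),d_V(x,\rho^W_V)\}\le E$ for all $x\in X$. If $V\sqsubset W$ then $\min\{d_W(x,\rho^V_W),\operatorname{diam}(\{\pi_V(x)\}\cup\rho^W_V(\pi_W(x)))\}\le E$ for all $x\in X$. If $U\sqsubseteq V$ then $d_W(\rho^U_W,\rho^V_W)\le E$ whenever $V\sqsubset W$, or $V\pitchfork W$ and $W\not\perp U$. 5. *Finite complexity.* The cardinality of $\sqsubseteq$-chains is bounded; the maximum is the *complexity*. 6. *Large links.* For $W\in\mathfrak S$, $x,x'\in X$ let $N=E\,d_W(x,x')+E$. There are $T_1,\dots,T_{\lfloor N\rfloor}\in\mathfrak S_W\smallsetminus\{W\}$ such that each $T\in\mathfrak S_W\smallsetminus\{W\}$ is nested in some $T_i$ or has $d_T(x,x')<E$; and $d_W(x,\rho^{T_i}_W)\le N$ for all $i$. 7. *Bounded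 geodesic image.* If $V\sqsubset W$ and $\gamma$ is a geodesic of $\mathcal C W$, then $\operatorname{diam}\rho^W_V(\gamma)\le E$ or $\gamma$ meets the $E$-neighbourhood of $\rho^V_W$. Moreover if $y,z\in X$ have $d_V(y,z)>E$ then $\rho^V_W$ is $E$-close to every geodesic $[\pi_W(y),\pi_W(z)]$. 8. *Partial realisation.* If $\{W_i\}$ are pairwise orthogonal and $p_i\in\mathcal C W_i$, there is $x\in X$ with $d_{W_i}(x,p_i)\le E$ for all $i$ and $d_V(x,\rho^{W_i}_V)\le E$ whenever $W_i\sqsubset V$ or $W_i\pitchfork V$. 9. *Uniqueness.* For each $\kappa$ there is $\theta_u(\kappa)$ such that if $d_X(x,y)>\theta_u(\kappa)$ then $d_U(x,y)>\kappa$ for some $U\in\mathfrak S$. **Hierarchically hyperbolic groups (HHGs).** A finitely generated group $G$ with an HHS structure $(G,\mathfrak S)$ on $G$ (with a word metric) is an HHG if: $G$ acts on $\mathfrak S$ with finitely many orbits, preserving $\sqsubseteq,\bot,\pitchfork$; for $g\in G$, $U\in\mathfrak S$ there is an isometry $g:\mathcal C U\to\mathcal C gU$, with the isometry of a product $gh$ equal to the composition; and $g\pi_U(x)=\pi_{gU}(gx)$, $g\rho^V_U=\rho^{gV}_{gU}$ for all $g,x\in G$ and $U,V$ with $U\pitchfork V$ or $V\sqsubset U$. By cofiniteness, $E$ is also chosen so that $\operatorname{diam}\mathcal C U>E$ implies $\operatorname{diam}\mathcal C U=\infty$. **Eyries of a subgroup.** For a subgroup $H<G$ let $\overline{\mathfrak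 S}{}^H=\{U\in\mathfrak S:\pi_U(H)\text{ is unbounded}\}$. There is a (necessarily unique) finite $H$-invariant set $\mathcal E(H)\subseteq\overline{\mathfrak S}{}^H$ of pairwise orthogonal domains such that every $U\in\overline{\mathfrak S}{}^H$ is nested in an element of $\mathcal E(H)$; it is the set of $\sqsubseteq$-maximal elements of $\overline{\mathfrak S}{}^H$ (possibly empty). Its elements are the *eyries* of $H$. **Big-sets.** For $h\in G$, $\operatorname{Big}(h)$ is the set of domains $U\in\mathfrak S$ for which $\pi_U(\langle h\rangle)$ is unbounded. *)

theory Defs
  imports
    "HOL-Analysis.Abstract_Metric_Spaces"
    "HOL-Library.Extended_Nonnegative_Real"
    "HOL-Algebra.Group_Action"
    "HOL-Algebra.Generated_Groups"
begin

section \<open>Metric preliminaries\<close>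

text \<open>Diameters and distances between sets take values in \<^typ>\<open>ennreal\<close>: the diameter of the
  empty set is 0, that of an unbounded set is \<open>\<infinity>\<close>, and the distance to the empty set is \<open>\<infinity>\<close>.\<close>

definition diam :: "'a metric \<Rightarrow> 'a set \<Rightarrow> ennreal" where
  "diam M S = (SUP (x, y) \<in> S \<times> S. ennreal (mdist M x y))"

definition set_dist :: "'a metric \<Rightarrow> 'a set \<Rightarrow> 'a set \<Rightarrow> ennreal" where
  "set_dist M S T = (INF (x, y) \<in> S \<times> T. ennreal (mdist M x y))"

definition nbhd :: "'a metric \<Rightarrow> real \<Rightarrow> 'a set \<Rightarrow> 'a set" where
  "nbhd M r S = {x \<in> mspace M. set_dist M {x} S \<le> ennreal r}"

abbreviation bounded_in :: "'a metric \<Rightarrow> 'a set \<Rightarrow> bool" where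
  "bounded_in M \<equiv> Metric_space.mbounded (mspace M) (mdist M)"

definition isometric_embedding :: "'a metric \<Rightarrow> 'b metric \<Rightarrow> ('a \<Rightarrow> 'b) \<Rightarrow> bool" where
  "isometric_embedding M N f \<longleftrightarrow> f ` mspace M \<subseteq> mspace N \<and>
     (\<forall>x \<in> mspace M. \<forall>y \<in> mspace M. mdist N (f x) (f y) = mdist M x y)"

definition isometry :: "'a metric \<Rightarrow> 'b metric \<Rightarrow> ('a \<Rightarrow> 'b) \<Rightarrow> bool" where
  "isometry M N f \<longleftrightarrow> isometric_embedding M N f \<and> f ` mspace M = mspace N"

definition qi_embedding :: "real \<Rightarrow> real \<Rightarrow> 'a metric \<Rightarrow> 'b metric \<Rightarrow> ('a \<Rightarrow> 'b) \<Rightarrow> bool" where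
  "qi_embedding K c M N f \<longleftrightarrow> 1 \<le> K \<and> 0 \<le> c \<and> f ` mspace M \<subseteq> mspace N \<and>
     (\<forall>x \<in> mspace M. \<forall>y \<in> mspace M.
        mdist M x y / K - c \<le> mdist N (f x) (f y) \<and>
        mdist N (f x) (f y) \<le> K * mdist M x y + c)"

abbreviation interval :: "real \<Rightarrow> real metric" where
  "interval l \<equiv> submetric euclidean_metric {0..l}"

definition int_metric :: "int metric" where
  "int_metric = metric (UNIV, \<lambda>m n. real_of_int \<bar>m - n\<bar>)"

lemma
  shows mspace_int_metric [simp]: "mspace int_metric = UNIV"
    and mdist_int_metric [simp]: "mdist int_metric m n = real_of_int \<bar>m - n\<bar>"
proof -
  interpret Metric_space "UNIV :: int set" "\<lambda>m n. real_of_int \<bar>m - n\<bar>"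
    by standard auto
  show "mspace int_metric = UNIV" "mdist int_metric m n = real_of_int \<bar>m - n\<bar>"
    unfolding int_metric_def by (fact mspace_metric, simp only: mdist_metric)
qed

definition quasigeodesic_space :: "'a metric \<Rightarrow> bool" where
  "quasigeodesic_space M \<longleftrightarrow> (\<exists>K c. \<forall>x \<in> mspace M. \<forall>y \<in> mspace M.
     \<exists>l \<ge> 0. \<exists>f. qi_embedding K c (interval l) M f \<and> f 0 = x \<and> f l = y)"

definition geodesic_segment :: "'a metric \<Rightarrow> 'a \<Rightarrow> 'a \<Rightarrow> 'a set \<Rightarrow> bool" where
  "geodesic_segment M x y \<gamma> \<longleftrightarrow>
     (\<exists>l \<ge> 0. \<exists>f. isometric_embedding (interval l) M f \<and> f 0 = x \<and> f l = y \<and> \<gamma> = f ` {0..l})"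

definition geodesic_space :: "'a metric \<Rightarrow> bool" where
  "geodesic_space M \<longleftrightarrow> (\<forall>x \<in> mspace M. \<forall>y \<in> mspace M. \<exists>\<gamma>. geodesic_segment M x y \<gamma>)"

text \<open>Hyperbolicity in the sense of Rips: geodesic triangles are \<open>\<delta>\<close>-slim.\<close>

definition hyperbolic_space :: "real \<Rightarrow> 'a metric \<Rightarrow> bool" where
  "hyperbolic_space \<delta> M \<longleftrightarrow> geodesic_space M \<and>
     (\<forall>x y z \<alpha> \<beta> \<gamma>. geodesic_segment M x y \<alpha> \<and> geodesic_segment M y z \<beta> \<and> geodesic_segment M x z \<gamma>
        \<longrightarrow> \<gamma> \<subseteq> nbhd M \<delta> (\<alpha> \<union> \<beta>))"

section \<open>Hierarchically hyperbolic spaces\<close>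

text \<open>The combinatorial part of an HHS structure: nesting, orthogonality and finite complexity.\<close>

locale domain_system =
  fixes \<SS> :: "'u set"
    and nest :: "'u \<Rightarrow> 'u \<Rightarrow> bool" (infix \<open>\<preceq>\<close> 50)
    and orth :: "'u \<Rightarrow> 'u \<Rightarrow> bool" (infix \<open>\<bottom>\<bottom>\<close> 50)
  assumes nest_refl: "U \<in> \<SS> \<Longrightarrow> U \<preceq> U"
    and nest_antisym: "\<lbrakk>U \<in> \<SS>; V \<in> \<SS>; U \<preceq> V; V \<preceq> U\<rbrakk> \<Longrightarrow> U = V"
    and nest_trans: "\<lbrakk>U \<in> \<SS>; V \<in> \<SS>; W \<in> \<SS>; U \<preceq> V; V \<preceq> W\<rbrakk> \<Longrightarrow> U \<preceq> W"
    and unique_maximal: "\<SS> \<noteq> {} \<Longrightarrow> \<exists>!M. M \<in> \<SS> \<and> (\<forall>V \<in> \<SS>. M \<preceq> V \<longrightarrow> V = M)"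
    and orth_sym: "\<lbrakk>U \<in> \<SS>; V \<in> \<SS>; U \<bottom>\<bottom> V\<rbrakk> \<Longrightarrow> V \<bottom>\<bottom> U"
    and orth_irrefl: "U \<in> \<SS> \<Longrightarrow> \<not> U \<bottom>\<bottom> U"
    and nest_orth: "\<lbrakk>U \<in> \<SS>; V \<in> \<SS>; W \<in> \<SS>; V \<preceq> W; W \<bottom>\<bottom> U\<rbrakk> \<Longrightarrow> V \<bottom>\<bottom> U"
    and orth_incomparable: "\<lbrakk>V \<in> \<SS>; W \<in> \<SS>; V \<bottom>\<bottom> W\<rbrakk> \<Longrightarrow> \<not> V \<preceq> W \<and> \<not> W \<preceq> V"
    and orth_container: "\<lbrakk>T \<in> \<SS>; U \<in> \<SS>; U \<preceq> T; {V \<in> \<SS>. V \<preceq> T \<and> V \<bottom>\<bottom> U} \<noteq> {}\<rbrakk> \<Longrightarrow>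
      \<exists>W \<in> \<SS>. W \<preceq> T \<and> W \<noteq> T \<and> (\<forall>V \<in> \<SS>. V \<preceq> T \<and> V \<bottom>\<bottom> U \<longrightarrow> V \<preceq> W)"
    and finite_complexity: "\<exists>n. \<forall>c \<subseteq> \<SS>. (\<forall>U \<in> c. \<forall>V \<in> c. U \<preceq> V \<or> V \<preceq> U) \<longrightarrow>
      finite c \<and> card c \<le> n"
begin

definition proper_nest :: "'u \<Rightarrow> 'u \<Rightarrow> bool" (infix \<open>\<prec>\<close> 50) where
  "V \<prec> W \<longleftrightarrow> V \<preceq> W \<and> V \<noteq> W"

definition transverse :: "'u \<Rightarrow> 'u \<Rightarrow> bool" (infix \<open>\<pitchfork>\<close> 50) where
  "V \<pitchfork> W \<longleftrightarrow> V \<noteq> W \<and> \<not> V \<bottom>\<bottom> W \<and> \<not> V \<preceq> W \<and> \<not> W \<preceq> V"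

end

text \<open>All the spaces \<open>C U\<close> are metrics on subsets of a single type of points, which is no restriction
  since one may pass to a disjoint union.  For \<open>V \<prec> W\<close> or \<open>V \<pitchfork> W\<close> the set \<open>\<rho>\<^sup>V\<^sub>W \<subseteq> C W\<close> is \<open>\<rho> V W\<close>;
  for \<open>V \<prec> W\<close> the map \<open>\<rho>\<^sup>W\<^sub>V\<close> from \<open>C W\<close> to the subsets of \<open>C V\<close> is \<open>\<rho>m W V\<close>.

  In the large links axiom the list of \<open>\<lfloor>N\<rfloor>\<close> domains is rendered as a set of at most \<open>\<lfloor>N\<rfloor>\<close> domains.
  A list of exactly \<open>\<lfloor>N\<rfloor> \<ge> 1\<close> domains could not exist when \<open>W\<close> is nest-minimal.

  The bounded geodesic image axiom is stated for geodesic segments; for rays and lines it follows by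
  exhausting them by segments.\<close>

locale hierarchically_hyperbolic_space = domain_system \<SS> nest orth
  for X :: "'x metric"
    and \<SS> :: "'u set"
    and E :: real
    and C :: "'u \<Rightarrow> 'c metric"
    and \<pi> :: "'u \<Rightarrow> 'x \<Rightarrow> 'c"
    and nest :: "'u \<Rightarrow> 'u \<Rightarrow> bool" (infix \<open>\<preceq>\<close> 50)
    and orth :: "'u \<Rightarrow> 'u \<Rightarrow> bool" (infix \<open>\<bottom>\<bottom>\<close> 50)
    and \<rho> :: "'u \<Rightarrow> 'u \<Rightarrow> 'c set"
    and \<rho>m :: "'u \<Rightarrow> 'u \<Rightarrow> 'c \<Rightarrow> 'c set" +
  assumes quasigeodesic: "quasigeodesic_space X"
    and E_ge_1: "1 \<le> E"
    and hyperbolic: "U \<in> \<SS> \<Longrightarrow> hyperbolic_space E (C U)"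
    \<comment> \<open>projections\<close>
    and proj_closed: "\<lbrakk>U \<in> \<SS>; x \<in> mspace X\<rbrakk> \<Longrightarrow> \<pi> U x \<in> mspace (C U)"
    and proj_lipschitz: "\<lbrakk>U \<in> \<SS>; x \<in> mspace X; y \<in> mspace X\<rbrakk> \<Longrightarrow>
      mdist (C U) (\<pi> U x) (\<pi> U y) \<le> E * mdist X x y + E"
    and proj_coarsely_onto: "U \<in> \<SS> \<Longrightarrow> mspace (C U) \<subseteq> nbhd (C U) E (\<pi> U ` mspace X)"
    \<comment> \<open>relative projections\<close>
    and rho_set: "\<lbrakk>V \<in> \<SS>; W \<in> \<SS>; V \<prec> W \<or> V \<pitchfork> W\<rbrakk> \<Longrightarrow>
      \<rho> V W \<noteq> {} \<and> \<rho> V W \<subseteq> mspace (C W) \<and> diam (C W) (\<rho> V W) \<le> ennreal E"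
    and rho_map: "\<lbrakk>V \<in> \<SS>; W \<in> \<SS>; V \<prec> W; p \<in> mspace (C W)\<rbrakk> \<Longrightarrow> \<rho>m W V p \<subseteq> mspace (C V)"
    \<comment> \<open>consistency\<close>
    and consistency_transverse: "\<lbrakk>V \<in> \<SS>; W \<in> \<SS>; V \<pitchfork> W; x \<in> mspace X\<rbrakk> \<Longrightarrow>
      min (set_dist (C W) {\<pi> W x} (\<rho> V W)) (set_dist (C V) {\<pi> V x} (\<rho> W V)) \<le> ennreal E"
    and consistency_nested: "\<lbrakk>V \<in> \<SS>; W \<in> \<SS>; V \<prec> W; x \<in> mspace X\<rbrakk> \<Longrightarrow>
      min (set_dist (C W) {\<pi> W x} (\<rho> V W)) (diam (C V) ({\<pi> V x} \<union> \<rho>m W V (\<pi> W x))) \<le> ennreal E"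
    and consistency_rho: "\<lbrakk>U \<in> \<SS>; V \<in> \<SS>; W \<in> \<SS>; U \<preceq> V; V \<prec> W \<or> V \<pitchfork> W \<and> \<not> W \<bottom>\<bottom> U\<rbrakk> \<Longrightarrow>
      set_dist (C W) (\<rho> U W) (\<rho> V W) \<le> ennreal E"
    and large_links: "\<lbrakk>W \<in> \<SS>; x \<in> mspace X; x' \<in> mspace X; N = E * mdist (C W) (\<pi> W x) (\<pi> W x') + E\<rbrakk> \<Longrightarrow>
      \<exists>\<T> \<subseteq> {T \<in> \<SS>. T \<prec> W}. finite \<T> \<and> card \<T> \<le> nat \<lfloor>N\<rfloor> \<and>
        (\<forall>T \<in> \<SS>. T \<prec> W \<longrightarrow> (\<exists>T' \<in> \<T>. T \<preceq> T') \<or> mdist (C T) (\<pi> T x) (\<pi> T x') < E) \<and>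
        (\<forall>T \<in> \<T>. set_dist (C W) {\<pi> W x} (\<rho> T W) \<le> ennreal N)"
    and bounded_geodesic_image: "\<lbrakk>V \<in> \<SS>; W \<in> \<SS>; V \<prec> W; geodesic_segment (C W) p q \<gamma>\<rbrakk> \<Longrightarrow>
      diam (C V) (\<Union>t \<in> \<gamma>. \<rho>m W V t) \<le> ennreal E \<or> \<gamma> \<inter> nbhd (C W) E (\<rho> V W) \<noteq> {}"
    and bounded_geodesic_image_proj: "\<lbrakk>V \<in> \<SS>; W \<in> \<SS>; V \<prec> W; y \<in> mspace X; z \<in> mspace X;
        mdist (C V) (\<pi> V y) (\<pi> V z) > E; geodesic_segment (C W) (\<pi> W y) (\<pi> W z) \<gamma>\<rbrakk> \<Longrightarrow>
      set_dist (C W) (\<rho> V W) \<gamma> \<le> ennreal E"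
    and partial_realisation: "\<lbrakk>\<W> \<subseteq> \<SS>; \<forall>V \<in> \<W>. \<forall>W \<in> \<W>. V \<noteq> W \<longrightarrow> V \<bottom>\<bottom> W;
        \<forall>W \<in> \<W>. P W \<in> mspace (C W)\<rbrakk> \<Longrightarrow>
      \<exists>x \<in> mspace X. \<forall>W \<in> \<W>. mdist (C W) (\<pi> W x) (P W) \<le> E \<and>
        (\<forall>V \<in> \<SS>. W \<prec> V \<or> W \<pitchfork> V \<longrightarrow> set_dist (C V) {\<pi> V x} (\<rho> W V) \<le> ennreal E)"
    and uniqueness: "\<exists>\<theta> :: real. \<forall>x \<in> mspace X. \<forall>y \<in> mspace X. mdist X x y > \<theta> \<longrightarrow>
        (\<exists>U \<in> \<SS>. mdist (C U) (\<pi> U x) (\<pi> U y) > \<kappa>)"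

section \<open>Word metrics\<close>

definition is_word :: "('g, 'm) monoid_scheme \<Rightarrow> 'g set \<Rightarrow> 'g \<Rightarrow> 'g list \<Rightarrow> bool" where
  "is_word G A g ws \<longleftrightarrow> set ws \<subseteq> A \<union> m_inv G ` A \<and> foldr (mult G) ws \<one>\<^bsub>G\<^esub> = g"

definition word_length :: "('g, 'm) monoid_scheme \<Rightarrow> 'g set \<Rightarrow> 'g \<Rightarrow> nat" where
  "word_length G A g = (LEAST n. \<exists>ws. is_word G A g ws \<and> length ws = n)"

text \<open>The value outside the carrier is irrelevant; it is set to 0 because \<^locale>\<open>Metric_space\<close>
  requires symmetry and nonnegativity everywhere.\<close>

definition word_dist :: "('g, 'm) monoid_scheme \<Rightarrow> 'g set \<Rightarrow> 'g \<Rightarrow> 'g \<Rightarrow> real" where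
  "word_dist G A x y = (if x \<in> carrier G \<and> y \<in> carrier G
     then real (word_length G A (inv\<^bsub>G\<^esub> x \<otimes>\<^bsub>G\<^esub> y)) else 0)"

definition word_metric :: "('g, 'm) monoid_scheme \<Rightarrow> 'g set \<Rightarrow> 'g metric" where
  "word_metric G A = metric (carrier G, word_dist G A)"

context group
begin

lemma is_word_append:
  assumes "A \<subseteq> carrier G" "is_word G A g us" "is_word G A h vs"
  shows "is_word G A (g \<otimes> h) (us @ vs)"
proof -
  have S: "A \<union> m_inv G ` A \<subseteq> carrier G" using assms(1) by auto
  have closed: "set ws \<subseteq> A \<union> m_inv G ` A \<Longrightarrow> foldr (\<otimes>) ws \<one> \<in> carrier G" for ws
    using S by (induction ws) auto
  have "set us \<subseteq> A \<union> m_inv G ` A \<Longrightarrow>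
      foldr (\<otimes>) (us @ vs) \<one> = foldr (\<otimes>) us \<one> \<otimes> foldr (\<otimes>) vs \<one>"
  proof (induction us)
    case Nil
    then show ?case using closed[of vs] assms(3) by (simp add: is_word_def)
  next
    case (Cons a us)
    have "a \<in> carrier G" using Cons.prems S by auto
    moreover have "foldr (\<otimes>) us \<one> \<in> carrier G" using Cons.prems by (intro closed) auto
    moreover have "foldr (\<otimes>) vs \<one> \<in> carrier G"
      using assms(3) by (intro closed) (auto simp: is_word_def)
    ultimately show ?case using Cons by (simp add: m_assoc)
  qed
  then show ?thesis using assms(2,3) by (auto simp: is_word_def)
qed

lemma is_word_single:
  assumes "A \<subseteq> carrier G" "a \<in> A \<union> m_inv G ` A"
  shows "is_word G A a [a]"
  using assms by (auto simp: is_word_def)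

lemma is_word_inv:
  assumes A: "A \<subseteq> carrier G" and "is_word G A g ws"
  shows "is_word G A (inv g) (rev (map (m_inv G) ws))"
  using assms(2)
proof (induction ws arbitrary: g)
  case Nil
  then show ?case by (auto simp: is_word_def)
next
  case (Cons a ws)
  have S: "A \<union> m_inv G ` A \<subseteq> carrier G" using A by auto
  define h where "h = foldr (\<otimes>) ws \<one>"
  have h: "is_word G A h ws" using Cons.prems by (auto simp: is_word_def h_def)
  have ws: "set ws \<subseteq> A \<union> m_inv G ` A" and a: "a \<in> A \<union> m_inv G ` A"
    using Cons.prems by (auto simp: is_word_def)
  have hc: "h \<in> carrier G" unfolding h_def using ws S by (induction ws) auto
  have ac: "a \<in> carrier G" using a S by auto
  have g: "g = a \<otimes> h" using Cons.prems by (auto simp: is_word_def h_def)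
  have "inv a \<in> A \<union> m_inv G ` A" using a A by auto
  from is_word_append[OF A Cons.IH[OF h] is_word_single[OF A this]]
  show ?case using hc ac by (simp add: g inv_mult_group)
qed

lemma is_word_exists:
  assumes A: "A \<subseteq> carrier G" and "g \<in> generate G A"
  shows "\<exists>ws. is_word G A g ws"
  using assms(2)
proof (induction rule: generate.induct)
  case one
  have "is_word G A \<one> []" by (simp add: is_word_def)
  then show ?case by blast
next
  case (incl h)
  then show ?case using is_word_single[OF A] by blast
next
  case (inv h)
  then show ?case using is_word_single[OF A] by blast
next
  case (eng h1 h2)
  then show ?case using is_word_append[OF A] by blast
qed

lemma word_length_le: "is_word G A g ws \<Longrightarrow> word_length G A g \<le> length ws"
  unfolding word_length_def by (rule Least_le) auto

lemma word_length_attained: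
  assumes "A \<subseteq> carrier G" "g \<in> generate G A"
  obtains ws where "is_word G A g ws" "length ws = word_length G A g"
proof -
  have "\<exists>n ws. is_word G A g ws \<and> length ws = n" using is_word_exists[OF assms] by blast
  from LeastI_ex[OF this] show ?thesis using that unfolding word_length_def by blast
qed

lemma Metric_space_word_dist:
  assumes A: "A \<subseteq> carrier G" and gen: "generate G A = carrier G"
  shows "Metric_space (carrier G) (word_dist G A)"
proof
  fix x y z
  show "0 \<le> word_dist G A x y" by (simp add: word_dist_def)
  have inv_le: "word_length G A (inv g) \<le> word_length G A g" if "g \<in> carrier G" for g
    using word_length_attained[OF A] that gen is_word_inv[OF A] word_length_le
    by (metis length_map length_rev)
  have "word_length G A (inv x \<otimes> y) \<le> word_length G A (inv y \<otimes> x)"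
    if "x \<in> carrier G" "y \<in> carrier G" for x y
    using inv_le[of "inv y \<otimes> x"] that by (simp add: inv_mult_group)
  then show "word_dist G A x y = word_dist G A y x"
    by (auto simp: word_dist_def intro: antisym)
  show "word_dist G A x y = 0 \<longleftrightarrow> x = y" if xy: "x \<in> carrier G" "y \<in> carrier G"
  proof
    assume "x = y"
    moreover have "is_word G A \<one> []" by (simp add: is_word_def)
    ultimately show "word_dist G A x y = 0" using xy word_length_le by (fastforce simp: word_dist_def)
  next
    assume "word_dist G A x y = 0"
    then have "word_length G A (inv x \<otimes> y) = 0" using xy by (simp add: word_dist_def)
    moreover have "inv x \<otimes> y \<in> generate G A" using xy gen by simp
    ultimately obtain ws where "is_word G A (inv x \<otimes> y) ws" "length ws = 0"
      using word_length_attained[OF A] by metis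
    then have "inv x \<otimes> y = \<one>" by (simp add: is_word_def)
    then show "x = y" using xy by (metis inv_closed inv_equality inv_inv)
  qed
  show "word_dist G A x z \<le> word_dist G A x y + word_dist G A y z"
    if xyz: "x \<in> carrier G" "y \<in> carrier G" "z \<in> carrier G"
  proof -
    obtain us where us: "is_word G A (inv x \<otimes> y) us" "length us = word_length G A (inv x \<otimes> y)"
      using word_length_attained[OF A, of "inv x \<otimes> y"] xyz gen by auto
    obtain vs where vs: "is_word G A (inv y \<otimes> z) vs" "length vs = word_length G A (inv y \<otimes> z)"
      using word_length_attained[OF A, of "inv y \<otimes> z"] xyz gen by auto
    have "inv x \<otimes> z = (inv x \<otimes> y) \<otimes> (inv y \<otimes> z)"
      using xyz by (simp add: m_assoc) (simp flip: m_assoc)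
    then have "word_length G A (inv x \<otimes> z) \<le> length (us @ vs)"
      using is_word_append[OF A us(1) vs(1)] word_length_le by metis
    then show ?thesis using us(2) vs(2) xyz by (simp add: word_dist_def)
  qed
qed

lemma
  assumes "A \<subseteq> carrier G" "generate G A = carrier G"
  shows mspace_word_metric: "mspace (word_metric G A) = carrier G"
    and mdist_word_metric: "mdist (word_metric G A) = word_dist G A"
  using Metric_space.mspace_metric[OF Metric_space_word_dist[OF assms]]
    Metric_space.mdist_metric[OF Metric_space_word_dist[OF assms]]
  by (simp_all add: word_metric_def)

end

section \<open>Hierarchically hyperbolic groups\<close>

text \<open>\<open>A\<close> is the finite generating set whose word metric is used, \<open>act g U\<close> is \<open>gU\<close>, and
  \<open>isom g U\<close> is the isometry from \<open>C U\<close> to \<open>C (gU)\<close> induced by \<open>g\<close>.\<close>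

locale hierarchically_hyperbolic_group =
  group G +
  hierarchically_hyperbolic_space "word_metric G A" \<SS> E C \<pi> nest orth \<rho> \<rho>m +
  action: group_action G \<SS> act
  for G :: "('g, 'm) monoid_scheme" (structure)
    and A :: "'g set"
    and \<SS> :: "'u set"
    and E :: real
    and C :: "'u \<Rightarrow> 'c metric"
    and \<pi> :: "'u \<Rightarrow> 'g \<Rightarrow> 'c"
    and nest :: "'u \<Rightarrow> 'u \<Rightarrow> bool" (infix \<open>\<preceq>\<close> 50)
    and orth :: "'u \<Rightarrow> 'u \<Rightarrow> bool" (infix \<open>\<bottom>\<bottom>\<close> 50)
    and \<rho> :: "'u \<Rightarrow> 'u \<Rightarrow> 'c set"
    and \<rho>m :: "'u \<Rightarrow> 'u \<Rightarrow> 'c \<Rightarrow> 'c set"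
    and act :: "'g \<Rightarrow> 'u \<Rightarrow> 'u"
    and isom :: "'g \<Rightarrow> 'u \<Rightarrow> 'c \<Rightarrow> 'c" +
  assumes generators: "finite A" "A \<subseteq> carrier G" "generate G A = carrier G"
    and cofinite: "finite (orbits G \<SS> act)"
    and act_nest: "\<lbrakk>g \<in> carrier G; U \<in> \<SS>; V \<in> \<SS>\<rbrakk> \<Longrightarrow> act g U \<preceq> act g V \<longleftrightarrow> U \<preceq> V"
    and act_orth: "\<lbrakk>g \<in> carrier G; U \<in> \<SS>; V \<in> \<SS>\<rbrakk> \<Longrightarrow> act g U \<bottom>\<bottom> act g V \<longleftrightarrow> U \<bottom>\<bottom> V"
    and act_transverse: "\<lbrakk>g \<in> carrier G; U \<in> \<SS>; V \<in> \<SS>\<rbrakk> \<Longrightarrow> act g U \<pitchfork> act g V \<longleftrightarrow> U \<pitchfork> V"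
    and iso_isometry: "\<lbrakk>g \<in> carrier G; U \<in> \<SS>\<rbrakk> \<Longrightarrow> isometry (C U) (C (act g U)) (isom g U)"
    and iso_mult: "\<lbrakk>g \<in> carrier G; h \<in> carrier G; U \<in> \<SS>; p \<in> mspace (C U)\<rbrakk> \<Longrightarrow>
      isom (g \<otimes> h) U p = isom g (act h U) (isom h U p)"
    and proj_equivariant: "\<lbrakk>g \<in> carrier G; x \<in> carrier G; U \<in> \<SS>\<rbrakk> \<Longrightarrow>
      isom g U (\<pi> U x) = \<pi> (act g U) (g \<otimes> x)"
    and rho_equivariant: "\<lbrakk>g \<in> carrier G; U \<in> \<SS>; V \<in> \<SS>; U \<pitchfork> V \<or> V \<prec> U\<rbrakk> \<Longrightarrow>
      isom g U ` \<rho> V U = \<rho> (act g V) (act g U)"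
    and bounded_dichotomy: "\<lbrakk>U \<in> \<SS>; diam (C U) (mspace (C U)) > ennreal E\<rbrakk> \<Longrightarrow>
      diam (C U) (mspace (C U)) = \<infinity>"

definition unbounded_domains ::
  "'u set \<Rightarrow> ('u \<Rightarrow> 'c metric) \<Rightarrow> ('u \<Rightarrow> 'g \<Rightarrow> 'c) \<Rightarrow> 'g set \<Rightarrow> 'u set" where
  "unbounded_domains \<SS> C \<pi> H = {U \<in> \<SS>. \<not> bounded_in (C U) (\<pi> U ` H)}"

text \<open>The eyries are the nest-maximal elements of the set of unbounded domains.  Lemma \<open>eyries_eqI\<close>
  below relates this to their characterisation as a set of pairwise orthogonal domains.\<close>

definition eyries ::
  "'u set \<Rightarrow> ('u \<Rightarrow> 'c metric) \<Rightarrow> ('u \<Rightarrow> 'g \<Rightarrow> 'c) \<Rightarrow> ('u \<Rightarrow> 'u \<Rightarrow> bool) \<Rightarrow> 'g set \<Rightarrow> 'u set" where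
  "eyries \<SS> C \<pi> nest H = {W \<in> unbounded_domains \<SS> C \<pi> H.
     \<forall>V \<in> unbounded_domains \<SS> C \<pi> H. nest W V \<longrightarrow> V = W}"

definition Big ::
  "('g, 'm) monoid_scheme \<Rightarrow> 'u set \<Rightarrow> ('u \<Rightarrow> 'c metric) \<Rightarrow> ('u \<Rightarrow> 'g \<Rightarrow> 'c) \<Rightarrow> 'g \<Rightarrow> 'u set" where
  "Big G \<SS> C \<pi> h = unbounded_domains \<SS> C \<pi> (generate G {h})"

text \<open>\<open>h\<close> stabilises \<open>W\<close> and acts loxodromically on \<open>C W\<close>: some orbit map \<open>n \<mapsto> h\<^sup>n p\<close> is a
  quasi-isometric embedding of the integers.\<close>

definition loxodromic_on ::
  "('g, 'm) monoid_scheme \<Rightarrow> ('u \<Rightarrow> 'c metric) \<Rightarrow> ('g \<Rightarrow> 'u \<Rightarrow> 'u) \<Rightarrow> ('g \<Rightarrow> 'u \<Rightarrow> 'c \<Rightarrow> 'c) \<Rightarrow>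
    'g \<Rightarrow> 'u \<Rightarrow> bool" where
  "loxodromic_on G C act isom h W \<longleftrightarrow> act h W = W \<and>
     (\<exists>p \<in> mspace (C W). \<exists>K c.
        qi_embedding K c int_metric (C W) (\<lambda>n. isom (h [^]\<^bsub>G\<^esub> n) W p))"

lemma (in domain_system) eyries_eqI:
  assumes sub: "\<E> \<subseteq> unbounded_domains \<SS> C \<pi> H"
    and orth: "\<And>V W. \<lbrakk>V \<in> \<E>; W \<in> \<E>; V \<noteq> W\<rbrakk> \<Longrightarrow> V \<bottom>\<bottom> W"
    and cover: "\<And>U. U \<in> unbounded_domains \<SS> C \<pi> H \<Longrightarrow> \<exists>W \<in> \<E>. U \<preceq> W"
  shows "\<E> = eyries \<SS> C \<pi> nest H"
proof -
  have S: "unbounded_domains \<SS> C \<pi> H \<subseteq> \<SS>" by (auto simp: unbounded_domains_def)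
  have "V = W" if asm: "W \<in> \<E>" "V \<in> unbounded_domains \<SS> C \<pi> H" "W \<preceq> V" for V W
  proof -
    obtain W' where W': "W' \<in> \<E>" "V \<preceq> W'" using cover asm by blast
    have "W \<preceq> W'" using nest_trans[of W V W'] asm W' sub S by blast
    then have "W = W'" using orth[OF asm(1) W'(1)] orth_incomparable[of W W'] asm W' sub S by blast
    then show ?thesis using nest_antisym[of V W] asm W' sub S by blast
  qed
  moreover have "W \<in> \<E>" if "W \<in> eyries \<SS> C \<pi> nest H" for W
    using that cover sub unfolding eyries_def by blast
  ultimately show ?thesis using sub unfolding eyries_def by blast
qed

end

theory Submission
  imports Defs "HOL-Library.Ramsey"
begin

text \<open>For a domain \<open>W\<close> write \<open>d\<^sub>W(x, y)\<close> for the distance of \<open>\<pi> W x\<close> and \<open>\<pi> W y\<close>. If every element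
  of a subgroup \<open>K\<close> fixes \<open>W\<close>, then \<open>d\<^sub>W\<close> is a left-invariant pseudometric on \<open>K\<close> satisfying
  Gromov's four-point inequality, and \<open>g\<close> is loxodromic on \<open>C W\<close> as soon as some power \<open>g\<^sup>M\<close> has
  \<open>d\<^sub>W(1, g\<^sup>2\<^sup>M)\<close> larger than \<open>d\<^sub>W(1, g\<^sup>M)\<close> by a definite constant. The proof has three parts.

  \<^emph>\<open>The eyries are finite in number and pairwise orthogonal.\<close> Distinct eyries are incomparable,
  and pairwise orthogonal families are finite (\<open>finite_pairwise_orth\<close>), so the point is to exclude
  transverse eyries \<open>V\<close> and \<open>W\<close>. Given elements of \<open>H\<close> loxodromic on \<open>V\<close> and on \<open>W\<close>, a product \<open>a\<close>
  of high powers plays ping-pong: in each domain \<open>a\<^sup>lW\<close> the translates \<open>a\<^sup>iW\<close> with \<open>i < l\<close> and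
  those with \<open>i > l\<close> project far apart (\<open>behrstock_chain\<close>). A segment of the orbit of \<open>a\<close> then
  makes progress in a long list of domains, and by large links such a list can be covered by few
  domains only if one of these sees the progress itself. A minimal level of domains that still
  covers uniformly yields finitely many domains periodic under \<open>a\<close>, and one of them lies strictly
  above some \<open>a\<^sup>iW\<close> and has unbounded projection (\<open>unbounded_domain_above\<close>). This contradicts the
  maximality of eyries.

  \<^emph>\<open>Some element of \<open>H\<close> fixes all eyries and is loxodromic on all of them.\<close> The elements of \<open>H\<close>
  that fix the finitely many eyries form a subgroup \<open>K\<close> containing powers of the given loxodromic
  elements. To combine two elements \<open>f\<close> and \<open>s\<close>, of which in each of the spaces one moves points
  much faster than the other, consider \<open>f\<^sup>ns\<^sup>n\<close>. On a space where \<open>f\<close> is fast this fails to be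
  loxodromic only if \<open>s\<^sup>n\<close> sends the attracting direction of \<open>f\<close> close to the repelling one. If
  this happened for \<open>a\<close> and \<open>a + b\<close>, then \<open>s\<^sup>b\<close> would almost fix the attracting direction, so it
  cannot happen for \<open>b\<close> (\<open>exceptional_exponents_sum_free\<close>). By Schur's theorem finitely many
  sum-free sets do not cover all exponents, which gives \<open>simultaneously_loxodromic\<close> by induction
  on the number of spaces.

  \<^emph>\<open>For such an \<open>h\<close> the big-set is the set of eyries.\<close> A domain in the big-set is unbounded for
  \<open>H\<close>, hence nested in an eyrie \<open>W\<close>. If it were a proper subdomain \<open>U\<close>, then both ends of the
  orbit of \<open>h\<close> in \<open>C W\<close> would move away from the bounded set \<open>\<rho> U W\<close>, and by the bounded geodesic
  image axiom the orbit of \<open>h\<close> in \<open>C U\<close> would be bounded (\<open>bounded_below_axis\<close>).\<close>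

section \<open>Gromov products in slim triangles\<close>

definition gromov_product :: "('a \<Rightarrow> 'a \<Rightarrow> real) \<Rightarrow> 'a \<Rightarrow> 'a \<Rightarrow> 'a \<Rightarrow> real" where
  "gromov_product d w x y = (d w x + d w y - d x y) / 2"

lemma nbhd_near:
  assumes p: "p \<in> nbhd M r S" and r: "0 \<le> r" "r < s"
  shows "\<exists>q \<in> S. mdist M p q < s"
proof -
  have "set_dist M {p} S \<le> ennreal r" using p by (simp add: nbhd_def)
  also have "\<dots> < ennreal s" using r by (simp add: ennreal_less_iff)
  finally obtain q where "q \<in> S" "ennreal (mdist M p q) < ennreal s"
    unfolding set_dist_def by (auto simp: INF_less_iff)
  then show ?thesis by (auto simp: ennreal_less_iff)
qed

lemma geodesic_segment_between:
  assumes "geodesic_segment M x y \<gamma>" "p \<in> \<gamma>"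
  shows "p \<in> mspace M" and "mdist M x p + mdist M p y = mdist M x y"
proof -
  obtain l f where l: "0 \<le> l" and f: "isometric_embedding (interval l) M f" "f 0 = x" "f l = y"
    and \<gamma>: "\<gamma> = f ` {0..l}"
    using assms(1) by (auto simp: geodesic_segment_def)
  obtain t where t: "t \<in> {0..l}" "p = f t" using assms(2) \<gamma> by auto
  have iso: "f s \<in> mspace M" "mdist M (f s) (f s') = \<bar>s - s'\<bar>"
    if "s \<in> {0..l}" "s' \<in> {0..l}" for s s'
    using f(1) that by (auto simp: isometric_embedding_def mspace_submetric mdist_submetric dist_real_def)
  show "p \<in> mspace M" using iso(1) t by auto
  have "mdist M x p = t" "mdist M p y = l - t" "mdist M x y = l"
    using iso(2)[of 0 t] iso(2)[of t l] iso(2)[of 0 l] t l f(2,3) by auto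
  then show "mdist M x p + mdist M p y = mdist M x y" by simp
qed

lemma gromov_product_le_dist_segment:
  assumes "geodesic_segment M x y \<gamma>" "p \<in> \<gamma>"
    and "w \<in> mspace M" "x \<in> mspace M" "y \<in> mspace M"
  shows "gromov_product (mdist M) w x y \<le> mdist M w p"
proof -
  note p = geodesic_segment_between[OF assms(1,2)]
  have "mdist M w x \<le> mdist M w p + mdist M x p" "mdist M w y \<le> mdist M w p + mdist M p y"
    using mdist_triangle[of w M p x] mdist_triangle[of w M p y] p(1) assms
    by (simp_all add: mdist_commute[of M p x])
  then show ?thesis using p(2) by (simp add: gromov_product_def)
qed

text \<open>Along a side of a slim triangle the points close to the second side and the points close to
  the third side cover the side, and each of the two sets contains an endpoint. Hence some point
  is close to both, and such a point is about as far from the opposite vertex as the Gromov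
  product.\<close>

lemma gromov_product_attained:
  assumes hyp: "hyperbolic_space \<delta> M" and \<delta>: "0 \<le> \<delta>"
    and pts: "w \<in> mspace M" "x \<in> mspace M" "y \<in> mspace M"
    and \<gamma>: "geodesic_segment M x y \<gamma>"
  shows "\<exists>p \<in> \<gamma>. mdist M w p \<le> gromov_product (mdist M) w x y + 2 * (\<delta> + 1)"
proof -
  have geo: "\<exists>\<gamma>. geodesic_segment M u v \<gamma>" if "u \<in> mspace M" "v \<in> mspace M" for u v
    using hyp that unfolding hyperbolic_space_def geodesic_space_def by blast
  obtain \<alpha> \<beta> where \<alpha>: "geodesic_segment M x w \<alpha>" and \<beta>: "geodesic_segment M w y \<beta>"
    using geo pts by metis
  have slim: "\<gamma> \<subseteq> nbhd M \<delta> (\<alpha> \<union> \<beta>)"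
    using hyp \<alpha> \<beta> \<gamma> unfolding hyperbolic_space_def by blast
  obtain l f where l: "0 \<le> l" and f: "isometric_embedding (interval l) M f" "f 0 = x" "f l = y"
    and \<gamma>_eq: "\<gamma> = f ` {0..l}"
    using \<gamma> by (auto simp: geodesic_segment_def)
  have iso: "f s \<in> mspace M" "mdist M (f s) (f s') = \<bar>s - s'\<bar>"
    if "s \<in> {0..l}" "s' \<in> {0..l}" for s s'
    using f(1) that by (auto simp: isometric_embedding_def mspace_submetric mdist_submetric dist_real_def)
  have ends: "x \<in> \<alpha>" "y \<in> \<beta>"
    using \<alpha> \<beta> by (auto simp: geodesic_segment_def)
  define near where "near S t \<longleftrightarrow> (\<exists>q \<in> S. mdist M (f t) q < \<delta> + 1/2)" for S t
  have cover: "near \<alpha> t \<or> near \<beta> t" if "t \<in> {0..l}" for t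
  proof -
    have "f t \<in> nbhd M \<delta> (\<alpha> \<union> \<beta>)" using slim \<gamma>_eq that by blast
    from nbhd_near[OF this \<delta>, of "\<delta> + 1/2"] show ?thesis by (auto simp: near_def)
  qed
  \<comment> \<open>the last time near \<open>\<alpha>\<close> need not exist, so two times on either side of the supremum are used\<close>
  define T where "T = {t \<in> {0..l}. near \<alpha> t}"
  have "mdist M (f 0) x = 0" using f(2) pts by simp
  then have "0 \<in> T" using ends(1) l \<delta> by (auto simp: T_def near_def intro!: bexI[of _ x])
  have bdd: "bdd_above T" by (auto simp: T_def bdd_above_def)
  have Sup_le: "Sup T \<le> l" by (rule cSup_least) (use \<open>0 \<in> T\<close> in \<open>auto simp: T_def\<close>)
  obtain t where t: "t \<in> T" "Sup T - 1/4 < t"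
    using less_cSup_iff[of T "Sup T - 1/4"] bdd \<open>0 \<in> T\<close> by auto
  have "t \<le> Sup T" using t bdd by (simp add: cSup_upper)
  have t0: "t \<in> {0..l}" using t by (auto simp: T_def)
  define t' where "t' = min l (Sup T + 1/4)"
  have t': "t' \<in> {0..l}" "\<bar>t - t'\<bar> \<le> 1/2"
    using t(2) \<open>t \<le> Sup T\<close> Sup_le l t0 by (auto simp: t'_def min_def)
  have "near \<beta> t'"
  proof (cases "t' = l")
    case True
    have "mdist M (f l) y = 0" using f(3) pts by simp
    then show ?thesis using ends(2) \<delta> True by (auto simp: near_def intro!: bexI[of _ y])
  next
    case False
    then have "t' > Sup T" by (auto simp: t'_def)
    then have "t' \<notin> T" using bdd cSup_upper by (metis less_le_not_le)
    then show ?thesis using cover[OF t'(1)] t'(1) by (auto simp: T_def)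
  qed
  then obtain r where r: "r \<in> \<beta>" "mdist M (f t') r < \<delta> + 1/2" by (auto simp: near_def)
  obtain q where q: "q \<in> \<alpha>" "mdist M (f t) q < \<delta> + 1/2" using t by (auto simp: T_def near_def)
  define p where "p = f t"
  have p: "p \<in> \<gamma>" "p \<in> mspace M" using t0 iso(1) by (auto simp: p_def \<gamma>_eq)
  note q' = geodesic_segment_between[OF \<alpha> q(1)] and r' = geodesic_segment_between[OF \<beta> r(1)]
    and p' = geodesic_segment_between[OF \<gamma> p(1)]
  have "mdist M p r \<le> mdist M p (f t') + mdist M (f t') r"
    using p iso(1) t'(1) r'(1) by (intro mdist_triangle) auto
  then have pr: "mdist M p r \<le> \<delta> + 1" using iso(2)[OF t0 t'(1)] t'(2) r(2) by (simp add: p_def)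
  have pq: "mdist M p q \<le> \<delta> + 1" using q(2) by (simp add: p_def)
  have "mdist M w p \<le> mdist M q w + mdist M p q" "mdist M x p \<le> mdist M x q + mdist M p q"
    using mdist_triangle[of w M q p] mdist_triangle[of x M q p] p q' pts
    by (simp_all add: mdist_commute)
  moreover have "mdist M w p \<le> mdist M w r + mdist M p r" "mdist M p y \<le> mdist M r y + mdist M p r"
    using mdist_triangle[of w M r p] mdist_triangle[of p M r y] p r' pts
    by (simp_all add: mdist_commute)
  ultimately have "mdist M w p \<le> gromov_product (mdist M) w x y + 2 * (\<delta> + 1)"
    using q' r' p' pr pq by (simp add: gromov_product_def mdist_commute[of M w x] field_simps)
  then show ?thesis using p by blast
qed

text \<open>A point of the side \<open>[x, z]\<close> at distance about the Gromov product of \<open>x\<close> and \<open>z\<close> from \<open>w\<close> is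
  close to one of the other two sides, whose points have distance at least the corresponding
  Gromov product. The summand \<open>1\<close> in the constant is slack for infima and suprema that need not be
  attained.\<close>

lemma four_point_inequality:
  assumes hyp: "hyperbolic_space \<delta> M" and \<delta>: "0 \<le> \<delta>"
    and pts: "w \<in> mspace M" "x \<in> mspace M" "y \<in> mspace M" "z \<in> mspace M"
  shows "min (gromov_product (mdist M) w x y) (gromov_product (mdist M) w y z) - 3 * (\<delta> + 1)
    \<le> gromov_product (mdist M) w x z"
proof -
  have geo: "\<exists>\<gamma>. geodesic_segment M u v \<gamma>" if "u \<in> mspace M" "v \<in> mspace M" for u v
    using hyp that unfolding hyperbolic_space_def geodesic_space_def by blast
  obtain \<alpha> \<beta> \<gamma> where seg: "geodesic_segment M x y \<alpha>" "geodesic_segment M y z \<beta>" "geodesic_segment M x z \<gamma>"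
    using geo[OF pts(2,3)] geo[OF pts(3,4)] geo[OF pts(2,4)] by blast
  have slim: "\<gamma> \<subseteq> nbhd M \<delta> (\<alpha> \<union> \<beta>)"
    using hyp seg unfolding hyperbolic_space_def by blast
  obtain p where p: "p \<in> \<gamma>" "mdist M w p \<le> gromov_product (mdist M) w x z + 2 * (\<delta> + 1)"
    using gromov_product_attained[OF hyp \<delta> pts(1,2,4) seg(3)] by blast
  obtain q where q: "q \<in> \<alpha> \<union> \<beta>" "mdist M p q < \<delta> + 1"
    using nbhd_near[of p M \<delta> "\<alpha> \<union> \<beta>" "\<delta> + 1"] slim p \<delta> by auto
  have q_in: "q \<in> mspace M"
    using q(1) geodesic_segment_between(1)[OF seg(1)] geodesic_segment_between(1)[OF seg(2)] by blast
  have p_in: "p \<in> mspace M" using geodesic_segment_between(1)[OF seg(3) p(1)] .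
  have "min (gromov_product (mdist M) w x y) (gromov_product (mdist M) w y z) \<le> mdist M w q"
    using q(1) gromov_product_le_dist_segment[OF seg(1)] gromov_product_le_dist_segment[OF seg(2)] pts
    by (auto simp: min_le_iff_disj)
  moreover have "mdist M w q \<le> mdist M w p + mdist M p q"
    using pts p_in q_in by (intro mdist_triangle) auto
  ultimately show ?thesis using p(2) q(2) by (simp add: algebra_simps)
qed

section \<open>Schur's theorem\<close>

text \<open>Schur's argument: colour the edge between \<open>i < j\<close> by the colour of \<open>j - i\<close>; the three
  differences of a monochromatic triangle are \<open>a\<close>, \<open>b\<close> and \<open>a + b\<close>.\<close>

lemma schur:
  assumes "finite I"
  shows "\<exists>R \<ge> (1::nat). \<forall>col. (\<forall>j \<in> {1..R}. col j \<in> I) \<longrightarrow>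
    (\<exists>a \<ge> 1. \<exists>b \<ge> 1. a + b \<le> R \<and> col a = col b \<and> col b = col (a + b))"
proof -
  obtain N :: nat where N: "partn_lst {..<N} (replicate (card I) 3) 2"
    using ramsey_full[of "replicate (card I) 3" 2] by blast
  obtain e where e: "bij_betw e I {..<card I}"
    using ex_bij_betw_finite_nat[OF assms] by (auto simp: atLeast0LessThan)
  have "\<exists>a \<ge> 1. \<exists>b \<ge> 1. a + b \<le> Suc N \<and> col a = col b \<and> col b = col (a + b)"
    if col: "\<forall>j \<in> {1..Suc N}. col j \<in> I" for col
  proof -
    define f where "f S = e (col (Max S - Min S))" for S :: "nat set"
    have "f \<in> nsets {..<N} 2 \<rightarrow> {..<length (replicate (card I) (3::nat))}"
    proof
      fix S assume "S \<in> nsets {..<N} 2"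
      then obtain x y where S: "S = {x, y}" "x < N" "y < N" "x < y"
        by (auto simp: ordered_nsets_2_eq)
      have "Max S - Min S \<in> {1..Suc N}" using S by auto
      then show "f S \<in> {..<length (replicate (card I) (3::nat))}"
        using col e by (auto simp: f_def bij_betw_def)
    qed
    then obtain i H where H: "i < card I" "H \<in> nsets {..<N} 3" "f ` nsets H 2 \<subseteq> {i}"
      using N by (auto simp: partn_lst_def monochromatic_def)
    obtain x y z where xyz: "H = {x, y, z}" "z < N" "x < y" "y < z"
      using H(2) by (auto simp: ordered_nsets_3_eq)
    have "{x, y} \<in> nsets H 2" "{y, z} \<in> nsets H 2" "{x, z} \<in> nsets H 2"
      using xyz by auto
    then have "f {x, y} = i" "f {y, z} = i" "f {x, z} = i" using H(3) by blast+
    then have "e (col (y - x)) = i" "e (col (z - y)) = i" "e (col (z - x)) = i"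
      using xyz by (simp_all add: f_def)
    moreover have "{y - x, z - y, z - x} \<subseteq> {1..Suc N}" using xyz by auto
    then have "col (y - x) \<in> I" "col (z - y) \<in> I" "col (z - x) \<in> I" using col by auto
    ultimately have "col (y - x) = col (z - y)" "col (z - y) = col (z - x)"
      using bij_betw_imp_inj_on[OF e] by (metis inj_onD)+
    moreover have "(y - x) + (z - y) = z - x" "y - x \<ge> 1" "z - y \<ge> 1" "z - x \<le> Suc N"
      using xyz by linarith+
    ultimately show ?thesis by metis
  qed
  then show ?thesis by (intro exI[of _ "Suc N"] conjI) (simp, blast)
qed

section \<open>Left-invariant hyperbolic pseudometrics on a group\<close>

text \<open>The pseudometric of an orbit map \<open>g \<mapsto> g p\<close> of an isometric action on a hyperbolic space. All
  that is said below about such actions, including loxodromicity, depends only on this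
  pseudometric, so actions on several spaces become several pseudometrics on the same group.\<close>

locale hyperbolic_length = group G for G (structure) +
  fixes d :: "'a \<Rightarrow> 'a \<Rightarrow> real" and \<delta> :: real
  assumes delta: "0 \<le> \<delta>"
    and self: "x \<in> carrier G \<Longrightarrow> d x x = 0"
    and commute: "\<lbrakk>x \<in> carrier G; y \<in> carrier G\<rbrakk> \<Longrightarrow> d x y = d y x"
    and triangle: "\<lbrakk>x \<in> carrier G; y \<in> carrier G; z \<in> carrier G\<rbrakk> \<Longrightarrow> d x z \<le> d x y + d y z"
    and left_invariant: "\<lbrakk>g \<in> carrier G; x \<in> carrier G; y \<in> carrier G\<rbrakk> \<Longrightarrow> d (g \<otimes> x) (g \<otimes> y) = d x y"
    and four_point: "\<lbrakk>w \<in> carrier G; x \<in> carrier G; y \<in> carrier G; z \<in> carrier G\<rbrakk> \<Longrightarrow>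
      min (gromov_product d w x y) (gromov_product d w y z) - \<delta> \<le> gromov_product d w x z"
begin

lemma nonneg: "\<lbrakk>x \<in> carrier G; y \<in> carrier G\<rbrakk> \<Longrightarrow> 0 \<le> d x y"
  using triangle[of x y x] self[of x] commute[of x y] by simp

lemma length_mult: "\<lbrakk>x \<in> carrier G; y \<in> carrier G\<rbrakk> \<Longrightarrow> d \<one> (x \<otimes> y) \<le> d \<one> x + d \<one> y"
  using triangle[of \<one> x "x \<otimes> y"] left_invariant[of x \<one> y] by simp

lemma dist_eq_length: "\<lbrakk>x \<in> carrier G; y \<in> carrier G\<rbrakk> \<Longrightarrow> d x y = d \<one> (inv x \<otimes> y)"
  using left_invariant[of "inv x" x y] by simp

lemma length_inv: "x \<in> carrier G \<Longrightarrow> d \<one> (inv x) = d \<one> x"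
  using left_invariant[of x \<one> "inv x"] commute[of x \<one>] by simp

lemma length_pow_le: "x \<in> carrier G \<Longrightarrow> d \<one> (x [^] (n::nat)) \<le> real n * d \<one> x"
proof (induction n)
  case (Suc n)
  then show ?case using length_mult[of "x [^] n" x] by (simp add: algebra_simps)
qed (simp add: self)

lemma dist_pow:
  assumes "h \<in> carrier G" "(i::nat) \<le> j"
  shows "d (h [^] i) (h [^] j) = d \<one> (h [^] (j - i))"
proof -
  have "h [^] j = h [^] i \<otimes> h [^] (j - i)" using assms by (simp add: nat_pow_mult)
  then show ?thesis using left_invariant[of "h [^] i" \<one> "h [^] (j - i)"] assms by simp
qed

lemma dist_pow':
  assumes "h \<in> carrier G" "(i::nat) \<le> j"
  shows "d (h [^] j) (h [^] i) = d \<one> (h [^] (j - i))"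
  using dist_pow[OF assms] commute assms by simp

lemma gromov_product_commute:
  "\<lbrakk>x \<in> carrier G; y \<in> carrier G\<rbrakk> \<Longrightarrow> gromov_product d w x y = gromov_product d w y x"
  by (simp add: gromov_product_def commute[of x y])

lemma gromov_product_mult:
  assumes "g \<in> carrier G" "x \<in> carrier G" "y \<in> carrier G"
  shows "gromov_product d \<one> (g \<otimes> x) (g \<otimes> y) \<le> gromov_product d \<one> x y + d \<one> g"
  using length_mult[of g x] length_mult[of g y] left_invariant[of g x y] assms
  by (simp add: gromov_product_def field_simps)

text \<open>If the square of \<open>h\<close> is longer than \<open>h\<close> by more than \<open>3 \<delta>\<close>, then the orbit path of \<open>h\<close> turns
  back by less than half of each step. In a hyperbolic space such local progress persists at all
  scales; this is the following induction on \<open>n\<close>.\<close>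

lemma doubling_growth:
  assumes h: "h \<in> carrier G" and dbl: "d \<one> (h [^] (2::nat)) \<ge> d \<one> h + t" and t: "t > 3 * \<delta>"
  shows "d \<one> (h [^] Suc n) \<ge> d \<one> (h [^] n) + (t - 2 * \<delta>)"
proof (induction n)
  case 0
  have "d \<one> (h [^] (2::nat)) \<le> d \<one> h + d \<one> h"
    using length_mult[OF h h] h by (simp add: numeral_2_eq_2)
  then show ?case using dbl delta h by (simp add: self)
next
  case (Suc n)
  have D: "d (h [^] Suc n) (h [^] n) = d \<one> h" "d (h [^] Suc n) (h [^] (0::nat)) = d \<one> (h [^] Suc n)"
    "d (h [^] n) (h [^] (0::nat)) = d \<one> (h [^] n)"
    "d (h [^] Suc n) (h [^] Suc (Suc n)) = d \<one> h"
    "d (h [^] (0::nat)) (h [^] Suc (Suc n)) = d \<one> (h [^] Suc (Suc n))"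
    "d (h [^] n) (h [^] Suc (Suc n)) = d \<one> (h [^] (2::nat))"
    using dist_pow'[OF h, of n "Suc n"] dist_pow'[OF h, of 0 "Suc n"] dist_pow'[OF h, of 0 n]
      dist_pow[OF h, of "Suc n" "Suc (Suc n)"] dist_pow[OF h, of 0 "Suc (Suc n)"]
      dist_pow[OF h, of n "Suc (Suc n)"] h
    by (simp_all del: nat_pow_Suc add: nat_pow_Suc[of h 0] Suc_diff_le numeral_2_eq_2)
  \<comment> \<open>seen from \<open>h\<^sup>n\<^sup>+\<^sup>1\<close>, the point \<open>h\<^sup>n\<close> is in the direction of \<open>1\<close> but not in the direction of \<open>h\<^sup>n\<^sup>+\<^sup>2\<close>\<close>
  have "min (gromov_product d (h [^] Suc n) (h [^] n) (h [^] (0::nat)))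
      (gromov_product d (h [^] Suc n) (h [^] (0::nat)) (h [^] Suc (Suc n))) - \<delta>
    \<le> gromov_product d (h [^] Suc n) (h [^] n) (h [^] Suc (Suc n))"
    by (rule four_point) (use h in auto)
  then show ?case using Suc dbl t delta unfolding gromov_product_def D
    by (auto simp: min_def field_simps split: if_splits simp del: nat_pow_Suc)
qed

lemma doubling_growth_add:
  fixes n m :: nat
  assumes h: "h \<in> carrier G" and dbl: "d \<one> (h [^] (2::nat)) \<ge> d \<one> h + t" and t: "t > 3 * \<delta>"
  shows "d \<one> (h [^] (n + m)) \<ge> d \<one> (h [^] n) + real m * (t - 2 * \<delta>)"
proof (induction m)
  case (Suc m)
  then show ?case using doubling_growth[OF assms, of "n + m"] by (simp add: algebra_simps)
qed simp

lemma doubling_growth_linear: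
  fixes n :: nat
  assumes h: "h \<in> carrier G" and dbl: "d \<one> (h [^] (2::nat)) \<ge> d \<one> h + t" and t: "t > 3 * \<delta>"
  shows "d \<one> (h [^] n) \<ge> real n * (t - 2 * \<delta>)"
  using doubling_growth_add[OF assms, of 0 n] by (simp add: self)

text \<open>Consequently the orbit path is nearly additive: its points lie uniformly close to a
  geodesic.\<close>

lemma doubling_almost_additive:
  fixes n m :: nat
  assumes h: "h \<in> carrier G" and dbl: "d \<one> (h [^] (2::nat)) \<ge> d \<one> h + t" and t: "t > 3 * \<delta>"
  shows "d \<one> (h [^] n) + d \<one> (h [^] m) - d \<one> (h [^] (n + m)) \<le> d \<one> h + 2 * \<delta>"
proof (cases m)
  case 0
  then show ?thesis using h nonneg[of \<one> h] delta by (simp add: self)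
next
  case (Suc k)
  have D: "d (h [^] n) (h [^] (0::nat)) = d \<one> (h [^] n)"
    "d (h [^] n) (h [^] (n + m)) = d \<one> (h [^] m)"
    "d (h [^] (0::nat)) (h [^] (n + m)) = d \<one> (h [^] (n + m))"
    "d (h [^] n) (h [^] Suc n) = d \<one> h"
    "d (h [^] (n + m)) (h [^] Suc n) = d \<one> (h [^] k)"
    "d (h [^] (0::nat)) (h [^] Suc n) = d \<one> (h [^] Suc n)"
    using dist_pow'[OF h, of 0 n] dist_pow[OF h, of n "n + m"] dist_pow[OF h, of 0 "n + m"]
      dist_pow[OF h, of n "Suc n"] dist_pow'[OF h, of "Suc n" "n + m"] dist_pow[OF h, of 0 "Suc n"] h Suc
    by (simp_all del: nat_pow_Suc add: nat_pow_Suc[of h 0] Suc_diff_le)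
  have "min (gromov_product d (h [^] n) (h [^] (0::nat)) (h [^] (n + m)))
      (gromov_product d (h [^] n) (h [^] (n + m)) (h [^] Suc n)) - \<delta>
    \<le> gromov_product d (h [^] n) (h [^] (0::nat)) (h [^] Suc n)"
    by (rule four_point) (use h in auto)
  moreover have "d \<one> (h [^] m) \<ge> d \<one> (h [^] k) + (t - 2 * \<delta>)"
    using doubling_growth[OF assms, of k] Suc by simp
  ultimately show ?thesis
    using doubling_growth[OF assms, of n] t delta
    unfolding gromov_product_def D min_def
    by (simp only: split: if_splits) argo+
qed

text \<open>Linear growth of the orbit, expressed by a single exponent. Any margin strictly above the
  threshold \<open>3 \<delta>\<close> of \<open>doubling_growth\<close> would define the same property.\<close>

definition loxodromic :: "'a \<Rightarrow> bool" where
  "loxodromic g \<longleftrightarrow> (\<exists>M \<ge> (1::nat). d \<one> (g [^] (2 * M)) \<ge> d \<one> (g [^] M) + 3 * \<delta> + 1)"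

text \<open>Taking all multiples of one exponent allows finitely many loxodromic conditions, on
  different spaces, to be met by a common power; the arbitrary margin \<open>t\<close> makes the power fast
  compared with any given element.\<close>

lemma loxodromic_powers:
  assumes g: "g \<in> carrier G" and "loxodromic g"
  shows "\<exists>M \<ge> (1::nat). \<forall>n. M dvd n \<longrightarrow> n \<ge> 1 \<longrightarrow> d \<one> (g [^] (2 * n)) \<ge> d \<one> (g [^] n) + t"
proof -
  obtain M :: nat where M: "M \<ge> 1" "d \<one> (g [^] (2 * M)) \<ge> d \<one> (g [^] M) + 3 * \<delta> + 1"
    using assms(2) by (auto simp: loxodromic_def)
  define k where "k = nat \<lceil>\<bar>t\<bar>\<rceil> + 1"
  have "d \<one> (g [^] (2 * n)) \<ge> d \<one> (g [^] n) + t" if n: "M * k dvd n" "n \<ge> 1" for n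
  proof -
    obtain j where j: "n = M * k * j" using n by (auto elim: dvdE)
    have "j \<ge> 1" using n(2) j by (cases j) auto
    have "d \<one> ((g [^] M) [^] (k * j + k * j)) \<ge> d \<one> ((g [^] M) [^] (k * j)) + real (k * j) * (3 * \<delta> + 1 - 2 * \<delta>)"
      by (rule doubling_growth_add) (use M g in \<open>simp_all add: nat_pow_pow mult.commute\<close>)
    moreover have "real (k * j) * (3 * \<delta> + 1 - 2 * \<delta>) \<ge> real k * 1"
    proof (rule mult_mono)
      have "k * 1 \<le> k * j" using \<open>j \<ge> 1\<close> by (intro mult_le_mono2)
      then show "real k \<le> real (k * j)" by (simp only: of_nat_le_iff mult_1_right)
    qed (use delta in auto)
    moreover have "real k \<ge> t" by (simp add: k_def) linarith
    moreover have "(g [^] M) [^] (k * j + k * j) = g [^] (2 * n)" "(g [^] M) [^] (k * j) = g [^] n"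
      using g by (simp_all add: nat_pow_pow j mult.assoc mult_2 distrib_left)
    ultimately show ?thesis by simp
  qed
  then show ?thesis using M(1) by (intro exI[of _ "M * k"]) (auto simp: k_def)
qed

text \<open>Otherwise each doubling of the exponent adds at most a constant, so the length along powers
  of two would grow only linearly in the number of doublings.\<close>

lemma loxodromic_if_linear_growth:
  assumes g: "g \<in> carrier G" and c: "c > 0"
    and growth: "\<And>n::nat. d \<one> (g [^] n) \<ge> c * real n - b"
  shows "loxodromic g"
proof (rule ccontr)
  assume "\<not> loxodromic g"
  then have step: "d \<one> (g [^] (2 * M)) \<le> d \<one> (g [^] M) + (3 * \<delta> + 1)" if "M \<ge> 1" for M :: nat
  proof -
    have "\<not> d \<one> (g [^] (2 * M)) \<ge> d \<one> (g [^] M) + 3 * \<delta> + 1"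
      using \<open>\<not> loxodromic g\<close> that unfolding loxodromic_def by blast
    then show ?thesis by linarith
  qed
  have "d \<one> (g [^] ((2::nat) ^ k)) \<le> d \<one> g + real k * (3 * \<delta> + 1)" for k
  proof (induction k)
    case (Suc k)
    then show ?case using step[of "2 ^ k"] by (simp add: algebra_simps)
  qed (use g in simp)
  then have bound: "c * 2 ^ k - b \<le> d \<one> g + real k * (3 * \<delta> + 1)" for k
    using order_trans[OF growth[of "2 ^ k"]] by simp
  define B where "B = 3 * \<delta> + 1"
  obtain j :: nat where j: "real j > (\<bar>d \<one> g + b\<bar> + 2 * B) / c" using reals_Archimedean2 by blast
  have "B \<ge> 1" using delta by (simp add: B_def)
  then have "(\<bar>d \<one> g + b\<bar> + 2 * B) / c \<ge> 0" using c by simp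
  then have "j \<ge> 1" using j by linarith
  have "c * real j > \<bar>d \<one> g + b\<bar> + 2 * B" using j c by (simp add: field_simps)
  then have "c * real j * real j > (\<bar>d \<one> g + b\<bar> + 2 * B) * real j"
    using \<open>j \<ge> 1\<close> by (intro mult_strict_right_mono) auto
  moreover have "\<bar>d \<one> g + b\<bar> * real j \<ge> \<bar>d \<one> g + b\<bar> * 1"
    using \<open>j \<ge> 1\<close> by (intro mult_left_mono) auto
  moreover have "c * real j * real j \<le> c * 2 ^ (j + j)"
  proof -
    have "real j \<le> 2 ^ j" by (simp add: less_imp_le of_nat_less_two_power)
    then have "real j * real j \<le> 2 ^ j * 2 ^ j" by (intro mult_mono) auto
    then show ?thesis using c by (simp add: power_add)
  qed
  ultimately show False using bound[of "j + j"] by (simp add: B_def algebra_simps)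
qed

text \<open>An element that is not loxodromic may still have unbounded orbits, but it moves points at
  sublinear speed: if every power had length at least \<open>\<epsilon> / 2\<close> times its exponent, the growth would
  be linear, so some power \<open>q\<close> is short, and by subadditivity it controls all large exponents.\<close>

lemma not_loxodromic_sublinear:
  assumes g: "g \<in> carrier G" and nl: "\<not> loxodromic g" and e: "\<epsilon> > 0"
  shows "\<exists>N::nat. \<forall>n \<ge> N. d \<one> (g [^] n) \<le> \<epsilon> * real n"
proof -
  have "\<exists>q \<ge> 1. d \<one> (g [^] q) \<le> \<epsilon> / 2 * real q"
  proof (rule ccontr)
    assume none: "\<not> (\<exists>q \<ge> 1. d \<one> (g [^] q) \<le> \<epsilon> / 2 * real q)"
    have big: "\<epsilon> / 2 * real q < d \<one> (g [^] q)" if "q \<ge> 1" for q :: nat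
      using none that not_le by blast
    have "d \<one> (g [^] n) \<ge> \<epsilon> / 2 * real n - 0" for n
      using big[of n] nonneg[of \<one> "\<one>"] by (cases n) (auto simp: self less_imp_le simp del: nat_pow_Suc)
    then have "loxodromic g" using loxodromic_if_linear_growth[of g "\<epsilon> / 2" 0] g e by auto
    then show False using nl by simp
  qed
  then obtain q :: nat where q: "q \<ge> 1" "d \<one> (g [^] q) \<le> \<epsilon> / 2 * real q" by blast
  have "d \<one> (g [^] n) \<le> \<epsilon> * real n" if n: "n \<ge> nat \<lceil>2 * real q * d \<one> g / \<epsilon>\<rceil>" for n
  proof -
    have n_eq: "n = q * (n div q) + n mod q" by simp
    have "g [^] n = (g [^] q) [^] (n div q) \<otimes> g [^] (n mod q)"
      using g by (simp add: nat_pow_pow nat_pow_mult)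
    then have "d \<one> (g [^] n) \<le> d \<one> ((g [^] q) [^] (n div q)) + d \<one> (g [^] (n mod q))"
      using g length_mult by simp
    also have "\<dots> \<le> real (n div q) * d \<one> (g [^] q) + real (n mod q) * d \<one> g"
      using length_pow_le g by (intro add_mono) auto
    also have "\<dots> \<le> real (n div q) * (\<epsilon> / 2 * real q) + real q * d \<one> g"
      using q g nonneg[of \<one> g] by (intro add_mono mult_left_mono mult_right_mono) (auto simp: less_imp_le)
    also have "real (n div q) * (\<epsilon> / 2 * real q) \<le> \<epsilon> / 2 * real n"
    proof -
      have "real (n div q) * real q \<le> real n"
        by (metis div_times_less_eq_dividend of_nat_le_iff of_nat_mult)
      then show ?thesis using e by (simp add: field_simps)
    qed
    also have "real q * d \<one> g \<le> \<epsilon> / 2 * real n"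
    proof -
      have "2 * real q * d \<one> g / \<epsilon> \<le> real n" using n by linarith
      then show ?thesis using e by (simp add: field_simps)
    qed
    finally show ?thesis by simp
  qed
  then show ?thesis by blast
qed

end

section \<open>Simultaneously loxodromic elements\<close>

context hyperbolic_length
begin

lemma gromov_product_trans:
  assumes "m \<le> gromov_product d w x y" "m \<le> gromov_product d w y z"
    and "w \<in> carrier G" "x \<in> carrier G" "y \<in> carrier G" "z \<in> carrier G"
  shows "m - \<delta> \<le> gromov_product d w x z"
  using four_point[of w x y z] assms by (auto simp: min_def split: if_splits)

text \<open>The broken path \<open>1, F, F S, F S F\<close> fails to be efficient only if \<open>S F\<close> points in the same
  direction as \<open>F\<^sup>-\<^sup>1\<close>. Both orders of the factors are needed, since the faster element may be
  either factor.\<close>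

lemma product_doubles:
  assumes F: "F \<in> carrier G" and S: "S \<in> carrier G"
    and long: "d \<one> F \<ge> 2 * gromov_product d \<one> (inv F) (S \<otimes> F) + 3 * d \<one> S + t"
  shows "d \<one> ((F \<otimes> S) [^] (2::nat)) \<ge> d \<one> (F \<otimes> S) + t"
    and "d \<one> ((S \<otimes> F) [^] (2::nat)) \<ge> d \<one> (S \<otimes> F) + t"
proof -
  have "d (inv F) (S \<otimes> F) = d \<one> (F \<otimes> (S \<otimes> F))"
    using dist_eq_length[of "inv F" "S \<otimes> F"] F S by simp
  then have gp: "2 * gromov_product d \<one> (inv F) (S \<otimes> F) = d \<one> F + d \<one> (S \<otimes> F) - d \<one> (F \<otimes> (S \<otimes> F))"
    using length_inv[OF F] by (simp add: gromov_product_def)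
  have "inv S \<otimes> (S \<otimes> F) = F" using F S by (simp flip: m_assoc)
  then have SF: "d \<one> F \<le> d \<one> S + d \<one> (S \<otimes> F)"
    using length_mult[of "inv S" "S \<otimes> F"] length_inv[OF S] F S by simp
  have sq: "(F \<otimes> S) [^] (2::nat) = F \<otimes> (S \<otimes> F) \<otimes> S" "(S \<otimes> F) [^] (2::nat) = S \<otimes> (F \<otimes> (S \<otimes> F))"
    using F S by (simp_all add: numeral_2_eq_2 m_assoc)
  have "F \<otimes> (S \<otimes> F) = (F \<otimes> S) [^] (2::nat) \<otimes> inv S" "F \<otimes> (S \<otimes> F) = inv S \<otimes> (S \<otimes> F) [^] (2::nat)"
    unfolding sq using F S by (simp_all add: m_assoc) (simp flip: m_assoc)
  then have "d \<one> (F \<otimes> (S \<otimes> F)) \<le> d \<one> ((F \<otimes> S) [^] (2::nat)) + d \<one> S"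
    "d \<one> (F \<otimes> (S \<otimes> F)) \<le> d \<one> S + d \<one> ((S \<otimes> F) [^] (2::nat))"
    using length_mult[of "(F \<otimes> S) [^] (2::nat)" "inv S"] length_mult[of "inv S" "(S \<otimes> F) [^] (2::nat)"]
      length_inv[OF S] F S by simp_all
  then show "d \<one> ((F \<otimes> S) [^] (2::nat)) \<ge> d \<one> (F \<otimes> S) + t"
    "d \<one> ((S \<otimes> F) [^] (2::nat)) \<ge> d \<one> (S \<otimes> F) + t"
    using gp SF long length_mult[OF F S] length_mult[OF S F] by linarith+
qed

text \<open>The exponents \<open>k\<close> for which \<open>product_doubles\<close> does not apply to \<open>f\<^sup>k\<close> and \<open>s\<^sup>k\<close> are those
  for which \<open>s\<^sup>k\<close> sends the attracting direction of \<open>f\<close> close to the repelling one. If \<open>a\<close>, \<open>b\<close>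
  and \<open>a + b\<close> were all of this kind, then \<open>s\<^sup>b\<close> would send the attracting direction close to
  itself and close to the repelling direction, although these two are far apart. The hypothesis
  \<open>large\<close> says that the displacement \<open>\<mu>\<close> of the powers of \<open>s\<close> is too small to spoil these
  comparisons; this covers elliptic and parabolic \<open>s\<close> as well as loxodromic ones that are slow
  compared with \<open>f\<close>.\<close>

lemma exceptional_exponents_sum_free:
  fixes a b :: nat
  assumes f: "f \<in> carrier G" and dbl: "d \<one> (f [^] (2::nat)) \<ge> d \<one> f + t" and t: "t > 3 * \<delta>"
    and s: "s \<in> carrier G" and slow: "\<And>k. k \<in> {a, b, a + b} \<Longrightarrow> d \<one> (s [^] k) \<le> \<mu>"
    and N: "N \<le> real a" "N \<le> real b"
    and u: "0 \<le> u"
    and large: "N * (t - 2 * \<delta>) > 5 * \<mu> + u + 10 * \<delta> + d \<one> f"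
  shows "\<exists>k \<in> {a, b, a + b}. d \<one> (f [^] k) \<ge>
    2 * gromov_product d \<one> (inv (f [^] k)) (s [^] k \<otimes> f [^] k) + 3 * d \<one> (s [^] k) + u"
proof (rule ccontr)
  assume bad: "\<not> ?thesis"
  define \<sigma> where "\<sigma> = t - 2 * \<delta>"
  define \<beta> where "\<beta> = (N * \<sigma> - 3 * \<mu> - u) / 2"
  have \<sigma>: "\<sigma> > 0" using t delta by (simp add: \<sigma>_def)
  have pos: "0 \<le> \<mu>" using slow[of a] nonneg[of \<one> "s [^] a"] s by auto
  note add = doubling_growth_add[OF f dbl t, folded \<sigma>_def]
    and lin = doubling_growth_linear[OF f dbl t, folded \<sigma>_def]
  have N\<sigma>: "N * \<sigma> \<le> real a * \<sigma>" "N * \<sigma> \<le> real b * \<sigma>" "N * \<sigma> \<le> real (a + b) * \<sigma>"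
    using N \<sigma> by (auto intro: mult_right_mono)
  have "0 < N * \<sigma>" using large pos u delta nonneg[of \<one> f] f by (simp add: \<sigma>_def)
  then have \<beta>: "\<beta> \<le> N * \<sigma>" using pos u by (simp add: \<beta>_def)
  define c where "c = a + b"
  have gp_bad: "\<beta> \<le> gromov_product d \<one> (inv (f [^] k)) (s [^] k \<otimes> f [^] k)" if k: "k \<in> {a, b, c}" for k
  proof -
    have "d \<one> (f [^] k) < 2 * gromov_product d \<one> (inv (f [^] k)) (s [^] k \<otimes> f [^] k) + 3 * d \<one> (s [^] k) + u"
      using bad k by (auto simp: c_def not_le)
    moreover have "N * \<sigma> \<le> d \<one> (f [^] k)" using lin[of k] N\<sigma> k by (auto simp: c_def)
    ultimately show ?thesis using slow[of k] k by (simp add: \<beta>_def c_def)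
  qed
  have fc: "f [^] c = f [^] b \<otimes> f [^] a" "f [^] c = f [^] a \<otimes> f [^] b"
    using f by (simp_all add: nat_pow_mult c_def add.commute)
  have sc: "s [^] c = s [^] a \<otimes> s [^] b"
    using s by (simp_all add: nat_pow_mult c_def)
  have add_ab: "d \<one> (f [^] c) \<ge> d \<one> (f [^] b) + real a * \<sigma>" "d \<one> (f [^] c) \<ge> d \<one> (f [^] a) + real b * \<sigma>"
    using add[of b a] add[of a b] by (simp_all add: c_def add.commute)
  have "d (inv (f [^] c)) (inv (f [^] a)) = d \<one> (f [^] b)"
    using dist_eq_length[of "inv (f [^] c)" "inv (f [^] a)"] f fc(1) by (simp add: m_assoc)
  then have backward: "\<beta> \<le> gromov_product d \<one> (inv (f [^] c)) (inv (f [^] a))"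
    using add_ab lin[of a] N\<sigma> \<beta> f by (simp add: gromov_product_def length_inv)
  have "d (f [^] b) (f [^] c) = d \<one> (f [^] a)"
    using dist_pow[OF f, of b c] by (simp add: c_def)
  then have forward: "\<beta> \<le> gromov_product d \<one> (f [^] b) (f [^] c)"
    using add_ab lin[of b] N\<sigma> \<beta> by (simp add: gromov_product_def)
  have in_G: "inv (f [^] k) \<in> carrier G" "f [^] k \<in> carrier G" "s [^] k \<in> carrier G"
    "s [^] k \<otimes> f [^] l \<in> carrier G" for k l :: nat
    using f s by auto
  \<comment> \<open>\<open>s\<^sup>a\<close> and \<open>s\<^sup>c\<close> both send the attracting direction of \<open>f\<close> to the repelling one\<close>
  have "\<beta> - \<delta> \<le> gromov_product d \<one> (s [^] c \<otimes> f [^] c) (inv (f [^] a))"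
    by (rule gromov_product_trans[OF _ backward]) 
      (use gp_bad[of c] gromov_product_commute[OF in_G(4)[of c c] in_G(1)[of c]] in_G in auto)
  then have "(\<beta> - \<delta>) - \<delta> \<le> gromov_product d \<one> (s [^] c \<otimes> f [^] c) (s [^] a \<otimes> f [^] a)"
    by (rule gromov_product_trans[of _ _ _ "inv (f [^] a)"]) (use gp_bad[of a] delta in_G in auto)
  \<comment> \<open>so their quotient \<open>s\<^sup>b\<close> roughly fixes the attracting direction\<close>
  moreover have "s [^] c \<otimes> f [^] c = s [^] a \<otimes> (s [^] b \<otimes> f [^] c)"
    unfolding sc using f s by (simp add: m_assoc)
  ultimately have "\<beta> - 2 * \<delta> \<le> gromov_product d \<one> (s [^] b \<otimes> f [^] c) (f [^] a) + d \<one> (s [^] a)"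
    using gromov_product_mult[of "s [^] a" "s [^] b \<otimes> f [^] c" "f [^] a"] in_G by simp
  then have fix1: "\<beta> - 2 * \<delta> - \<mu> \<le> gromov_product d \<one> (s [^] b \<otimes> f [^] c) (f [^] a)"
    using slow[of a] by simp
  have "gromov_product d \<one> (f [^] b) (f [^] c) - d \<one> (inv (s [^] b)) \<le>
      gromov_product d \<one> (s [^] b \<otimes> f [^] b) (s [^] b \<otimes> f [^] c)"
    using gromov_product_mult[of "inv (s [^] b)" "s [^] b \<otimes> f [^] b" "s [^] b \<otimes> f [^] c"] f s
    by (simp flip: m_assoc)
  then have near: "\<beta> - \<mu> \<le> gromov_product d \<one> (s [^] b \<otimes> f [^] b) (s [^] b \<otimes> f [^] c)"
    using forward slow[of b] s by (simp add: length_inv)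
  \<comment> \<open>but \<open>s\<^sup>b\<close> also sends it to the repelling direction\<close>
  have fix2: "(\<beta> - \<mu>) - \<delta> \<le> gromov_product d \<one> (inv (f [^] b)) (s [^] b \<otimes> f [^] c)"
    by (rule gromov_product_trans[of _ _ _ "s [^] b \<otimes> f [^] b"]) (use near gp_bad[of b] pos in_G in auto)
  have "(\<beta> - 2 * \<delta> - \<mu>) - \<delta> \<le> gromov_product d \<one> (inv (f [^] b)) (f [^] a)"
    by (rule gromov_product_trans[of _ _ _ "s [^] b \<otimes> f [^] c"]) (use fix1 fix2 delta in_G in auto)
  moreover have "d (inv (f [^] b)) (f [^] a) = d \<one> (f [^] c)"
    using dist_eq_length[of "inv (f [^] b)" "f [^] a"] f fc by simp
  then have "gromov_product d \<one> (inv (f [^] b)) (f [^] a) \<le> (d \<one> f + 2 * \<delta>) / 2"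
    using doubling_almost_additive[OF f dbl t, of a b] f
    by (simp add: gromov_product_def length_inv c_def)
  moreover have "2 * \<beta> = N * \<sigma> - 3 * \<mu> - u" by (simp add: \<beta>_def)
  ultimately show False using large[folded \<sigma>_def] delta by argo
qed

text \<open>The factor \<open>10 R\<close> leaves room for the exponents up to \<open>R n\<close> that Schur's theorem may select
  from the multiples of \<open>n\<close>.\<close>

definition outpaces :: "nat \<Rightarrow> 'a \<Rightarrow> 'a \<Rightarrow> bool" where
  "outpaces R f s \<longleftrightarrow> f \<in> carrier G \<and> s \<in> carrier G \<and>
    (\<exists>t > 3 * \<delta>. d \<one> (f [^] (2::nat)) \<ge> d \<one> f + t \<and>
      (\<exists>N::nat. \<forall>n \<ge> N. d \<one> (s [^] n) \<le> (t - 2 * \<delta>) / (10 * real R) * real n))"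

text \<open>The case \<open>M = 1\<close> of the criterion for being loxodromic, so that \<open>doubling_growth\<close> applies to
  \<open>h\<close> itself.\<close>

definition doubles :: "'a \<Rightarrow> bool" where
  "doubles h \<longleftrightarrow> d \<one> (h [^] (2::nat)) \<ge> d \<one> h + 3 * \<delta> + 1"

lemma outpaces_product_doubles:
  assumes out: "outpaces R f s" and R: "R \<ge> 1"
  shows "\<exists>N::nat. \<forall>n \<ge> N. \<forall>a \<ge> 1. \<forall>b \<ge> 1. a + b \<le> R \<longrightarrow>
    (\<exists>k \<in> {a, b, a + b}. doubles (f [^] (k * n) \<otimes> s [^] (k * n)) \<and> doubles (s [^] (k * n) \<otimes> f [^] (k * n)))"
proof -
  obtain t N0 where t: "t > 3 * \<delta>" and dbl: "d \<one> (f [^] (2::nat)) \<ge> d \<one> f + t"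
    and N0: "\<And>n. n \<ge> N0 \<Longrightarrow> d \<one> (s [^] n) \<le> (t - 2 * \<delta>) / (10 * real R) * real n"
    using out by (auto simp: outpaces_def)
  have f: "f \<in> carrier G" and s: "s \<in> carrier G" using out by (auto simp: outpaces_def)
  define \<sigma> where "\<sigma> = t - 2 * \<delta>"
  have \<sigma>: "\<sigma> > 0" using t delta by (simp add: \<sigma>_def)
  define u where "u = 3 * \<delta> + 1"
  define N where "N = max (max 1 N0) (nat \<lceil>2 * (u + 10 * \<delta> + d \<one> f) / \<sigma>\<rceil> + 1)"
  have "\<exists>k \<in> {a, b, a + b}. doubles (f [^] (k * n) \<otimes> s [^] (k * n)) \<and> doubles (s [^] (k * n) \<otimes> f [^] (k * n))"
    if n: "n \<ge> N" and ab: "a \<ge> 1" "b \<ge> 1" "a + b \<le> R" for n a b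
  proof -
    define \<mu> where "\<mu> = real n * \<sigma> / 10"
    have n': "n \<ge> 1" "n \<ge> N0" "2 * (u + 10 * \<delta> + d \<one> f) / \<sigma> < real n"
      using n unfolding N_def by linarith+
    have slow: "d \<one> (s [^] k) \<le> \<mu>" if k: "k \<in> {a * n, b * n, a * n + b * n}" for k
    proof -
      have "(a + b) * n \<le> R * n" using ab(3) by (rule mult_le_mono1)
      moreover have "k \<le> (a + b) * n" using k by (auto simp: add_mult_distrib)
      ultimately have "k \<le> R * n" by linarith
      have "1 * n \<le> a * n" "1 * n \<le> b * n" using ab by (intro mult_le_mono1; simp)+
      then have "n \<le> k" using k by (elim insertE emptyE) linarith+
      then have "k \<ge> N0" using n'(2) by linarith
      then have "d \<one> (s [^] k) \<le> \<sigma> / (10 * real R) * real k" using N0 by (simp add: \<sigma>_def)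
      also have "\<dots> \<le> \<sigma> / (10 * real R) * real (R * n)"
        using \<open>k \<le> R * n\<close> \<sigma> by (intro mult_left_mono) (auto simp del: of_nat_mult)
      also have "\<dots> = \<mu>" using R by (simp add: \<mu>_def field_simps)
      finally show ?thesis .
    qed
    have "real n * \<sigma> > 5 * \<mu> + u + 10 * \<delta> + d \<one> f"
      using n'(3) \<sigma> by (simp add: \<mu>_def field_simps)
    moreover have "real n \<le> real (a * n)" "real n \<le> real (b * n)"
      using ab by (simp_all add: mult_le_cancel_right1)
    moreover have "0 \<le> u" using delta by (simp add: u_def)
    ultimately obtain k where k: "k \<in> {a * n, b * n, a * n + b * n}" and
      "d \<one> (f [^] k) \<ge> 2 * gromov_product d \<one> (inv (f [^] k)) (s [^] k \<otimes> f [^] k) + 3 * d \<one> (s [^] k) + u"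
      using exceptional_exponents_sum_free[OF f dbl t s slow, where a = "a * n" and b = "b * n" and N = "real n" and u = u]
      unfolding \<sigma>_def by blast
    then have "doubles (f [^] k \<otimes> s [^] k)" "doubles (s [^] k \<otimes> f [^] k)"
      using product_doubles[of "f [^] k" "s [^] k" u] f s by (auto simp: doubles_def u_def)
    moreover have "k \<in> (\<lambda>k. k * n) ` {a, b, a + b}" using k by (auto simp: add_mult_distrib)
    ultimately show ?thesis by auto
  qed
  then show ?thesis by blast
qed

lemma doubles_imp_loxodromic: "h \<in> carrier G \<Longrightarrow> doubles h \<Longrightarrow> loxodromic h"
  unfolding doubles_def loxodromic_def by (intro exI[of _ "1::nat"]) simp

end

text \<open>If every multiple of \<open>n\<close> up to \<open>R n\<close> failed on some space, colouring it by such a space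
  would produce a monochromatic triple \<open>a, b, a + b\<close>, which \<open>outpaces_product_doubles\<close> excludes.\<close>

lemma (in group) simultaneously_doubling_product:
  assumes I: "finite I" and hyp: "\<And>i. i \<in> I \<Longrightarrow> hyperbolic_length G (d i) \<delta>"
    and R: "R \<ge> 1" "\<And>col. (\<forall>j \<in> {1..R}. col j \<in> I) \<Longrightarrow>
      (\<exists>a \<ge> 1. \<exists>b \<ge> 1. a + b \<le> R \<and> col a = col b \<and> col b = col (a + b))"
    and out: "\<And>i. i \<in> I \<Longrightarrow> hyperbolic_length.outpaces G (d i) \<delta> R f s \<or>
      hyperbolic_length.outpaces G (d i) \<delta> R s f"
  shows "\<exists>n::nat. \<forall>i \<in> I. hyperbolic_length.doubles G (d i) \<delta> (f [^] n \<otimes> s [^] n)"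
proof -
  define good where "good i n \<longleftrightarrow> hyperbolic_length.doubles G (d i) \<delta> (f [^] n \<otimes> s [^] n)"
    for i and n :: nat
  have "\<exists>N::nat. \<forall>n \<ge> N. \<forall>a \<ge> 1. \<forall>b \<ge> 1. a + b \<le> R \<longrightarrow> (\<exists>k \<in> {a, b, a + b}. good i (k * n))"
    if "i \<in> I" for i
    using out[OF that] hyperbolic_length.outpaces_product_doubles[OF hyp[OF that] _ R(1)]
    unfolding good_def by meson
  then obtain N :: "_ \<Rightarrow> nat" where N: "\<And>i n a b. \<lbrakk>i \<in> I; n \<ge> N i; a \<ge> 1; b \<ge> 1; a + b \<le> R\<rbrakk> \<Longrightarrow>
      \<exists>k \<in> {a, b, a + b}. good i (k * n)"
    by metis
  define n where "n = (\<Sum>i \<in> I. N i)"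
  have n: "n \<ge> N i" if "i \<in> I" for i
    unfolding n_def using that I by (intro member_le_sum) auto
  have "\<exists>j \<in> {1..R}. \<forall>i \<in> I. good i (j * n)"
  proof (rule ccontr)
    assume "\<not> ?thesis"
    then have "\<forall>j \<in> {1..R}. \<exists>i. i \<in> I \<and> \<not> good i (j * n)" by blast
    then obtain col where col: "\<forall>j \<in> {1..R}. col j \<in> I \<and> \<not> good (col j) (j * n)" by metis
    then obtain a b where ab: "a \<ge> 1" "b \<ge> 1" "a + b \<le> R" "col a = col b" "col b = col (a + b)"
      using R(2)[of col] by auto
    have mem: "a \<in> {1..R}" "b \<in> {1..R}" "a + b \<in> {1..R}" using ab by auto
    then have "\<not> good (col a) (k * n)" if "k \<in> {a, b, a + b}" for k
      using col ab that by (metis empty_iff insert_iff)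
    then show False using N[of "col a" n a b] ab n col mem by blast
  qed
  then show ?thesis by (auto simp: good_def)
qed

text \<open>In the inductive step \<open>h\<close> is loxodromic on the spaces in \<open>I\<close>, and \<open>g\<close> on the new space \<open>k\<close>.
  If \<open>h\<close> is not loxodromic on \<open>k\<close>, then any power of it is outpaced there by a power \<open>s\<close> of \<open>g\<close>;
  and once \<open>s\<close> is chosen, a high power \<open>f\<close> of \<open>h\<close> outpaces \<open>s\<close> on all spaces in \<open>I\<close>.\<close>

theorem (in group) simultaneously_loxodromic:
  assumes "finite I" and "\<And>i. i \<in> I \<Longrightarrow> hyperbolic_length G (d i) \<delta>"
    and "\<And>i. i \<in> I \<Longrightarrow> \<exists>g \<in> carrier G. hyperbolic_length.loxodromic G (d i) \<delta> g"
  shows "\<exists>h \<in> carrier G. \<forall>i \<in> I. hyperbolic_length.loxodromic G (d i) \<delta> h"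
  using assms
proof (induction I)
  case empty
  then show ?case by auto
next
  case (insert k I)
  obtain h where h: "h \<in> carrier G" "\<forall>i \<in> I. hyperbolic_length.loxodromic G (d i) \<delta> h"
    using insert by auto
  obtain g where g: "g \<in> carrier G" "hyperbolic_length.loxodromic G (d k) \<delta> g"
    using insert.prems(2)[of k] by auto
  interpret k: hyperbolic_length G "d k" \<delta> using insert.prems(1) by simp
  show ?case
  proof (cases "k.loxodromic h")
    case True
    then show ?thesis using h by blast
  next
    case False
    have fin: "finite (insert k I)" using insert.hyps by simp
    obtain R where R: "R \<ge> (1::nat)" "\<And>col. (\<forall>j \<in> {1..R}. col j \<in> insert k I) \<Longrightarrow>
        (\<exists>a \<ge> 1. \<exists>b \<ge> 1. a + b \<le> R \<and> col a = col b \<and> col b = col (a + b))"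
      using schur[OF fin] by blast
    obtain m :: nat where m: "m \<ge> 1" "d k \<one> (g [^] (2 * m)) \<ge> d k \<one> (g [^] m) + (3 * \<delta> + 1)"
      using k.loxodromic_powers[OF g, of "3 * \<delta> + 1"] by auto
    define s where "s = g [^] m"
    have s: "s \<in> carrier G" using g by (simp add: s_def)
    \<comment> \<open>this margin makes the translation length of \<open>f\<close> on the space \<open>i\<close> exceed \<open>10 R\<close> times the length of \<open>s\<close>\<close>
    define t where "t i = 3 * \<delta> + 1 + 10 * real R * d i \<one> s" for i
    have "\<exists>M \<ge> (1::nat). \<forall>n. M dvd n \<longrightarrow> n \<ge> 1 \<longrightarrow> d i \<one> (h [^] (2 * n)) \<ge> d i \<one> (h [^] n) + t i"
      if "i \<in> I" for i
      using hyperbolic_length.loxodromic_powers[OF _ h(1), of "d i" \<delta> "t i"] insert.prems(1) h(2) that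
      by blast
    then obtain M :: "_ \<Rightarrow> nat" where M: "\<And>i. i \<in> I \<Longrightarrow> M i \<ge> 1"
      "\<And>i n. \<lbrakk>i \<in> I; M i dvd n; n \<ge> 1\<rbrakk> \<Longrightarrow> d i \<one> (h [^] (2 * n)) \<ge> d i \<one> (h [^] n) + t i"
      by metis
    define q where "q = (\<Prod>i \<in> I. M i)"
    have q: "q \<ge> 1" unfolding q_def by (rule prod_ge_1) (rule M(1))
    have dvd: "M i dvd q" if "i \<in> I" for i using that insert.hyps(1) by (simp add: q_def dvd_prodI)
    define f where "f = h [^] q"
    have f: "f \<in> carrier G" using h by (simp add: f_def)
    have pow2: "f [^] (2::nat) = h [^] (2 * q)" "s [^] (2::nat) = g [^] (2 * m)"
      using h g by (simp_all add: f_def s_def nat_pow_pow mult.commute)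
    have "hyperbolic_length.outpaces G (d i) \<delta> R f s" if i: "i \<in> I" for i
    proof -
      interpret i: hyperbolic_length G "d i" \<delta> using insert.prems(1) i by simp
      have t: "t i > 3 * \<delta>" using i.nonneg[of \<one> s] s by (simp add: t_def add_pos_nonneg)
      have dbl: "d i \<one> (f [^] (2::nat)) \<ge> d i \<one> f + t i"
        using M(2)[OF i dvd[OF i] q] unfolding pow2 by (simp add: f_def)
      have "d i \<one> (s [^] n) \<le> (t i - 2 * \<delta>) / (10 * real R) * real n" for n :: nat
      proof -
        have "d i \<one> s \<le> (t i - 2 * \<delta>) / (10 * real R)"
          using R(1) i.delta by (simp add: t_def field_simps)
        then have "d i \<one> s * real n \<le> (t i - 2 * \<delta>) / (10 * real R) * real n"
          by (rule mult_right_mono) simp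
        then show ?thesis using i.length_pow_le[OF s, of n] by (simp add: mult.commute)
      qed
      then show ?thesis using t dbl f s by (auto simp: i.outpaces_def)
    qed
    moreover have "k.outpaces R s f"
    proof -
      define e where "e = (3 * \<delta> + 1 - 2 * \<delta>) / (10 * real R) / real q"
      have "e > 0" using R(1) q k.delta by (simp add: e_def)
      then obtain N :: nat where N: "\<And>n. n \<ge> N \<Longrightarrow> d k \<one> (h [^] n) \<le> e * real n"
        using k.not_loxodromic_sublinear[OF h(1) False] by blast
      have "d k \<one> (f [^] n) \<le> (3 * \<delta> + 1 - 2 * \<delta>) / (10 * real R) * real n" if "n \<ge> N" for n :: nat
      proof -
        have "1 * n \<le> q * n" using q by (intro mult_le_mono1)
        then have "N \<le> q * n" using that by linarith
        then have "d k \<one> (h [^] (q * n)) \<le> e * real (q * n)" by (rule N)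
        then show ?thesis using h q by (simp add: f_def nat_pow_pow e_def)
      qed
      moreover have "d k \<one> (s [^] (2::nat)) \<ge> d k \<one> s + (3 * \<delta> + 1)"
        using m(2) unfolding pow2 by (simp add: s_def)
      ultimately show ?thesis using f s unfolding k.outpaces_def
        by (intro conjI exI[of _ "3 * \<delta> + 1"]) auto
    qed
    ultimately have "\<exists>n::nat. \<forall>i \<in> insert k I. hyperbolic_length.doubles G (d i) \<delta> (f [^] n \<otimes> s [^] n)"
      using R insert.prems(1) by (intro simultaneously_doubling_product[OF fin]) auto
    then show ?thesis
      using hyperbolic_length.doubles_imp_loxodromic insert.prems(1) f s by (metis m_closed nat_pow_closed)
  qed
qed

corollary (in group) simultaneously_doubling:
  assumes "finite I" and hyp: "\<And>i. i \<in> I \<Longrightarrow> hyperbolic_length G (d i) \<delta>"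
    and "\<And>i. i \<in> I \<Longrightarrow> \<exists>g \<in> carrier G. hyperbolic_length.loxodromic G (d i) \<delta> g"
  shows "\<exists>h \<in> carrier G. \<forall>i \<in> I. hyperbolic_length.doubles G (d i) \<delta> h"
proof -
  obtain h where h: "h \<in> carrier G" "\<forall>i \<in> I. hyperbolic_length.loxodromic G (d i) \<delta> h"
    using simultaneously_loxodromic[of I d \<delta>, OF assms] by auto
  have "\<exists>M \<ge> (1::nat). \<forall>n. M dvd n \<longrightarrow> n \<ge> 1 \<longrightarrow>
      d i \<one> (h [^] (2 * n)) \<ge> d i \<one> (h [^] n) + (3 * \<delta> + 1)" if "i \<in> I" for i
    using hyperbolic_length.loxodromic_powers[OF hyp h(1)] h(2) that by blast
  then obtain M :: "_ \<Rightarrow> nat" where M: "\<And>i. i \<in> I \<Longrightarrow> M i \<ge> 1"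
    "\<And>i n. \<lbrakk>i \<in> I; M i dvd n; n \<ge> 1\<rbrakk> \<Longrightarrow> d i \<one> (h [^] (2 * n)) \<ge> d i \<one> (h [^] n) + (3 * \<delta> + 1)"
    by metis
  define q where "q = (\<Prod>i \<in> I. M i)"
  have q: "q \<ge> 1" unfolding q_def by (rule prod_ge_1) (rule M(1))
  have "hyperbolic_length.doubles G (d i) \<delta> (h [^] q)" if i: "i \<in> I" for i
  proof -
    have "M i dvd q" using i assms(1) by (simp add: q_def dvd_prodI)
    then have "d i \<one> (h [^] (2 * q)) \<ge> d i \<one> (h [^] q) + (3 * \<delta> + 1)" using M(2)[OF i _ q] by blast
    moreover have "(h [^] q) [^] (2::nat) = h [^] (2 * q)" using h(1) by (simp add: nat_pow_pow mult.commute)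
    ultimately show ?thesis unfolding hyperbolic_length.doubles_def[OF hyp[OF i]] by simp
  qed
  then show ?thesis using h(1) by blast
qed

section \<open>Levels of domains\<close>

context domain_system
begin

lemma transverse_sym: "\<lbrakk>U \<in> \<SS>; V \<in> \<SS>; U \<pitchfork> V\<rbrakk> \<Longrightarrow> V \<pitchfork> U"
  unfolding transverse_def using orth_sym by blast

lemma nested_in_transverse:
  assumes "U \<in> \<SS>" "V \<in> \<SS>" "W \<in> \<SS>" "U \<preceq> V" "V \<pitchfork> W" "\<not> W \<bottom>\<bottom> U"
  shows "U \<prec> W \<or> U \<pitchfork> W"
proof -
  have "\<not> W \<preceq> U" using assms nest_trans[of W U V] by (auto simp: transverse_def)
  moreover have "U \<noteq> W" using assms by (auto simp: transverse_def)
  moreover have "\<not> U \<bottom>\<bottom> W" using assms orth_sym by blast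
  ultimately show ?thesis by (auto simp: proper_nest_def transverse_def)
qed

definition chain_below :: "'u \<Rightarrow> 'u set \<Rightarrow> bool" where
  "chain_below T c \<longleftrightarrow> c \<subseteq> {V \<in> \<SS>. V \<preceq> T} \<and> (\<forall>U \<in> c. \<forall>V \<in> c. U \<preceq> V \<or> V \<preceq> U)"

text \<open>A strictly monotone, bounded height function for nesting. It depends on the nesting relation
  alone, so it is invariant under the group action.\<close>

definition level :: "'u \<Rightarrow> nat" where
  "level T = Max (card ` {c. chain_below T c})"

lemma chain_bound: "\<exists>n. \<forall>T c. chain_below T c \<longrightarrow> finite c \<and> card c \<le> n"
proof -
  obtain n where n: "\<forall>c \<subseteq> \<SS>. (\<forall>U \<in> c. \<forall>V \<in> c. U \<preceq> V \<or> V \<preceq> U) \<longrightarrow> finite c \<and> card c \<le> n"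
    using finite_complexity by blast
  have "finite c \<and> card c \<le> n" if "chain_below T c" for T c
  proof -
    have "c \<subseteq> \<SS>" "\<forall>U \<in> c. \<forall>V \<in> c. U \<preceq> V \<or> V \<preceq> U" using that by (auto simp: chain_below_def)
    then show ?thesis using n by blast
  qed
  then show ?thesis by blast
qed

lemma finite_chain_cards: "finite (card ` {c. chain_below T c})"
proof -
  obtain n where "\<forall>T c. chain_below T c \<longrightarrow> finite c \<and> card c \<le> n" using chain_bound by blast
  then have "card ` {c. chain_below T c} \<subseteq> {..n}" by auto
  then show ?thesis using finite_subset by blast
qed

lemma card_le_level: "chain_below T c \<Longrightarrow> card c \<le> level T"
  unfolding level_def by (rule Max_ge[OF finite_chain_cards]) auto

lemma level_attained: "\<exists>c. chain_below T c \<and> card c = level T"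
proof -
  have "chain_below T {}" by (simp add: chain_below_def)
  then have "level T \<in> card ` {c. chain_below T c}"
    unfolding level_def by (intro Max_in finite_chain_cards) auto
  then show ?thesis by auto
qed

lemma level_bounded: "\<exists>n. \<forall>T. level T \<le> n"
  using chain_bound level_attained by metis

lemma level_strict_mono:
  assumes "V \<in> \<SS>" "W \<in> \<SS>" "proper_nest V W"
  shows "level V < level W"
proof -
  obtain c where c: "chain_below V c" "card c = level V" using level_attained by blast
  have "finite c" using c(1) chain_bound by blast
  have below: "U \<in> \<SS> \<and> U \<preceq> V \<and> U \<preceq> W" if "U \<in> c" for U
    using c(1) that assms nest_trans[of U V W] by (auto simp: chain_below_def proper_nest_def)
  have "W \<notin> c" using below assms nest_antisym[of V W] by (auto simp: proper_nest_def)
  moreover have "chain_below W (insert W c)"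
    using c(1) below assms nest_refl unfolding chain_below_def by auto
  then have "card (insert W c) \<le> level W" by (rule card_le_level)
  ultimately show ?thesis using c(2) \<open>finite c\<close> by simp
qed

lemma maximal_above:
  assumes "\<P> \<subseteq> \<SS>" "V \<in> \<P>"
  shows "\<exists>T \<in> \<P>. V \<preceq> T \<and> (\<forall>U \<in> \<P>. T \<preceq> U \<longrightarrow> U = T)"
proof -
  obtain n where n: "\<And>T. level T \<le> n" using level_bounded by blast
  obtain T where T: "T \<in> \<P> \<and> V \<preceq> T" and max: "\<And>U. U \<in> \<P> \<and> V \<preceq> U \<Longrightarrow> level U \<le> level T"
  proof -
    have "V \<in> \<P> \<and> V \<preceq> V" using assms nest_refl by blast
    then have "\<exists>T. (T \<in> \<P> \<and> V \<preceq> T) \<and> (\<forall>U. U \<in> \<P> \<and> V \<preceq> U \<longrightarrow> level U \<le> level T)"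
      by (rule ex_has_greatest_nat[where b = "Suc n"]) (use n in \<open>auto simp: less_Suc_eq_le\<close>)
    then show ?thesis using that by blast
  qed
  have "U = T" if "U \<in> \<P>" "T \<preceq> U" for U
  proof (rule ccontr)
    assume "U \<noteq> T"
    then have "level T < level U" using that T assms by (intro level_strict_mono) (auto simp: proper_nest_def)
    moreover have "level U \<le> level T" using that T assms nest_trans[of V T U] by (intro max) auto
    ultimately show False by simp
  qed
  then show ?thesis using T by blast
qed

lemma top_domain:
  assumes "\<SS> \<noteq> {}"
  shows "\<exists>T \<in> \<SS>. \<forall>V \<in> \<SS>. V \<preceq> T"
  using unique_maximal[OF assms] maximal_above[of \<SS>] by blast

text \<open>Passing to the container of the orthogonal complement of one member lowers the level, so the
  members of a pairwise orthogonal family can be removed one after the other at most \<open>level T\<close>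
  times.\<close>

lemma card_pairwise_orth_le_level:
  assumes "T \<in> \<SS>" "finite \<U>" "\<U> \<subseteq> {V \<in> \<SS>. V \<preceq> T}"
    and "\<And>V W. \<lbrakk>V \<in> \<U>; W \<in> \<U>; V \<noteq> W\<rbrakk> \<Longrightarrow> V \<bottom>\<bottom> W"
  shows "card \<U> \<le> level T"
  using assms
proof (induction "level T" arbitrary: T \<U> rule: less_induct)
  case less
  show ?case
  proof (cases "\<U> = {}")
    case False
    then obtain U where U: "U \<in> \<U>" by blast
    define \<V> where "\<V> = \<U> - {U}"
    have card: "card \<U> = Suc (card \<V>)" using U less.prems(2) by (metis card.remove \<V>_def)
    have "chain_below T {T}" using less.prems(1) nest_refl by (simp add: chain_below_def)
    then have one: "1 \<le> level T" using card_le_level by fastforce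
    show ?thesis
    proof (cases "\<V> = {}")
      case True
      then show ?thesis using card one by simp
    next
      case ne: False
      have orth: "\<V> \<subseteq> {V \<in> \<SS>. V \<preceq> T \<and> V \<bottom>\<bottom> U}"
        using less.prems(3,4) U by (auto simp: \<V>_def)
      then have "{V \<in> \<SS>. V \<preceq> T \<and> V \<bottom>\<bottom> U} \<noteq> {}" using ne by blast
      then obtain W where W: "W \<in> \<SS>" "W \<preceq> T" "W \<noteq> T" "\<forall>V \<in> \<SS>. V \<preceq> T \<and> V \<bottom>\<bottom> U \<longrightarrow> V \<preceq> W"
        using orth_container[of T U] less.prems(1,3) U by auto
      have rk: "level W < level T"
        using W less.prems(1) by (intro level_strict_mono) (auto simp: proper_nest_def)
      moreover have "card \<V> \<le> level W"
        using less.prems(2,4) orth W by (intro less.hyps rk) (auto simp: \<V>_def)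
      ultimately show ?thesis using card by simp
    qed
  qed simp
qed

lemma finite_pairwise_orth:
  assumes "\<U> \<subseteq> \<SS>" "\<And>V W. \<lbrakk>V \<in> \<U>; W \<in> \<U>; V \<noteq> W\<rbrakk> \<Longrightarrow> V \<bottom>\<bottom> W"
  shows "finite \<U>"
proof (cases "\<SS> = {}")
  case False
  then obtain T where T: "T \<in> \<SS>" "\<forall>V \<in> \<SS>. V \<preceq> T" using top_domain by blast
  have "card F \<le> level T" if "F \<subseteq> \<U>" "finite F" for F
    using that T assms by (intro card_pairwise_orth_le_level) blast+
  then show ?thesis using finite_if_finite_subsets_card_bdd by blast
qed (use assms in auto)

end

section \<open>The pseudometrics of a hierarchically hyperbolic group\<close>

lemma diam_leD:
  assumes "diam M S \<le> ennreal r" "0 \<le> r" "x \<in> S" "y \<in> S"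
  shows "mdist M x y \<le> r"
proof -
  have "ennreal (mdist M x y) \<le> diam M S"
    unfolding diam_def using assms(3,4) by (intro SUP_upper2[of "(x, y)"]) auto
  then show ?thesis using assms(1,2) by (meson ennreal_le_iff order_trans)
qed

lemma set_dist_leD:
  assumes "set_dist M S T \<le> ennreal r" "0 \<le> r" "r < s"
  shows "\<exists>x \<in> S. \<exists>y \<in> T. mdist M x y < s"
proof -
  have "set_dist M S T < ennreal s" using assms by (meson ennreal_less_iff le_less_trans)
  then show ?thesis
    using assms unfolding set_dist_def by (auto simp: INF_less_iff ennreal_less_iff)
qed

lemma set_dist_diam_le:
  assumes near: "set_dist M S T \<le> ennreal r" and diam: "diam M S \<le> ennreal a" "diam M T \<le> ennreal b"
    and nonneg: "0 \<le> r" "0 \<le> a" "0 \<le> b" and sub: "S \<subseteq> mspace M" "T \<subseteq> mspace M"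
    and pts: "x \<in> S" "y \<in> T"
  shows "mdist M x y \<le> a + r + b"
proof (rule field_le_epsilon)
  fix e :: real assume "0 < e"
  then obtain p q where pq: "p \<in> S" "q \<in> T" "mdist M p q < r + e"
    using set_dist_leD[OF near nonneg(1), of "r + e"] by auto
  have "mdist M x y \<le> mdist M x p + mdist M p q + mdist M q y"
    using mdist_triangle[of x M p y] mdist_triangle[of p M q y] sub pts pq by (smt (verit) subsetD)
  moreover have "mdist M x p \<le> a" "mdist M q y \<le> b"
    using diam_leD[OF diam(1) nonneg(2)] diam_leD[OF diam(2) nonneg(3)] pts pq by auto
  ultimately show "mdist M x y \<le> a + r + b + e" using pq(3) by simp
qed

lemma diam_singleton: "x \<in> mspace M \<Longrightarrow> diam M {x} \<le> ennreal 0"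
  by (simp add: diam_def)

context hierarchically_hyperbolic_group
begin

lemma space_word_metric [simp]: "mspace (word_metric G A) = carrier G"
  using mspace_word_metric generators by simp

lemma word_metric_left_invariant:
  assumes "g \<in> carrier G" "x \<in> carrier G" "y \<in> carrier G"
  shows "mdist (word_metric G A) (g \<otimes> x) (g \<otimes> y) = mdist (word_metric G A) x y"
proof -
  have "inv (g \<otimes> x) \<otimes> (g \<otimes> y) = inv x \<otimes> y"
    using assms by (simp add: inv_mult_group m_assoc) (simp flip: m_assoc)
  then show ?thesis using assms generators by (simp add: mdist_word_metric word_dist_def)
qed

lemma act_closed [simp]: "\<lbrakk>g \<in> carrier G; U \<in> \<SS>\<rbrakk> \<Longrightarrow> act g U \<in> \<SS>"
  using action.element_image by blast

lemma act_mult: "\<lbrakk>g \<in> carrier G; h \<in> carrier G; U \<in> \<SS>\<rbrakk> \<Longrightarrow> act (g \<otimes> h) U = act g (act h U)"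
  using action.composition_rule by simp

lemma act_one [simp]: "U \<in> \<SS> \<Longrightarrow> act \<one> U = U"
  using action.id_eq_one by (metis restrict_apply')

lemma act_inv [simp]: "\<lbrakk>g \<in> carrier G; U \<in> \<SS>\<rbrakk> \<Longrightarrow> act (inv g) (act g U) = U"
  using act_mult[of "inv g" g U] by simp

lemma act_inv' [simp]: "\<lbrakk>g \<in> carrier G; U \<in> \<SS>\<rbrakk> \<Longrightarrow> act g (act (inv g) U) = U"
  using act_mult[of g "inv g" U] by simp

lemma act_inj: "\<lbrakk>g \<in> carrier G; U \<in> \<SS>; V \<in> \<SS>\<rbrakk> \<Longrightarrow> act g U = act g V \<longleftrightarrow> U = V"
  using act_inv by metis

lemma act_proper_nest:
  "\<lbrakk>g \<in> carrier G; U \<in> \<SS>; V \<in> \<SS>\<rbrakk> \<Longrightarrow> act g U \<prec> act g V \<longleftrightarrow> U \<prec> V"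
  by (simp add: proper_nest_def act_nest act_inj)

lemma level_act:
  assumes "g \<in> carrier G" "T \<in> \<SS>"
  shows "level (act g T) = level T"
proof -
  have le: "level T \<le> level (act g T)" if g: "g \<in> carrier G" and T: "T \<in> \<SS>" for g T
  proof -
    obtain c where c: "chain_below T c" "card c = level T" using level_attained by blast
    have "chain_below (act g T) (act g ` c)"
      using c(1) g T act_nest unfolding chain_below_def by (auto simp: subset_iff)
    moreover have "inj_on (act g) c"
      using c(1) g by (auto simp: inj_on_def chain_below_def act_inj subset_iff)
    ultimately show ?thesis using card_le_level[of "act g T" "act g ` c"] c(2) by (simp add: card_image)
  qed
  have "level (act g T) \<le> level (act (inv g) (act g T))" using assms by (intro le) auto
  then show ?thesis using le[OF assms] assms by simp
qed

definition dist_on :: "'u \<Rightarrow> 'g \<Rightarrow> 'g \<Rightarrow> real" where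
  "dist_on U x y = mdist (C U) (\<pi> U x) (\<pi> U y)"

lemma proj_in [simp]: "\<lbrakk>U \<in> \<SS>; x \<in> carrier G\<rbrakk> \<Longrightarrow> \<pi> U x \<in> mspace (C U)"
  using proj_closed by simp

lemma dist_on_nonneg: "0 \<le> dist_on U x y"
  by (simp add: dist_on_def)

lemma dist_on_commute: "dist_on U x y = dist_on U y x"
  by (simp add: dist_on_def mdist_commute)

lemma dist_on_self: "\<lbrakk>U \<in> \<SS>; x \<in> carrier G\<rbrakk> \<Longrightarrow> dist_on U x x = 0"
  by (simp add: dist_on_def)

lemma dist_on_triangle:
  "\<lbrakk>U \<in> \<SS>; x \<in> carrier G; y \<in> carrier G; z \<in> carrier G\<rbrakk> \<Longrightarrow>
    dist_on U x z \<le> dist_on U x y + dist_on U y z"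
  unfolding dist_on_def by (intro mdist_triangle) auto

lemma dist_on_act:
  assumes "g \<in> carrier G" "x \<in> carrier G" "y \<in> carrier G" "U \<in> \<SS>"
  shows "dist_on (act g U) (g \<otimes> x) (g \<otimes> y) = dist_on U x y"
proof -
  have "mdist (C (act g U)) (isom g U (\<pi> U x)) (isom g U (\<pi> U y)) = mdist (C U) (\<pi> U x) (\<pi> U y)"
    using iso_isometry[of g U] assms by (simp add: isometry_def isometric_embedding_def)
  then show ?thesis using assms by (simp add: dist_on_def proj_equivariant)
qed

lemma dist_on_stab:
  "\<lbrakk>g \<in> carrier G; x \<in> carrier G; y \<in> carrier G; U \<in> \<SS>; act g U = U\<rbrakk> \<Longrightarrow>
    dist_on U (g \<otimes> x) (g \<otimes> y) = dist_on U x y"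
  using dist_on_act[of g x y U] by simp

text \<open>Projections are coarsely Lipschitz and the word metric is left-invariant, so translating an
  orbit by a fixed element on the right moves its projections a bounded amount.\<close>

lemma dist_on_right_mult_bounded:
  assumes "z \<in> carrier G"
  shows "\<exists>B. \<forall>U \<in> \<SS>. \<forall>g \<in> carrier G. dist_on U g (g \<otimes> z) \<le> B"
proof (intro exI ballI)
  fix U g assume U: "U \<in> \<SS>" and g: "g \<in> carrier G"
  have "dist_on U g (g \<otimes> z) \<le> E * mdist (word_metric G A) (g \<otimes> \<one>) (g \<otimes> z) + E"
    using proj_lipschitz[of U g "g \<otimes> z"] U g assms by (simp add: dist_on_def)
  then show "dist_on U g (g \<otimes> z) \<le> E * mdist (word_metric G A) \<one> z + E"
    using word_metric_left_invariant[of g \<one> z] g assms by simp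
qed

lemma bounded_proj_iff:
  assumes "U \<in> \<SS>" "S \<subseteq> carrier G"
  shows "bounded_in (C U) (\<pi> U ` S) \<longleftrightarrow> (\<exists>B. \<forall>x \<in> S. \<forall>y \<in> S. dist_on U x y \<le> B)"
  using assms Metric_space.mbounded_alt[OF Metric_space_mspace_mdist, of "C U" "\<pi> U ` S"]
  by (auto simp: dist_on_def)

section \<open>Points that realise a domain\<close>

text \<open>A point whose projections agree, up to a constant, with the relative projections of \<open>W\<close>.
  Such points replace the sets \<open>\<rho> W V\<close>: positions of domains relative to each other turn into
  distances between points of the group. The bound is \<open>2 E\<close>, and not \<open>E\<close>, because it concerns
  every point of \<open>\<rho> W V\<close>.\<close>

definition realises :: "'u \<Rightarrow> 'g \<Rightarrow> bool" where
  "realises W x \<longleftrightarrow> x \<in> carrier G \<and>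
    (\<forall>V \<in> \<SS>. W \<prec> V \<or> W \<pitchfork> V \<longrightarrow> (\<forall>p \<in> \<rho> W V. mdist (C V) (\<pi> V x) p \<le> 2 * E))"

lemma rho_near:
  assumes "W \<in> \<SS>" "V \<in> \<SS>" "W \<prec> V \<or> W \<pitchfork> V" "x \<in> carrier G"
    and "set_dist (C V) {\<pi> V x} (\<rho> W V) \<le> ennreal E" "p \<in> \<rho> W V"
  shows "mdist (C V) (\<pi> V x) p \<le> 2 * E"
proof -
  have "mdist (C V) (\<pi> V x) p \<le> 0 + E + E"
    using rho_set[OF assms(1-3)] assms E_ge_1 diam_singleton[of "\<pi> V x" "C V"]
    by (intro set_dist_diam_le[OF assms(5)]) auto
  then show ?thesis by simp
qed

lemma realise_family:
  assumes "\<W> \<subseteq> \<SS>" "\<forall>V \<in> \<W>. \<forall>W \<in> \<W>. V \<noteq> W \<longrightarrow> V \<bottom>\<bottom> W"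
  shows "\<exists>x. \<forall>W \<in> \<W>. realises W x"
proof -
  have "\<forall>W \<in> \<W>. \<pi> W \<one> \<in> mspace (C W)" using assms by auto
  from partial_realisation[OF assms this] obtain x where x: "x \<in> carrier G"
    "\<And>W V. \<lbrakk>W \<in> \<W>; V \<in> \<SS>; W \<prec> V \<or> W \<pitchfork> V\<rbrakk> \<Longrightarrow> set_dist (C V) {\<pi> V x} (\<rho> W V) \<le> ennreal E"
    by auto
  then have "realises W x" if "W \<in> \<W>" for W
    unfolding realises_def using rho_near[of W] that assms(1) by blast
  then show ?thesis by blast
qed

lemma realise: "W \<in> \<SS> \<Longrightarrow> \<exists>x. realises W x"
  using realise_family[of "{W}"] by blast

lemma realise_orth:
  "\<lbrakk>V \<in> \<SS>; W \<in> \<SS>; V \<bottom>\<bottom> W\<rbrakk> \<Longrightarrow> \<exists>x. realises V x \<and> realises W x"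
  using realise_family[of "{V, W}"] orth_sym by blast

lemma realises_in: "realises W x \<Longrightarrow> x \<in> carrier G"
  by (simp add: realises_def)

lemma realises_act:
  assumes g: "g \<in> carrier G" and W: "W \<in> \<SS>" and x: "realises W x"
  shows "realises (act g W) (g \<otimes> x)"
  unfolding realises_def
proof (intro conjI ballI impI)
  show "g \<otimes> x \<in> carrier G" using g x by (simp add: realises_def)
next
  fix V p assume V: "V \<in> \<SS>" and rel: "act g W \<prec> V \<or> act g W \<pitchfork> V" and p: "p \<in> \<rho> (act g W) V"
  define D where "D = act (inv g) V"
  have D: "D \<in> \<SS>" "V = act g D" using g V by (auto simp: D_def)
  have rel': "W \<prec> D \<or> W \<pitchfork> D"
    using rel g W D act_proper_nest[of g W D] act_transverse[of g W D] by simp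
  then have "isom g D ` \<rho> W D = \<rho> (act g W) V"
    using rho_equivariant[of g D W] g D W transverse_sym by metis
  then obtain q where q: "q \<in> \<rho> W D" "p = isom g D q" using p by auto
  have "q \<in> mspace (C D)" using rho_set[OF W D(1) rel'] q by auto
  moreover have "isom g D (\<pi> D x) = \<pi> V (g \<otimes> x)"
    using proj_equivariant[of g x D] D g x by (simp add: realises_def)
  ultimately have "mdist (C V) (\<pi> V (g \<otimes> x)) p = mdist (C D) (\<pi> D x) q"
    using iso_isometry[OF g D(1)] D q(2) x
    by (metis isometry_def isometric_embedding_def proj_in realises_in)
  then show "mdist (C V) (\<pi> V (g \<otimes> x)) p \<le> 2 * E"
    using x rel' D(1) q(1) unfolding realises_def by metis
qed

lemma mdist_via:
  "\<lbrakk>p \<in> mspace M; q \<in> mspace M; r \<in> mspace M; mdist M p q \<le> a; mdist M r q \<le> b\<rbrakk> \<Longrightarrow> mdist M p r \<le> a + b"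
  using mdist_triangle[of p M q r] by (simp add: mdist_commute)

lemma realises_close:
  assumes W: "W \<in> \<SS>" and V: "V \<in> \<SS>" and rel: "W \<prec> V \<or> W \<pitchfork> V" and x: "realises W x" "realises W y"
  shows "dist_on V x y \<le> 4 * E"
proof -
  obtain p where p: "p \<in> \<rho> W V" "p \<in> mspace (C V)" using rho_set[OF W V rel] by blast
  have "mdist (C V) (\<pi> V x) (\<pi> V y) \<le> 2 * E + 2 * E"
    using x rel V p by (intro mdist_via[of _ _ p]) (auto simp: realises_def)
  then show ?thesis by (simp add: dist_on_def)
qed

text \<open>The Behrstock inequality, with realising points in place of relative projections.\<close>

lemma behrstock:
  assumes V: "V \<in> \<SS>" and W: "W \<in> \<SS>" and rel: "V \<pitchfork> W"
    and v: "realises V v" and w: "realises W w" and z: "z \<in> carrier G"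
  shows "dist_on W z v \<le> 4 * E \<or> dist_on V z w \<le> 4 * E"
proof -
  have *: "dist_on W z v \<le> 4 * E"
    if V: "V \<in> \<SS>" and W: "W \<in> \<SS>" and rel: "V \<pitchfork> W" and v: "realises V v"
      and near: "set_dist (C W) {\<pi> W z} (\<rho> V W) \<le> ennreal E" for V W v
  proof -
    obtain p where p: "p \<in> \<rho> V W" "p \<in> mspace (C W)" using rho_set[of V W] rel V W by blast
    have "mdist (C W) (\<pi> W z) (\<pi> W v) \<le> 2 * E + 2 * E"
    proof (rule mdist_via[of _ _ p])
      show "mdist (C W) (\<pi> W z) p \<le> 2 * E"
        using V W rel z near p by (intro rho_near) auto
      show "mdist (C W) (\<pi> W v) p \<le> 2 * E" using v W rel p by (auto simp: realises_def)
    qed (use p z v W in \<open>auto simp: realises_def\<close>)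
    then show ?thesis by (simp add: dist_on_def)
  qed
  have "set_dist (C W) {\<pi> W z} (\<rho> V W) \<le> ennreal E \<or> set_dist (C V) {\<pi> V z} (\<rho> W V) \<le> ennreal E"
    using consistency_transverse[OF V W rel, of z] z by (auto simp: min_le_iff_disj)
  then show ?thesis using *[OF V W rel v] *[OF W V transverse_sym[OF V W rel] w] by blast
qed

text \<open>A domain \<open>W\<close> transverse to \<open>V\<close> sees all subdomains of \<open>V\<close> that are not orthogonal to \<open>W\<close> in
  the same place as \<open>V\<close> itself.\<close>

lemma nested_realises_close:
  assumes U: "U \<in> \<SS>" and V: "V \<in> \<SS>" and W: "W \<in> \<SS>" and "U \<preceq> V" and "V \<pitchfork> W" and "\<not> W \<bottom>\<bottom> U"
    and u: "realises U u" and v: "realises V v"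
  shows "dist_on W u v \<le> 7 * E"
proof -
  have rel: "U \<prec> W \<or> U \<pitchfork> W" using nested_in_transverse assms by blast
  note rU = rho_set[OF U W rel] and rV = rho_set[OF V W disjI2[OF \<open>V \<pitchfork> W\<close>]]
  obtain p q where p: "p \<in> \<rho> U W" "p \<in> mspace (C W)" and q: "q \<in> \<rho> V W" "q \<in> mspace (C W)"
    using rU rV by blast
  have "set_dist (C W) (\<rho> U W) (\<rho> V W) \<le> ennreal E"
    using consistency_rho[OF U V W] assms by blast
  then have "mdist (C W) p q \<le> E + E + E"
    using rU rV E_ge_1 p q by (intro set_dist_diam_le) auto
  moreover have "mdist (C W) (\<pi> W u) p \<le> 2 * E" "mdist (C W) (\<pi> W v) q \<le> 2 * E"
    using u v rel \<open>V \<pitchfork> W\<close> W p q by (auto simp: realises_def)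
  ultimately have "mdist (C W) (\<pi> W u) (\<pi> W v) \<le> (2 * E + (E + E + E)) + 2 * E"
    using mdist_triangle[of "\<pi> W u" "C W" p q] p q W realises_in[OF u] realises_in[OF v]
    by (intro mdist_via[where q = q and a = "2 * E + (E + E + E)"]) simp_all
  then show ?thesis by (simp add: dist_on_def)
qed

text \<open>If \<open>U\<close> and \<open>V\<close> were orthogonal, one point would realise both; if they were nested, their
  projections to \<open>W\<close> would be close by consistency. Either way \<open>W\<close> would not see them far apart.\<close>

lemma transverse_if_far:
  assumes U: "U \<in> \<SS>" and V: "V \<in> \<SS>" and W: "W \<in> \<SS>" and "U \<pitchfork> W" and "V \<pitchfork> W"
    and u: "realises U u" and v: "realises V v" and far: "dist_on W u v > 8 * E"
  shows "U \<pitchfork> V"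
proof -
  have not_orth: "\<not> U \<bottom>\<bottom> V"
  proof
    assume "U \<bottom>\<bottom> V"
    then obtain z where z: "realises U z" "realises V z" using realise_orth U V by blast
    have "dist_on W u z \<le> 4 * E" "dist_on W z v \<le> 4 * E"
      using realises_close[OF U W _ u z(1)] realises_close[OF V W _ z(2) v] assms by blast+
    then show False using dist_on_triangle[OF W, of u z v] far u v z by (simp add: realises_def)
  qed
  have not_nest: "\<not> U \<preceq> V" if "U \<in> \<SS>" "V \<in> \<SS>" "V \<pitchfork> W" "U \<pitchfork> W" "realises U u" "realises V v"
    "dist_on W u v > 8 * E" for U V u v
  proof
    assume "U \<preceq> V"
    moreover have "\<not> W \<bottom>\<bottom> U" using that W orth_sym by (auto simp: transverse_def)
    ultimately have "dist_on W u v \<le> 7 * E" using that W nested_realises_close by blast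
    then show False using that(7) E_ge_1 by simp
  qed
  have "\<not> U \<preceq> V" "\<not> V \<preceq> U"
    using not_nest[of U V u v] not_nest[of V U v u] assms by (simp_all add: dist_on_commute)
  then show ?thesis using not_orth nest_refl U by (auto simp: transverse_def)
qed

lemma large_links_on:
  assumes T: "T \<in> \<SS>" and x: "x \<in> carrier G" "y \<in> carrier G" and B: "dist_on T x y \<le> B"
  shows "\<exists>\<T> \<subseteq> {V \<in> \<SS>. V \<prec> T}. finite \<T> \<and> card \<T> \<le> nat \<lfloor>E * B + E\<rfloor> \<and>
    (\<forall>V \<in> \<SS>. V \<prec> T \<longrightarrow> dist_on V x y \<ge> E \<longrightarrow> (\<exists>T' \<in> \<T>. V \<preceq> T'))"
proof -
  obtain \<T> where \<T>: "\<T> \<subseteq> {V \<in> \<SS>. V \<prec> T}" "finite \<T>" "card \<T> \<le> nat \<lfloor>E * dist_on T x y + E\<rfloor>"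
    "\<forall>V \<in> \<SS>. V \<prec> T \<longrightarrow> (\<exists>T' \<in> \<T>. V \<preceq> T') \<or> dist_on V x y < E"
    using large_links[OF T _ _ refl, of x y] x by (auto simp: dist_on_def)
  have "nat \<lfloor>E * dist_on T x y + E\<rfloor> \<le> nat \<lfloor>E * B + E\<rfloor>"
    using B E_ge_1 by (intro nat_mono floor_mono) simp
  then show ?thesis using \<T> by (intro exI[of _ \<T>]) fastforce
qed

end

section \<open>Domains along an axis\<close>

lemma (in hierarchically_hyperbolic_group) act_int_pow_fixes:
  assumes "g \<in> carrier G" "T \<in> \<SS>" "act g T = T"
  shows "act (g [^] (k::int)) T = T"
proof -
  have "g \<in> stabilizer G act T" using assms by (simp add: stabilizer_def)
  then have "g [^] k \<in> stabilizer G act T"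
    using subgroup_int_pow_closed[OF action.stabilizer_subgroup[OF assms(2)]] by blast
  then show ?thesis by (simp add: stabilizer_def)
qed

text \<open>The translates \<open>U i\<close> of a domain under the powers of \<open>a\<close>, with points \<open>x i\<close> realising them.
  By \<open>spread\<close> each \<open>U l\<close> separates the points before it from those after it, so that the orbit of
  \<open>a\<close> makes progress in all of these domains, one after the other. The aim is a single domain that
  contains some \<open>U i\<close> and sees unbounded progress.\<close>

locale domain_axis = hierarchically_hyperbolic_group +
  fixes a :: 'a and U :: "int \<Rightarrow> 'c" and x :: "int \<Rightarrow> 'a"
  assumes a_in: "a \<in> carrier G"
    and U_in: "U i \<in> \<SS>"
    and U_shift: "act (a [^] (k::int)) (U i) = U (i + k)"
    and U_antichain: "U i \<preceq> U j \<Longrightarrow> i = j"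
    and x_realises: "realises (U i) (x i)"
    and spread: "\<lbrakk>i < l; l < j\<rbrakk> \<Longrightarrow> E \<le> dist_on (U l) (x i) (x j)"
begin

lemma x_in: "x i \<in> carrier G"
  using x_realises realises_in by blast

lemma a_pow_in: "a [^] (k::int) \<in> carrier G"
  using a_in by simp

definition shadow :: "'c \<Rightarrow> int set" where
  "shadow T = {i. U i \<preceq> T}"

text \<open>The domains \<open>U i\<close> are admitted whatever their level: they contribute single indices (the end
  points of an interval in \<open>covered_if_bounded\<close>), so they do not help to cover long intervals.\<close>

definition admissible :: "nat \<Rightarrow> 'c \<Rightarrow> bool" where
  "admissible l T \<longleftrightarrow> T \<in> \<SS> \<and> (level T < l \<or> T \<in> range U)"

text \<open>The least such \<open>p\<close> is a size of the index set \<open>F\<close> that is monotone, subadditive and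
  invariant under shifts. The argument compares these sizes for two consecutive values of \<open>l\<close>.\<close>

definition covered :: "nat \<Rightarrow> nat \<Rightarrow> int set \<Rightarrow> bool" where
  "covered l p F \<longleftrightarrow> (\<exists>\<T>. finite \<T> \<and> card \<T> \<le> p \<and> (\<forall>T \<in> \<T>. admissible l T) \<and> F \<subseteq> (\<Union>T \<in> \<T>. shadow T))"

lemma covered_mono: "\<lbrakk>covered l p F; F' \<subseteq> F; p \<le> p'\<rbrakk> \<Longrightarrow> covered l p' F'"
  unfolding covered_def by (meson order_trans)

lemma covered_empty: "covered l p {}"
  unfolding covered_def by (intro exI[of _ "{}"]) simp

lemma covered_single:
  assumes "admissible l T" "F \<subseteq> shadow T" "1 \<le> p"
  shows "covered l p F"
  unfolding covered_def using assms by (intro exI[of _ "{T}"]) simp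

lemma covered_UN:
  assumes I: "finite I" "card I \<le> m" and cov: "\<And>i. i \<in> I \<Longrightarrow> covered l p (f i)"
  shows "covered l (m * p) (\<Union>i \<in> I. f i)"
proof -
  obtain \<T> where \<T>: "\<And>i. i \<in> I \<Longrightarrow> finite (\<T> i) \<and> card (\<T> i) \<le> p \<and>
      (\<forall>T \<in> \<T> i. admissible l T) \<and> f i \<subseteq> (\<Union>T \<in> \<T> i. shadow T)"
    using cov unfolding covered_def by metis
  have "card (\<Union>i \<in> I. \<T> i) \<le> (\<Sum>i \<in> I. card (\<T> i))" by (rule card_UN_le[OF I(1)])
  also have "\<dots> \<le> card I * p" using sum_bounded_above[of I "\<lambda>i. card (\<T> i)" p] \<T> by simp
  also have "\<dots> \<le> m * p" using I(2) by (rule mult_le_mono1)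
  finally show ?thesis
    unfolding covered_def using I(1) \<T> by (intro exI[of _ "\<Union>i \<in> I. \<T> i"]) fastforce
qed

text \<open>Large links: if \<open>T\<close> does not see the points of \<open>F\<close> far apart, then boundedly many proper
  subdomains of \<open>T\<close> contain all \<open>U k\<close> for \<open>k\<close> strictly between the extreme indices, since each of
  these \<open>U k\<close> separates the extreme points. Proper subdomains have lower level.\<close>

lemma covered_if_bounded:
  assumes T: "T \<in> \<SS>" "T \<notin> range U" "level T \<le> l" and F: "finite F" "F \<subseteq> shadow T"
    and B: "\<And>i j. \<lbrakk>i \<in> F; j \<in> F\<rbrakk> \<Longrightarrow> dist_on T (x i) (x j) \<le> B"
  shows "covered l (nat \<lfloor>E * B + E\<rfloor> + 2) F"
proof (cases "F = {}")
  case False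
  define i where "i = Min F"
  define j where "j = Max F"
  have ij: "i \<in> F" "j \<in> F" using False F(1) by (simp_all add: i_def j_def)
  obtain \<T> where \<T>: "\<T> \<subseteq> {V \<in> \<SS>. V \<prec> T}" "finite \<T>" "card \<T> \<le> nat \<lfloor>E * B + E\<rfloor>"
    "\<forall>V \<in> \<SS>. V \<prec> T \<longrightarrow> dist_on V (x i) (x j) \<ge> E \<longrightarrow> (\<exists>T' \<in> \<T>. V \<preceq> T')"
    using large_links_on[OF T(1) x_in x_in B[OF ij]] by blast
  have "F \<subseteq> (\<Union>S \<in> \<T> \<union> {U i, U j}. shadow S)"
  proof
    fix k assume k: "k \<in> F"
    show "k \<in> (\<Union>S \<in> \<T> \<union> {U i, U j}. shadow S)"
    proof (cases "k = i \<or> k = j")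
      case True
      then show ?thesis using nest_refl[OF U_in] by (auto simp: shadow_def)
    next
      case ne: False
      have "i \<le> k" "k \<le> j" using k F(1) by (simp_all add: i_def j_def)
      then have "E \<le> dist_on (U k) (x i) (x j)" using spread[of i k j] ne by linarith
      moreover have "U k \<prec> T" using k F(2) T(2) by (auto simp: shadow_def proper_nest_def)
      ultimately show ?thesis using \<T>(4) U_in[of k] by (auto simp: shadow_def)
    qed
  qed
  moreover have "admissible l S" if "S \<in> \<T> \<union> {U i, U j}" for S
  proof (cases "S \<in> \<T>")
    case True
    then have S: "S \<in> \<SS>" "S \<prec> T" using \<T>(1) by auto
    then have "level S < l" using level_strict_mono[OF S(1) T(1) S(2)] T(3) by simp
    then show ?thesis using S by (simp add: admissible_def)
  next
    case False
    then show ?thesis using that U_in by (auto simp: admissible_def)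
  qed
  moreover have "card (\<T> \<union> {U i, U j}) \<le> nat \<lfloor>E * B + E\<rfloor> + 2"
    using card_Un_le[of \<T> "{U i, U j}"] \<T>(3) card_insert_le_m1[of 2 "{U j}" "U i"] by simp
  ultimately show ?thesis unfolding covered_def using \<T>(2) by (intro exI[of _ "\<T> \<union> {U i, U j}"]) auto
qed (simp add: covered_empty)

text \<open>The number obtained from \<open>covered_if_bounded\<close> for the bound \<open>14 E\<close> that arises for
  transverse domains.\<close>

definition overlap :: nat where
  "overlap = nat \<lfloor>E * (14 * E) + E\<rfloor> + 2"

text \<open>Distinct domains of top level share only few indices: they are not nested because their
  levels agree, and not orthogonal because both contain some \<open>U i\<close>. If they are transverse, \<open>S\<close>
  sees every domain nested in both of them close to the position of \<open>T\<close>, so the common indices are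
  bounded in \<open>S\<close>.\<close>

lemma covered_overlap:
  assumes S: "admissible (Suc l) S" and T: "admissible (Suc l) T" and ne: "S \<noteq> T" and F: "finite F"
  shows "covered l overlap {i \<in> F. U i \<preceq> S \<and> U i \<preceq> T}" (is "covered l _ ?F")
proof -
  have one: "1 \<le> overlap" by (simp add: overlap_def)
  have sub: "?F \<subseteq> shadow S" "?F \<subseteq> shadow T" by (auto simp: shadow_def)
  have in_S: "S \<in> \<SS>" "T \<in> \<SS>" using S T by (auto simp: admissible_def)
  show ?thesis
  proof (cases "admissible l S \<or> admissible l T")
    case True
    then show ?thesis using covered_single sub one by blast
  next
    case False
    then have S': "S \<notin> range U" "level S = l" and T': "T \<notin> range U" "level T = l"
      using S T by (auto simp: admissible_def)
    have no_nest: "\<not> S \<preceq> T" "\<not> T \<preceq> S"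
      using level_strict_mono[of S T] level_strict_mono[of T S] in_S ne S' T' by (auto simp: proper_nest_def)
    show ?thesis
    proof (cases "?F = {}")
      case ne: False
      have no_orth: "\<not> S \<bottom>\<bottom> U i" if "i \<in> ?F" for i
      proof
        assume "S \<bottom>\<bottom> U i"
        then have "U i \<bottom>\<bottom> U i"
          using nest_orth[of "U i" "U i" S] that in_S U_in[of i] by auto
        then show False using orth_irrefl U_in by blast
      qed
      have "T \<pitchfork> S"
      proof -
        obtain i where i: "i \<in> ?F" using ne by blast
        have "\<not> T \<bottom>\<bottom> S"
        proof
          assume "T \<bottom>\<bottom> S"
          then have "S \<bottom>\<bottom> U i"
            using nest_orth[of S "U i" T] orth_sym[of "U i" S] in_S U_in[of i] i by blast
          then show False using no_orth i by blast
        qed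
        then show ?thesis using no_nest \<open>S \<noteq> T\<close> by (auto simp: transverse_def)
      qed
      obtain t where t: "realises T t" using realise in_S by blast
      have near: "dist_on S (x i) t \<le> 7 * E" if "i \<in> ?F" for i
        using nested_realises_close[OF U_in in_S(2,1) _ \<open>T \<pitchfork> S\<close> no_orth[OF that] x_realises t] that by blast
      have "dist_on S (x i) (x j) \<le> 14 * E" if "i \<in> ?F" "j \<in> ?F" for i j
        using near[OF that(1)] near[OF that(2)] dist_on_triangle[OF in_S(1) x_in[of i] realises_in[OF t] x_in[of j]]
        by (simp add: dist_on_commute[of S t])
      then show ?thesis
        unfolding overlap_def using F S' in_S sub by (intro covered_if_bounded[of S]) auto
    next
      case True
      show ?thesis unfolding True by (rule covered_empty)
    qed
  qed
qed

lemma shadow_act: "T \<in> \<SS> \<Longrightarrow> i \<in> shadow (act (a [^] (k::int)) T) \<longleftrightarrow> i - k \<in> shadow T"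
  using act_nest[OF a_pow_in[of k] U_in[of "i - k"], of T] U_shift[of k "i - k"]
  by (simp add: shadow_def)

lemma admissible_act: "admissible l T \<Longrightarrow> admissible l (act (a [^] (k::int)) T)"
  using level_act[OF a_pow_in[of k]] act_closed[OF a_pow_in[of k]] U_shift[of k]
  by (auto simp: admissible_def)

text \<open>Suppose that \<open>p\<close> domains suffice to cover \<open>F\<close> together with its shifts by \<open>0, ..., p\<close>. The
  \<open>m\<close>-th translates of these domains then cover \<open>F\<close> again. If \<open>T\<close> differs from all the \<open>m\<close>-th
  translates for some \<open>m\<close>, it meets each of them in few indices, so its part of \<open>F\<close> is small.
  Otherwise \<open>T\<close> is an \<open>m\<close>-th translate for each of the \<open>p + 1\<close> values of \<open>m\<close>, twice of the same
  domain, and the quotient of the two powers of \<open>a\<close> fixes \<open>T\<close>.\<close>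

lemma cover_almost_periodic:
  assumes p: "1 \<le> p" and cov: "\<And>F. finite F \<Longrightarrow> covered (Suc l) p F" and F: "finite F"
  shows "\<exists>\<T>. finite \<T> \<and> card \<T> \<le> p \<and> F \<subseteq> (\<Union>T \<in> \<T>. shadow T) \<and> (\<forall>T \<in> \<T>. admissible (Suc l) T \<and>
    (covered l (p * overlap) (F \<inter> shadow T) \<or> act (a [^] int (fact p)) T = T))"
proof -
  define F' where "F' = (\<Union>m \<in> {0..p}. (\<lambda>i. i - int m) ` F)"
  have "finite F'" using F by (simp add: F'_def)
  then obtain \<T> where \<T>: "finite \<T>" "card \<T> \<le> p" "\<And>T. T \<in> \<T> \<Longrightarrow> admissible (Suc l) T"
    "F' \<subseteq> (\<Union>T \<in> \<T>. shadow T)"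
    using cov[of F'] unfolding covered_def by blast
  have in_S: "T \<in> \<SS>" if "T \<in> \<T>" for T using \<T>(3)[OF that] by (simp add: admissible_def)
  have "(\<lambda>i. i - int 0) ` F \<subseteq> F'" unfolding F'_def by (rule UN_upper) simp
  then have "F \<subseteq> (\<Union>T \<in> \<T>. shadow T)" using \<T>(4) by simp
  moreover have "covered l (p * overlap) (F \<inter> shadow T) \<or> act (a [^] int (fact p)) T = T" if T: "T \<in> \<T>" for T
  proof (cases "\<forall>m \<in> {0..p}. \<exists>S \<in> \<T>. act (a [^] int m) S = T")
    case True
    then obtain S where S: "\<And>m. m \<in> {0..p} \<Longrightarrow> S m \<in> \<T> \<and> act (a [^] int m) (S m) = T" by metis
    have "\<not> inj_on S {0..p}"
    proof
      assume "inj_on S {0..p}"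
      then have "card {0..p} \<le> card \<T>" using S \<T>(1) by (intro card_inj_on_le) auto
      then show False using \<T>(2) by simp
    qed
    then obtain m n where mn: "m \<in> {0..p}" "n \<in> {0..p}" "m < n" "S m = S n"
      unfolding inj_on_def by (metis nat_neq_iff)
    have "int n = int (n - m) + int m" using mn by simp
    then have "a [^] int n = a [^] int (n - m) \<otimes> a [^] int m" using a_in by (metis int_pow_mult)
    then have "act (a [^] int n) (S n) = act (a [^] int (n - m)) (act (a [^] int m) (S m))"
      using act_mult[OF a_pow_in a_pow_in, of "S n" "int (n - m)" "int m"] S mn in_S by simp
    then have fix1: "act (a [^] int (n - m)) T = T" using S[OF mn(1)] S[OF mn(2)] mn(4) by metis
    have "(n - m) dvd fact p" using mn by (intro dvd_fact) auto
    then obtain q where "fact p = (n - m) * q" by (auto elim: dvdE)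
    then have "a [^] int (fact p) = (a [^] int (n - m)) [^] int q"
      using a_in by (simp only: int_pow_pow of_nat_mult)
    then show ?thesis using act_int_pow_fixes[OF a_pow_in in_S[OF T] fix1] by simp
  next
    case False
    then obtain m where m: "m \<in> {0..p}" "\<And>S. S \<in> \<T> \<Longrightarrow> act (a [^] int m) S \<noteq> T" by blast
    have "F \<inter> shadow T \<subseteq> (\<Union>S \<in> \<T>. {i \<in> F. U i \<preceq> T \<and> U i \<preceq> act (a [^] int m) S})"
    proof
      fix i assume i: "i \<in> F \<inter> shadow T"
      then have "i - int m \<in> F'" using m(1) by (auto simp: F'_def)
      then obtain S where S: "S \<in> \<T>" "i - int m \<in> shadow S" using \<T>(4) by blast
      then have "i \<in> shadow (act (a [^] int m) S)" using shadow_act in_S by blast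
      then show "i \<in> (\<Union>S \<in> \<T>. {i \<in> F. U i \<preceq> T \<and> U i \<preceq> act (a [^] int m) S})"
        using i S by (auto simp: shadow_def)
    qed
    moreover have "covered l (p * overlap) (\<Union>S \<in> \<T>. {i \<in> F. U i \<preceq> T \<and> U i \<preceq> act (a [^] int m) S})"
    proof (rule covered_UN[OF \<T>(1,2)])
      fix S assume S: "S \<in> \<T>"
      show "covered l overlap {i \<in> F. U i \<preceq> T \<and> U i \<preceq> act (a [^] int m) S}"
        by (rule covered_overlap[OF \<T>(3)[OF T] admissible_act[OF \<T>(3)[OF S]] m(2)[OF S, symmetric] F])
    qed
    ultimately show ?thesis using covered_mono by blast
  qed
  ultimately show ?thesis using \<T>(1-3) by blast
qed

text \<open>The index set of a periodic domain is determined by its residues modulo \<open>r\<close>, and by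
  \<open>covered_overlap\<close> distinct domains with the same index set have a small one.\<close>

lemma finite_periodic_domains:
  assumes r: "1 \<le> r"
  shows "finite {T. admissible (Suc l) T \<and> act (a [^] int r) T = T \<and>
    (\<exists>F. finite F \<and> F \<subseteq> shadow T \<and> \<not> covered l overlap F)}" (is "finite ?\<F>")
proof -
  have periodic: "i \<in> shadow T \<longleftrightarrow> i mod int r \<in> shadow T" if T: "T \<in> ?\<F>" for T i
  proof -
    have in_S: "T \<in> \<SS>" using T by (simp add: admissible_def)
    have "act ((a [^] int r) [^] (i div int r)) T = T"
      using T in_S act_int_pow_fixes[OF a_pow_in] by simp
    then have "act (a [^] (int r * (i div int r))) T = T" using a_in by (simp add: int_pow_pow)
    then show ?thesis using shadow_act[OF in_S, of i "int r * (i div int r)"]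
      by (simp add: minus_mult_div_eq_mod)
  qed
  have "inj_on (\<lambda>T. shadow T \<inter> {0..<int r}) ?\<F>"
  proof (rule inj_onI)
    fix S T assume S: "S \<in> ?\<F>" and T: "T \<in> ?\<F>"
      and eq: "shadow S \<inter> {0..<int r} = shadow T \<inter> {0..<int r}"
    have "shadow S = shadow T"
    proof (rule Set.set_eqI)
      fix i
      have "i mod int r \<in> {0..<int r}" using r by simp
      then show "i \<in> shadow S \<longleftrightarrow> i \<in> shadow T"
        using periodic[OF S, of i] periodic[OF T, of i] eq by blast
    qed
    obtain F where F: "finite F" "F \<subseteq> shadow S" "\<not> covered l overlap F" using S by blast
    have "{i \<in> F. U i \<preceq> S \<and> U i \<preceq> T} = F"
      using F(2) \<open>shadow S = shadow T\<close> by (auto simp: shadow_def)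
    then show "S = T" using covered_overlap[of l S T F] S T F by auto
  qed
  moreover have "finite ((\<lambda>T. shadow T \<inter> {0..<int r}) ` ?\<F>)"
    by (rule finite_subset[of _ "Pow {0..<int r}"]) auto
  ultimately show ?thesis using finite_imageD by blast
qed

text \<open>Let \<open>l + 1\<close> be the least level at which all finite index sets are covered by a uniform
  number of domains. It exists because the top domain covers everything, while level \<open>0\<close> admits
  only the domains \<open>U i\<close>, which cover one index each. If every domain properly above some \<open>U i\<close>
  saw only bounded progress, the index sets of the finitely many periodic domains would be covered
  uniformly at level \<open>l\<close>, and so would the parts of all other domains in a cover, by
  \<open>cover_almost_periodic\<close>. Then \<open>l\<close> would have been good enough.\<close>

theorem unbounded_domain_above:
  "\<exists>T \<in> \<SS>. T \<notin> range U \<and> (\<exists>i. U i \<preceq> T) \<and> (\<forall>B. \<exists>i j. dist_on T (x i) (x j) > B)"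
proof (rule ccontr)
  assume none: "\<not> ?thesis"
  have bounded: "\<exists>B. \<forall>i j. dist_on T (x i) (x j) \<le> B" if "T \<in> \<SS>" "T \<notin> range U" "U i \<preceq> T" for T i
    using none that by (meson not_le)
  define P where "P l \<longleftrightarrow> (\<exists>p. \<forall>F. finite F \<longrightarrow> covered l p F)" for l
  have "\<not> P 0"
  proof
    assume "P 0"
    then obtain p where p: "\<And>F. finite F \<Longrightarrow> covered 0 p F" by (auto simp: P_def)
    then obtain \<T> where \<T>: "finite \<T>" "card \<T> \<le> p" "\<And>T. T \<in> \<T> \<Longrightarrow> admissible 0 T"
      "{0..int p} \<subseteq> (\<Union>T \<in> \<T>. shadow T)"
      using p[of "{0..int p}", OF finite_atLeastAtMost_int] unfolding covered_def by blast
    have "U i \<in> \<T>" if "i \<in> {0..int p}" for i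
    proof -
      have "i \<in> (\<Union>T \<in> \<T>. shadow T)" using \<T>(4) that by blast
      then obtain T where T: "T \<in> \<T>" "U i \<preceq> T" by (auto simp: shadow_def)
      then obtain j where "T = U j" using \<T>(3) by (auto simp: admissible_def)
      then show ?thesis using T U_antichain by metis
    qed
    moreover have "inj_on U {0..int p}"
      by (rule inj_onI) (metis U_antichain U_in nest_refl)
    ultimately have "card {0..int p} \<le> card \<T>" using \<T>(1) by (intro card_inj_on_le) auto
    then show False using \<T>(2) by simp
  qed
  obtain n where n: "\<And>T. level T \<le> n" using level_bounded by blast
  obtain M where M: "M \<in> \<SS>" "\<And>V. V \<in> \<SS> \<Longrightarrow> V \<preceq> M" using top_domain U_in by blast
  have "covered (Suc n) 1 F" for F
    using M U_in n by (intro covered_single[of _ M]) (auto simp: admissible_def shadow_def less_Suc_eq_le)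
  then have "P (Suc n)" unfolding P_def by blast
  with \<open>\<not> P 0\<close> obtain l where l: "\<not> P l" "P (Suc l)"
    using ex_least_nat_less[of P "Suc n"] by blast
  obtain p0 where p0: "\<And>F. finite F \<Longrightarrow> covered (Suc l) p0 F" using l(2) by (auto simp: P_def)
  define p where "p = Suc p0"
  have p: "covered (Suc l) p F" if "finite F" for F
    using p0[OF that] by (rule covered_mono) (auto simp: p_def)
  define r :: nat where "r = fact p"
  define \<F> where "\<F> = {T. admissible (Suc l) T \<and> act (a [^] int r) T = T \<and>
    (\<exists>F. finite F \<and> F \<subseteq> shadow T \<and> \<not> covered l overlap F)}"
  have "finite \<F>" unfolding \<F>_def by (rule finite_periodic_domains) (simp add: r_def)
  have one: "1 \<le> overlap" by (simp add: overlap_def)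
  have "\<exists>q. \<forall>F. finite F \<longrightarrow> covered l q (F \<inter> shadow T)" if T: "T \<in> \<F>" for T
  proof -
    obtain F where F: "finite F" "F \<subseteq> shadow T" "\<not> covered l overlap F" using T by (auto simp: \<F>_def)
    have adm: "admissible (Suc l) T" using T by (simp add: \<F>_def)
    have "\<not> admissible l T" using F one covered_single by blast
    then have T': "T \<in> \<SS>" "T \<notin> range U" "level T \<le> l" using adm by (auto simp: admissible_def)
    have "F \<noteq> {}" using F(3) covered_empty by blast
    then obtain i where "U i \<preceq> T" using F(2) by (auto simp: shadow_def)
    then obtain B where B: "\<And>i j. dist_on T (x i) (x j) \<le> B" using bounded T' by blast
    have "covered l (nat \<lfloor>E * B + E\<rfloor> + 2) (F \<inter> shadow T)" if "finite F" for F
      using that B T' by (intro covered_if_bounded[of T]) auto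
    then show ?thesis by blast
  qed
  then obtain q where q: "\<And>T F. \<lbrakk>T \<in> \<F>; finite F\<rbrakk> \<Longrightarrow> covered l (q T) (F \<inter> shadow T)" by metis
  have "covered l (p * (p * overlap + (\<Sum>T \<in> \<F>. q T))) F" if F: "finite F" for F
  proof -
    obtain \<T> where \<T>: "finite \<T>" "card \<T> \<le> p" "F \<subseteq> (\<Union>T \<in> \<T>. shadow T)"
      "\<And>T. T \<in> \<T> \<Longrightarrow> admissible (Suc l) T \<and>
        (covered l (p * overlap) (F \<inter> shadow T) \<or> act (a [^] int r) T = T)"
      using cover_almost_periodic[of p l, OF _ p F] by (auto simp: p_def r_def)
    have "covered l (p * overlap + (\<Sum>T \<in> \<F>. q T)) (F \<inter> shadow T)" if T: "T \<in> \<T>" for T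
    proof (cases "covered l (p * overlap) (F \<inter> shadow T)")
      case True
      then show ?thesis by (rule covered_mono) auto
    next
      case False
      then have "\<not> covered l overlap (F \<inter> shadow T)"
        using covered_mono[of l overlap "F \<inter> shadow T" "F \<inter> shadow T" "p * overlap"] by (auto simp: p_def)
      then have "T \<in> \<F>" using \<T>(4)[OF T] False F unfolding \<F>_def by blast
      then have "q T \<le> (\<Sum>T \<in> \<F>. q T)" using \<open>finite \<F>\<close> by (intro member_le_sum) auto
      then show ?thesis using q[OF \<open>T \<in> \<F>\<close> F] covered_mono by (meson order_refl trans_le_add2)
    qed
    then have "covered l (p * (p * overlap + (\<Sum>T \<in> \<F>. q T))) (\<Union>T \<in> \<T>. F \<inter> shadow T)"
      by (rule covered_UN[OF \<T>(1,2)])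
    moreover have "F \<subseteq> (\<Union>T \<in> \<T>. F \<inter> shadow T)" using \<T>(3) by blast
    ultimately show ?thesis using covered_mono by blast
  qed
  then have "P l" unfolding P_def by blast
  then show False using l(1) by simp
qed

end

section \<open>Eyries are pairwise orthogonal\<close>

context hierarchically_hyperbolic_group
begin

abbreviation "unbounded H \<equiv> unbounded_domains \<SS> C \<pi> H"
abbreviation "eyrie_set H \<equiv> eyries \<SS> C \<pi> nest H"

lemma unbounded_iff:
  "S \<subseteq> carrier G \<Longrightarrow> U \<in> unbounded S \<longleftrightarrow> U \<in> \<SS> \<and> (\<forall>B. \<exists>x \<in> S. \<exists>y \<in> S. dist_on U x y > B)"
  using bounded_proj_iff[of U S] by (auto simp: unbounded_domains_def) (meson not_le)+

lemma eyrie_in: "W \<in> eyrie_set H \<Longrightarrow> W \<in> \<SS>"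
  by (auto simp: eyries_def unbounded_domains_def)

lemma act_unbounded:
  assumes H: "subgroup H G" and h: "h \<in> H" and U: "U \<in> unbounded H"
  shows "act h U \<in> unbounded H"
proof -
  have HG: "H \<subseteq> carrier G" using H by (rule subgroup.subset)
  have "\<exists>x \<in> H. \<exists>y \<in> H. dist_on (act h U) x y > B" for B
  proof -
    obtain x y where xy: "x \<in> H" "y \<in> H" "dist_on U x y > B" "U \<in> \<SS>"
      using U unbounded_iff[OF HG] by blast
    moreover have "h \<in> carrier G" "x \<in> carrier G" "y \<in> carrier G" using xy h HG by auto
    ultimately have "dist_on (act h U) (h \<otimes> x) (h \<otimes> y) > B" using dist_on_act[of h x y U] by simp
    then show ?thesis using subgroup.m_closed[OF H h] xy by blast
  qed
  then show ?thesis using unbounded_iff[OF HG] U h HG by auto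
qed

lemma act_eyrie:
  assumes H: "subgroup H G" and h: "h \<in> H" and W: "W \<in> eyrie_set H"
  shows "act h W \<in> eyrie_set H"
proof -
  have hG: "h \<in> carrier G" using H h subgroup.mem_carrier by metis
  have hi: "inv h \<in> H" using H h by (rule subgroup.m_inv_closed)
  have WS: "W \<in> \<SS>" using W by (rule eyrie_in)
  have "V = act h W" if V: "V \<in> unbounded H" "act h W \<preceq> V" for V
  proof -
    have VS: "V \<in> \<SS>" using V by (simp add: unbounded_domains_def)
    have "W \<preceq> act (inv h) V"
      using act_nest[of h W "act (inv h) V"] V(2) hG VS WS by simp
    then have "act (inv h) V = W"
      using W act_unbounded[OF H hi V(1)] by (simp add: eyries_def)
    then show ?thesis using VS hG act_inv' by metis
  qed
  then show ?thesis using W act_unbounded[OF H h] by (auto simp: eyries_def)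
qed

lemma nested_in_eyrie:
  assumes "U \<in> unbounded H"
  shows "\<exists>W \<in> eyrie_set H. U \<preceq> W"
proof -
  have "unbounded H \<subseteq> \<SS>" by (auto simp: unbounded_domains_def)
  from maximal_above[OF this assms] show ?thesis by (auto simp: eyries_def)
qed

lemma loxodromic_on_growth:
  assumes g: "g \<in> carrier G" and W: "W \<in> \<SS>" and lox: "loxodromic_on G C act isom g W"
  shows "act g W = W" and "\<exists>c > 0. \<exists>b. \<forall>n::nat. dist_on W \<one> (g [^] n) \<ge> c * real n - b"
proof -
  show gW: "act g W = W" using lox by (simp add: loxodromic_on_def)
  obtain p K c where p: "p \<in> mspace (C W)"
    and qi: "qi_embedding K c int_metric (C W) (\<lambda>n. isom (g [^] n) W p)"
    using lox by (auto simp: loxodromic_on_def)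
  have K: "K \<ge> 1" using qi by (simp add: qi_embedding_def)
  define b where "b = c + 2 * mdist (C W) p (\<pi> W \<one>)"
  have "dist_on W \<one> (g [^] n) \<ge> (1 / K) * real n - b" for n :: nat
  proof -
    have near: "isom (g [^] k) W p \<in> mspace (C W)"
      "mdist (C W) (isom (g [^] k) W p) (\<pi> W (g [^] k)) = mdist (C W) p (\<pi> W \<one>)" for k :: int
    proof -
      have k: "g [^] k \<in> carrier G" "act (g [^] k) W = W"
        using g act_int_pow_fixes[OF g W gW] by simp_all
      have iso: "isometry (C W) (C W) (isom (g [^] k) W)" using iso_isometry[OF k(1) W] k(2) by simp
      then show "isom (g [^] k) W p \<in> mspace (C W)"
        using p by (auto simp: isometry_def)
      have base: "isom (g [^] k) W (\<pi> W \<one>) = \<pi> W (g [^] k)"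
        using proj_equivariant[OF k(1) one_closed W] k by simp
      have "mdist (C W) (isom (g [^] k) W p) (isom (g [^] k) W (\<pi> W \<one>)) = mdist (C W) p (\<pi> W \<one>)"
        using iso p proj_in[OF W one_closed] unfolding isometry_def isometric_embedding_def by blast
      then show "mdist (C W) (isom (g [^] k) W p) (\<pi> W (g [^] k)) = mdist (C W) p (\<pi> W \<one>)"
        unfolding base .
    qed
    define q where "q k = isom (g [^] k) W p" for k :: int
    note near = near[folded q_def]
    have "real n / K - c \<le> mdist (C W) (q 0) (q (int n))"
    proof -
      have "\<forall>i \<in> mspace int_metric. \<forall>j \<in> mspace int_metric.
          mdist int_metric i j / K - c \<le> mdist (C W) (q i) (q j)"
        using qi unfolding qi_embedding_def q_def by blast
      from this[rule_format, of 0 "int n"] show ?thesis by simp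
    qed
    also have "\<dots> \<le> mdist (C W) (q 0) (\<pi> W \<one>) + mdist (C W) (\<pi> W \<one>) (q (int n))"
      using near(1) W by (intro mdist_triangle) auto
    also have "mdist (C W) (\<pi> W \<one>) (q (int n)) \<le>
        mdist (C W) (\<pi> W \<one>) (\<pi> W (g [^] int n)) + mdist (C W) (\<pi> W (g [^] int n)) (q (int n))"
      using near(1) W g by (intro mdist_triangle) auto
    finally show ?thesis
      using near(2)[of 0] near(2)[of "int n"] g
      by (simp add: dist_on_def b_def mdist_commute[of "C W" "\<pi> W (g [^] n)"] int_pow_int)
  qed
  then show "\<exists>c > 0. \<exists>b. \<forall>n::nat. dist_on W \<one> (g [^] n) \<ge> c * real n - b"
    using K by (intro exI[of _ "1 / K"]) auto
qed

lemma loxodromic_moves_far: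
  assumes g: "g \<in> carrier G" and W: "W \<in> \<SS>" and lox: "loxodromic_on G C act isom g W"
    and y: "y \<in> carrier G"
  shows "\<exists>n::nat. dist_on W y (g [^] n \<otimes> y) > R"
proof -
  obtain c b where c: "c > 0" "\<And>n::nat. dist_on W \<one> (g [^] n) \<ge> c * real n - b"
    using loxodromic_on_growth(2)[OF assms(1-3)] by blast
  obtain n :: nat where "real n > (R + b + 2 * dist_on W \<one> y) / c" using reals_Archimedean2 by blast
  then have n: "c * real n > R + b + 2 * dist_on W \<one> y" using c(1) by (simp add: field_simps)
  have "act g W = W" by (rule loxodromic_on_growth(1)[OF assms(1-3)])
  then have fix_n: "act (g [^] n) W = W" using act_int_pow_fixes[OF g W, of "int n"] by (simp add: int_pow_int)
  have "dist_on W (g [^] n \<otimes> \<one>) (g [^] n \<otimes> y) = dist_on W \<one> y"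
    using dist_on_stab[of "g [^] n" \<one> y W] fix_n g y W by simp
  then have "dist_on W \<one> (g [^] n) \<le> dist_on W \<one> y + dist_on W y (g [^] n \<otimes> y) + dist_on W \<one> y"
    using dist_on_triangle[OF W one_closed, of y "g [^] n"]
      dist_on_triangle[OF W y, of "g [^] n \<otimes> y" "g [^] n"] g y
    by (simp add: dist_on_commute[of W "g [^] n \<otimes> y"])
  then show ?thesis using c(2)[of n] n by (intro exI[of _ n]) linarith
qed

text \<open>From local to global: \<open>U (l - 1)\<close> sees \<open>x (l - 2)\<close>, and inductively every earlier point, far
  from \<open>x l\<close>. The Behrstock inequality for \<open>U (l - 1)\<close> and \<open>U l\<close> then places all these points near
  \<open>x (l - 1)\<close> in \<open>U l\<close>. The second claim is the first one for the reversed family.\<close>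

lemma behrstock_chain:
  assumes U: "\<And>l::int. U l \<in> \<SS>" and x: "\<And>l. realises (U l) (x l)"
    and step: "\<And>l. U l \<pitchfork> U (l + 1)" and far: "\<And>l. dist_on (U l) (x (l - 1)) (x (l + 1)) > 8 * E"
  shows "dist_on (U l) (x (l - 1 - int n)) (x (l - 1)) \<le> 4 * E"
    and "dist_on (U l) (x (l + 1 + int n)) (x (l + 1)) \<le> 4 * E"
proof -
  have one_sided: "dist_on (V l) (y (l - 1 - int n)) (y (l - 1)) \<le> 4 * E"
    if V: "\<And>l::int. V l \<in> \<SS>" and y: "\<And>l. realises (V l) (y l)"
      and step: "\<And>l. V (l - 1) \<pitchfork> V l" and far: "\<And>l. dist_on (V l) (y (l - 1)) (y (l + 1)) > 8 * E"
    for V y l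
  proof (induction n arbitrary: l)
    case 0
    then show ?case using dist_on_self[OF V realises_in[OF y]] E_ge_1 by simp
  next
    case (Suc n)
    have yG: "y l \<in> carrier G" for l using y realises_in by blast
    define z where "z = y (l - 1 - int (Suc n))"
    have z: "z \<in> carrier G" using yG by (simp add: z_def)
    have "dist_on (V (l - 1)) z (y (l - 1 - 1)) \<le> 4 * E"
      using Suc.IH[of "l - 1"] by (simp add: z_def algebra_simps)
    moreover have "dist_on (V (l - 1)) (y (l - 1 - 1)) (y l) > 8 * E"
      using far[of "l - 1"] by simp
    ultimately have "dist_on (V (l - 1)) z (y l) > 4 * E"
      using dist_on_triangle[OF V[of "l - 1"] yG[of "l - 1 - 1"] z yG[of l]]
      by (simp add: dist_on_commute[of _ _ z])
    then have "dist_on (V l) z (y (l - 1)) \<le> 4 * E"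
      using behrstock[OF V V step[of l] y y z] by simp
    then show ?case by (simp add: z_def)
  qed
  show "dist_on (U l) (x (l - 1 - int n)) (x (l - 1)) \<le> 4 * E"
    using step[of "_ - 1"] by (intro one_sided U x far) simp
  have "dist_on (U (- (- l))) (x (- (- l - 1 - int n))) (x (- (- l - 1))) \<le> 4 * E"
  proof (rule one_sided[where V = "\<lambda>l. U (- l)" and y = "\<lambda>l. x (- l)"])
    show "U (- (l - 1)) \<pitchfork> U (- l)" for l
      using transverse_sym[OF U U step[of "- l"]] by simp
    show "dist_on (U (- l)) (x (- (l - 1))) (x (- (l + 1))) > 8 * E" for l
      using far[of "- l"] by (simp add: dist_on_commute)
  qed (use U x in auto)
  then show "dist_on (U l) (x (l + 1 + int n)) (x (l + 1)) \<le> 4 * E"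
    by (simp add: algebra_simps)
qed

text \<open>Ping-pong with \<open>a = g f\<close>, where \<open>f\<close> and \<open>g\<close> are high powers of the loxodromic elements. In
  \<open>C W\<close> both \<open>f W\<close> and \<open>f\<^sup>-\<^sup>1W\<close> project close to \<open>\<rho> V W\<close>, because \<open>f\<close> moves \<open>W\<close> far in \<open>C V\<close>. So
  \<open>a\<^sup>-\<^sup>1W = f\<^sup>-\<^sup>1W\<close> projects close to \<open>\<rho> V W\<close> and \<open>a W = g f W\<close> close to its image under \<open>g\<close>,
  which is far away. Hence the translates of \<open>W\<close> form an axis. The domain that
  \<open>unbounded_domain_above\<close> finds for it is unbounded for \<open>H\<close> and lies strictly above a translate
  of \<open>W\<close>, which is an eyrie.\<close>

lemma eyries_not_transverse:
  assumes H: "subgroup H G" and V: "V \<in> eyrie_set H" and W: "W \<in> eyrie_set H" and rel: "V \<pitchfork> W"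
    and f0: "f0 \<in> H" "loxodromic_on G C act isom f0 V"
    and g0: "g0 \<in> H" "loxodromic_on G C act isom g0 W"
  shows False
proof -
  have HG: "h \<in> carrier G" if "h \<in> H" for h using subgroup.mem_carrier[OF H that] .
  have VS: "V \<in> \<SS>" and WS: "W \<in> \<SS>" using V W eyrie_in by auto
  obtain v y where v: "realises V v" and y: "realises W y" using realise VS WS by blast
  have vG: "v \<in> carrier G" and yG: "y \<in> carrier G" using v y realises_in by auto
  obtain m n :: nat where m: "dist_on V y (f0 [^] m \<otimes> y) > 20 * E"
    and n: "dist_on W v (g0 [^] n \<otimes> v) > 20 * E"
    using loxodromic_moves_far[OF HG VS f0(2) yG] loxodromic_moves_far[OF HG WS g0(2) vG] f0(1) g0(1)
    by blast
  define f where "f = f0 [^] m"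
  define g where "g = g0 [^] n"
  have fH: "f \<in> H" "g \<in> H"
    using subgroup_int_pow_closed[OF H f0(1), of "int m"] subgroup_int_pow_closed[OF H g0(1), of "int n"]
    by (simp_all add: f_def g_def int_pow_int)
  have fG: "f \<in> carrier G" "g \<in> carrier G" using HG fH by auto
  have fV: "act f V = V"
    using act_int_pow_fixes[OF HG[OF f0(1)] VS loxodromic_on_growth(1)[OF HG[OF f0(1)] VS f0(2)], of "int m"]
    by (simp add: f_def int_pow_int)
  have gW: "act g W = W"
    using act_int_pow_fixes[OF HG[OF g0(1)] WS loxodromic_on_growth(1)[OF HG[OF g0(1)] WS g0(2)], of "int n"]
    by (simp add: g_def int_pow_int)
  have far_f: "dist_on V y (f \<otimes> y) > 20 * E" and far_g: "dist_on W v (g \<otimes> v) > 20 * E"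
    using m n by (simp_all add: f_def g_def)
  have rel': "W \<pitchfork> V" using transverse_sym[OF VS WS rel] .
  define a where "a = g \<otimes> f"
  have aH: "a \<in> H" using subgroup.m_closed[OF H] fH by (simp add: a_def)
  have aG: "a \<in> carrier G" using HG aH .
  have a_pow: "a [^] (k::int) \<in> carrier G" "a [^] k \<in> H" for k
    using aG subgroup_int_pow_closed[OF H aH] by simp_all
  define U where "U k = act (a [^] k) W" for k :: int
  define x where "x k = a [^] k \<otimes> y" for k :: int
  have U_S: "U k \<in> \<SS>" for k using a_pow WS by (simp add: U_def)
  have U_eyrie: "U k \<in> eyrie_set H" for k using act_eyrie[OF H a_pow(2) W] by (simp add: U_def)
  have x_real: "realises (U k) (x k)" for k
    using realises_act[OF a_pow(1) WS y] by (simp add: U_def x_def)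
  have xG: "x k \<in> carrier G" for k using realises_in[OF x_real] .
  have pow_add: "a [^] (i + k) = a [^] k \<otimes> a [^] i" for i k :: int
    using int_pow_mult[OF aG, of k i] by (simp add: add.commute)
  have U_shift: "act (a [^] k) (U i) = U (i + k)" for i k :: int
    using act_mult[OF a_pow(1) a_pow(1) WS, of k i] by (simp add: U_def pow_add)
  have x_shift: "a [^] k \<otimes> x i = x (i + k)" for i k :: int
    using m_assoc[OF a_pow(1) a_pow(1) yG, of k i] by (simp add: x_def pow_add)
  have U0: "U 0 = W" and x0: "x 0 = y" using WS yG by (simp_all add: U_def x_def)
  have U1: "U 1 = act g (act f W)" and x1: "x 1 = g \<otimes> (f \<otimes> y)"
    using aG fG WS yG by (simp_all add: U_def x_def int_pow_1 a_def act_mult m_assoc)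
  have step0: "U 0 \<pitchfork> U 1"
  proof -
    have "act f W \<pitchfork> V" using act_transverse[OF fG(1) WS VS] rel' fV by simp
    then have "W \<pitchfork> act f W"
      using transverse_if_far[OF WS _ VS rel' _ y realises_act[OF fG(1) WS y]] fG WS far_f E_ge_1 by simp
    then have "act g W \<pitchfork> act g (act f W)" using act_transverse[OF fG(2) WS] fG WS by simp
    then show ?thesis using U0 U1 gW by simp
  qed
  have step: "U l \<pitchfork> U (l + 1)" for l
    using act_transverse[OF a_pow(1)[of l] U_S[of 0] U_S[of 1]] step0 by (simp add: U_shift add.commute)
  have far0: "dist_on (U 0) (x (- 1)) (x 1) > 12 * E"
  proof -
    have x_neg: "x (- 1) = inv f \<otimes> (inv g \<otimes> y)"
      using aG fG yG by (simp add: x_def int_pow_neg int_pow_1 a_def inv_mult_group m_assoc)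
    have gy: "realises W (inv g \<otimes> y)"
      using realises_act[OF inv_closed[OF fG(2)] WS y] gW act_inv[OF fG(2) WS] by simp
    have "dist_on V (x (- 1)) y = dist_on V (f \<otimes> x (- 1)) (f \<otimes> y)"
      using dist_on_stab[OF fG(1) xG yG VS fV] by simp
    also have "f \<otimes> x (- 1) = inv g \<otimes> y"
      unfolding x_neg using fG yG by (simp flip: m_assoc)
    finally have "dist_on V (x (- 1)) y = dist_on V (inv g \<otimes> y) (f \<otimes> y)" .
    moreover have "dist_on V y (inv g \<otimes> y) \<le> 4 * E"
      using realises_close[OF WS VS _ y gy] rel' by blast
    ultimately have "dist_on V (x (- 1)) y > 4 * E"
      using far_f dist_on_triangle[OF VS yG realises_in[OF gy], of "f \<otimes> y"] fG yG E_ge_1 by simp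
    then have "dist_on W (x (- 1)) v \<le> 4 * E"
      using behrstock[OF VS WS rel v y xG] by force
    moreover have "dist_on V (f \<otimes> y) y > 4 * E"
      using far_f E_ge_1 by (simp add: dist_on_commute)
    then have "dist_on W (f \<otimes> y) v \<le> 4 * E"
      using behrstock[OF VS WS rel v y, of "f \<otimes> y"] fG yG by force
    then have "dist_on W (x 1) (g \<otimes> v) \<le> 4 * E"
      using dist_on_stab[OF fG(2) _ vG WS gW, of "f \<otimes> y"] fG yG by (simp add: x1)
    moreover have "dist_on W v (g \<otimes> v) \<le> dist_on W (x (- 1)) v + dist_on W (x (- 1)) (x 1) + dist_on W (x 1) (g \<otimes> v)"
      using dist_on_triangle[OF WS vG xG[of "- 1"], of "g \<otimes> v"]
        dist_on_triangle[OF WS xG[of "- 1"] xG[of 1], of "g \<otimes> v"] fG vG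
      by (simp add: dist_on_commute[of W v])
    ultimately show ?thesis using far_g U0 by simp
  qed
  have far: "dist_on (U l) (x (l - 1)) (x (l + 1)) > 12 * E" for l
    using dist_on_act[OF a_pow(1)[of l] xG[of "- 1"] xG[of 1] U_S[of 0]] far0
    by (simp add: U_shift x_shift algebra_simps)
  have far8: "dist_on (U l) (x (l - 1)) (x (l + 1)) > 8 * E" for l using far[of l] E_ge_1 by simp
  note chain = behrstock_chain[of U x, OF U_S x_real step far8]
  have left: "dist_on (U l) (x i) (x (l - 1)) \<le> 4 * E" if "i < l" for i l
    using chain(1)[of l "nat (l - 1 - i)"] that by simp
  have right: "dist_on (U l) (x j) (x (l + 1)) \<le> 4 * E" if "l < j" for j l
    using chain(2)[of l "nat (j - 1 - l)"] that by simp
  have spread: "dist_on (U l) (x i) (x j) > 4 * E" if "i < l" "l < j" for i l j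
    using left[OF that(1)] right[OF that(2)] far[of l]
      dist_on_triangle[OF U_S[of l] xG[of "l - 1"] xG[of i] xG[of "l + 1"]]
      dist_on_triangle[OF U_S[of l] xG[of i] xG[of j] xG[of "l + 1"]]
    by (simp add: dist_on_commute[of "U l" "x (l - 1)" "x i"])
  have "U i \<noteq> U j" if "i < j" for i j
  proof
    assume eq: "U i = U j"
    have "j \<noteq> i + 1" using step[of i] eq by (auto simp: transverse_def)
    then have "dist_on (U i) (x (i - 1)) (x (j - 1)) > 4 * E" using that by (intro spread) auto
    moreover have "dist_on (U j) (x (i - 1)) (x (j - 1)) \<le> 4 * E" using that by (intro left) auto
    ultimately show False using eq by simp
  qed
  then have U_inj: "U i = U j \<Longrightarrow> i = j" for i j by (metis linorder_neqE)
  have U_antichain: "i = j" if "U i \<preceq> U j" for i j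
    using that U_eyrie[of i] U_eyrie[of j] U_inj[of j i] by (auto simp: eyries_def)
  interpret axis: domain_axis G A \<SS> E C \<pi> nest orth \<rho> \<rho>m act isom a U x
  proof unfold_locales
    show "E \<le> dist_on (U l) (x i) (x j)" if "i < l" "l < j" for i l j
      using spread[OF that] E_ge_1 by simp
  qed (use aG U_S U_shift U_antichain x_real in auto)
  obtain T i where T: "T \<in> \<SS>" "T \<notin> range U" "U i \<preceq> T" "\<And>B. \<exists>i j. dist_on T (x i) (x j) > B"
    using axis.unbounded_domain_above by blast
  obtain B where B: "\<And>U g. \<lbrakk>U \<in> \<SS>; g \<in> carrier G\<rbrakk> \<Longrightarrow> dist_on U g (g \<otimes> y) \<le> B"
    using dist_on_right_mult_bounded[OF yG] by blast
  have "\<exists>g \<in> H. \<exists>h \<in> H. dist_on T g h > D" for D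
  proof -
    obtain i j where ij: "dist_on T (x i) (x j) > D + 2 * B" using T(4) by blast
    have "dist_on T (a [^] k) (x k) \<le> B" for k using B[OF T(1) a_pow(1)] by (simp add: x_def)
    from this[of i] this[of j] have "dist_on T (x i) (x j) \<le> B + dist_on T (a [^] i) (a [^] j) + B"
      using dist_on_triangle[OF T(1) xG[of i] a_pow(1)[of i] xG[of j]]
        dist_on_triangle[OF T(1) a_pow(1)[of i] a_pow(1)[of j] xG[of j]]
      by (simp add: dist_on_commute[of T "x i" "a [^] i"])
    then show ?thesis using ij a_pow(2) by (intro bexI[of _ "a [^] i"] bexI[of _ "a [^] j"]) auto
  qed
  then have "T \<in> unbounded H" using unbounded_iff[OF subgroup.subset[OF H]] T(1) by blast
  then have "T = U i" using U_eyrie[of i] T(3) by (simp add: eyries_def)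
  then show False using T(2) by simp
qed

end

section \<open>The big-set of an element that is loxodromic on all eyries\<close>

context hierarchically_hyperbolic_group
begin

lemma hyperbolic_length_dist_on:
  assumes K: "subgroup K G" and W: "W \<in> \<SS>" and stab: "\<And>k. k \<in> K \<Longrightarrow> act k W = W"
  shows "hyperbolic_length (G\<lparr>carrier := K\<rparr>) (dist_on W) (3 * (E + 1))"
proof -
  have KG: "k \<in> carrier G" if "k \<in> K" for k using subgroup.mem_carrier[OF K that] .
  have four: "min (gromov_product (dist_on W) w x y) (gromov_product (dist_on W) w y z) - 3 * (E + 1)
      \<le> gromov_product (dist_on W) w x z" if "w \<in> K" "x \<in> K" "y \<in> K" "z \<in> K" for w x y z
    using four_point_inequality[OF hyperbolic[OF W], of "\<pi> W w" "\<pi> W x" "\<pi> W y" "\<pi> W z"] that KG W E_ge_1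
    by (simp add: gromov_product_def dist_on_def)
  interpret K: group "G\<lparr>carrier := K\<rparr>" using subgroup.subgroup_is_group[OF K] by (simp add: is_group)
  show ?thesis
    using four E_ge_1 dist_on_self[OF W] dist_on_commute[of W] dist_on_triangle[OF W]
      dist_on_stab[OF _ _ _ W stab] KG
    by unfold_locales auto
qed

text \<open>The distance from \<open>1\<close> of a geodesic of \<open>C W\<close> joining \<open>k\<^sup>N\<close> to a later \<open>k\<^sup>b\<close> is at least the
  Gromov product of its end points, which \<open>growth\<close> bounds below by \<open>N\<close>. For large \<open>N\<close> such
  geodesics avoid the neighbourhood of \<open>\<rho> U W\<close>, so by the bounded geodesic image axiom \<open>C U\<close>
  hardly distinguishes \<open>k\<^sup>b\<close> from \<open>k\<^sup>N\<close>.\<close>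

lemma bounded_below_axis:
  assumes k: "k \<in> carrier G" and W: "W \<in> \<SS>" and kW: "act k W = W" and U: "U \<in> \<SS>" "proper_nest U W"
    and growth: "\<And>n m::nat. dist_on W \<one> (k [^] (n + m)) \<ge> dist_on W \<one> (k [^] n) + real m"
  shows "\<exists>B. \<forall>n::nat. dist_on U \<one> (k [^] n) \<le> B"
proof -
  note \<rho> = rho_set[OF U(1) W disjI1[OF U(2)]]
  obtain p where p: "p \<in> \<rho> U W" "p \<in> mspace (C W)" using \<rho> by blast
  define D where "D = mdist (C W) (\<pi> W \<one>) p + 2 * E + 1"
  define N where "N = nat \<lceil>D\<rceil> + 1"
  have kG: "k [^] (n::nat) \<in> carrier G" for n using k by simp
  have fixW: "act (k [^] (n::nat)) W = W" for n
    using act_int_pow_fixes[OF k W kW, of "int n"] by (simp add: int_pow_int)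
  have close: "dist_on U (k [^] N) (k [^] b) \<le> E" if b: "N \<le> b" for b
  proof (rule ccontr)
    assume far: "\<not> ?thesis"
    obtain \<gamma> where \<gamma>: "geodesic_segment (C W) (\<pi> W (k [^] N)) (\<pi> W (k [^] b)) \<gamma>"
      using hyperbolic[OF W] kG W unfolding hyperbolic_space_def geodesic_space_def by (meson proj_in)
    have "set_dist (C W) (\<rho> U W) \<gamma> \<le> ennreal E"
      using bounded_geodesic_image_proj[OF U(1) W U(2) _ _ _ \<gamma>] far kG by (simp add: dist_on_def)
    then obtain q s where q: "q \<in> \<rho> U W" and s: "s \<in> \<gamma>" and qs: "mdist (C W) q s < E + 1"
      using set_dist_leD[of "C W" "\<rho> U W" \<gamma> E "E + 1"] E_ge_1 by auto
    have q_in: "q \<in> mspace (C W)" and s_in: "s \<in> mspace (C W)"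
      using \<rho> q geodesic_segment_between(1)[OF \<gamma> s] by auto
    have "dist_on W (k [^] N) (k [^] b) = dist_on W \<one> (k [^] (b - N))"
      using dist_on_stab[OF kG one_closed kG W fixW, of N "b - N"] k b by (simp add: nat_pow_mult)
    then have "real N \<le> gromov_product (dist_on W) \<one> (k [^] N) (k [^] b)"
      using growth[of 0 N] growth[of "b - N" N] b dist_on_self[OF W one_closed]
      by (simp add: gromov_product_def)
    also have "\<dots> \<le> mdist (C W) (\<pi> W \<one>) s"
      using gromov_product_le_dist_segment[OF \<gamma> s, of "\<pi> W \<one>"] kG W
      by (simp add: gromov_product_def dist_on_def)
    also have "\<dots> \<le> mdist (C W) (\<pi> W \<one>) p + mdist (C W) p q + mdist (C W) q s"
      using mdist_triangle[of "\<pi> W \<one>" "C W" p s] mdist_triangle[of p "C W" q s] p q_in s_in W by simp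
    also have "mdist (C W) p q \<le> E" using \<rho> p q E_ge_1 by (intro diam_leD) auto
    finally have "real N \<le> D" using qs by (simp add: D_def)
    moreover have "real N > D" unfolding N_def by linarith
    ultimately show False by simp
  qed
  have "dist_on U \<one> (k [^] n) \<le> (\<Sum>i \<le> N. dist_on U \<one> (k [^] i)) + E" for n :: nat
  proof (cases "n \<le> N")
    case True
    then have "dist_on U \<one> (k [^] n) \<le> (\<Sum>i \<le> N. dist_on U \<one> (k [^] i))"
      by (intro member_le_sum) (auto simp: dist_on_nonneg)
    then show ?thesis using E_ge_1 by simp
  next
    case False
    have "dist_on U \<one> (k [^] N) \<le> (\<Sum>i \<le> N. dist_on U \<one> (k [^] i))"
      by (intro member_le_sum) (auto simp: dist_on_nonneg)
    then show ?thesis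
      using close[of n] False dist_on_triangle[OF U(1) one_closed kG[of N] kG[of n]] by simp
  qed
  then show ?thesis by blast
qed

text \<open>A domain of the big-set properly nested in an eyrie is excluded by \<open>bounded_below_axis\<close>,
  applied to \<open>h\<close> for the positive powers and to its inverse for the negative ones.\<close>

lemma Big_eq_eyries:
  assumes H: "subgroup H G" and h: "h \<in> H"
    and fixes_eyries: "\<And>W. W \<in> eyrie_set H \<Longrightarrow> act h W = W"
    and growth: "\<And>W n m. W \<in> eyrie_set H \<Longrightarrow>
      dist_on W \<one> (h [^] (n + m :: nat)) \<ge> dist_on W \<one> (h [^] n) + real m"
  shows "Big G \<SS> C \<pi> h = eyrie_set H"
proof
  have hG: "h \<in> carrier G" using subgroup.mem_carrier[OF H h] .
  have HG: "H \<subseteq> carrier G" using subgroup.subset[OF H] .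
  have cyc: "generate G {h} = {h [^] (k::int) | k. k \<in> UNIV}" by (rule generate_pow[OF hG])
  have cycH: "generate G {h} \<subseteq> H" unfolding cyc using subgroup_int_pow_closed[OF H h] by auto
  have cycG: "generate G {h} \<subseteq> carrier G" using cycH HG by simp
  note big_iff = unbounded_iff[OF cycG]
  show "eyrie_set H \<subseteq> Big G \<SS> C \<pi> h"
  proof
    fix W assume W: "W \<in> eyrie_set H"
    have "\<exists>x \<in> generate G {h}. \<exists>y \<in> generate G {h}. dist_on W x y > B" for B
    proof -
      obtain n :: nat where n: "real n > B" using reals_Archimedean2 by blast
      have "dist_on W \<one> (h [^] n) \<ge> real n"
        using growth[OF W, of 0 n] dist_on_self[OF eyrie_in[OF W] one_closed] by simp
      moreover have "\<one> \<in> generate G {h}" by (rule generate.one)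
      moreover have "h [^] int n \<in> generate G {h}" unfolding cyc by blast
      then have "h [^] n \<in> generate G {h}" by (simp add: int_pow_int)
      ultimately show ?thesis using n by force
    qed
    then show "W \<in> Big G \<SS> C \<pi> h" unfolding Big_def big_iff using eyrie_in[OF W] by blast
  qed
  show "Big G \<SS> C \<pi> h \<subseteq> eyrie_set H"
  proof
    fix U assume U: "U \<in> Big G \<SS> C \<pi> h"
    then have US: "U \<in> \<SS>" and unb: "\<And>B. \<exists>x \<in> generate G {h}. \<exists>y \<in> generate G {h}. dist_on U x y > B"
      unfolding Big_def big_iff by blast+
    have "U \<in> unbounded H" unfolding unbounded_iff[OF HG] using US unb cycH by blast
    then obtain W where W: "W \<in> eyrie_set H" "U \<preceq> W" using nested_in_eyrie by blast
    have WS: "W \<in> \<SS>" using eyrie_in[OF W(1)] .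
    have hW: "act h W = W" using fixes_eyries[OF W(1)] .
    have "U = W"
    proof (rule ccontr)
      assume "U \<noteq> W"
      then have UW: "U \<prec> W" using W(2) by (simp add: proper_nest_def)
      have inv_pow: "dist_on W \<one> (inv h [^] n) = dist_on W \<one> (h [^] n)" for n :: nat
      proof -
        have hn: "h [^] n \<in> carrier G" using hG by simp
        have "act (h [^] n) W = W" using act_int_pow_fixes[OF hG WS hW, of "int n"] by (simp add: int_pow_int)
        then have "dist_on W (h [^] n \<otimes> \<one>) (h [^] n \<otimes> inv (h [^] n)) = dist_on W \<one> (inv (h [^] n))"
          using hn WS by (intro dist_on_stab) auto
        then show ?thesis using hn hG by (simp add: nat_pow_inv dist_on_commute)
      qed
      have inv_W: "act (inv h) W = W" using act_inv[OF hG WS] hW by simp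
      obtain B1 where B1: "\<And>n::nat. dist_on U \<one> (h [^] n) \<le> B1"
        using bounded_below_axis[OF hG WS hW US UW growth[OF W(1)]] by blast
      obtain B2 where B2: "\<And>n::nat. dist_on U \<one> (inv h [^] n) \<le> B2"
        using bounded_below_axis[OF inv_closed[OF hG] WS inv_W US UW] growth[OF W(1)]
        unfolding inv_pow by blast
      have near: "dist_on U \<one> x \<le> max B1 B2" if x: "x \<in> generate G {h}" for x
      proof -
        obtain k :: int where k: "x = h [^] k" using x unfolding cyc by blast
        show ?thesis
        proof (cases "k \<ge> 0")
          case True
          then have "x = h [^] nat k" using k by (metis int_nat_eq int_pow_int)
          then show ?thesis using B1[of "nat k"] by simp
        next
          case False
          then have "k = - int (nat (- k))" by simp
          then have "x = inv (h [^] nat (- k))" using k hG by (metis int_pow_int int_pow_neg)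
          then have "x = inv h [^] nat (- k)" using hG by (simp add: nat_pow_inv)
          then show ?thesis using B2[of "nat (- k)"] by simp
        qed
      qed
      obtain x y where xy: "x \<in> generate G {h}" "y \<in> generate G {h}" "dist_on U x y > 2 * max B1 B2"
        using unb by blast
      then have "dist_on U x y \<le> dist_on U \<one> x + dist_on U \<one> y"
        using dist_on_triangle[OF US, of x \<one> y] cycG by (auto simp: dist_on_commute[of U x])
      then show False using near[OF xy(1)] near[OF xy(2)] xy(3) by linarith
    qed
    then show "U \<in> eyrie_set H" using W(1) by simp
  qed
qed

theorem exists_element_with_Big_eq_eyries:
  assumes H: "subgroup H G"
    and lox: "\<And>W. W \<in> eyrie_set H \<Longrightarrow> \<exists>g \<in> H. loxodromic_on G C act isom g W"
  shows "\<exists>h \<in> H. Big G \<SS> C \<pi> h = eyrie_set H"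
proof -
  let ?E = "eyrie_set H"
  have HG: "h \<in> carrier G" if "h \<in> H" for h using subgroup.mem_carrier[OF H that] .
  have orth: "V \<bottom>\<bottom> W" if V: "V \<in> ?E" and W: "W \<in> ?E" and "V \<noteq> W" for V W
  proof -
    obtain f g where "f \<in> H" "loxodromic_on G C act isom f V" "g \<in> H" "loxodromic_on G C act isom g W"
      using lox V W by blast
    then have "\<not> V \<pitchfork> W" using eyries_not_transverse[OF H V W] by blast
    moreover have "\<not> V \<preceq> W" "\<not> W \<preceq> V" using V W \<open>V \<noteq> W\<close> by (auto simp: eyries_def)
    ultimately show ?thesis using \<open>V \<noteq> W\<close> by (auto simp: transverse_def)
  qed
  have fin: "finite ?E" using eyrie_in orth by (intro finite_pairwise_orth) auto
  define K where "K = {h \<in> H. \<forall>W \<in> ?E. act h W = W}"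
  have K: "subgroup K G"
  proof
    show "K \<subseteq> carrier G" using HG by (auto simp: K_def)
    show "\<one> \<in> K" using subgroup.one_closed[OF H] eyrie_in by (auto simp: K_def)
    show "x \<otimes> y \<in> K" if "x \<in> K" "y \<in> K" for x y
      using that subgroup.m_closed[OF H] HG eyrie_in by (auto simp: K_def act_mult)
    show "inv x \<in> K" if x: "x \<in> K" for x
    proof -
      have xH: "x \<in> H" using x by (simp add: K_def)
      have "act (inv x) W = W" if "W \<in> ?E" for W
        using act_inv[OF HG[OF xH] eyrie_in[OF that]] x that by (simp add: K_def)
      then show ?thesis using subgroup.m_inv_closed[OF H xH] by (simp add: K_def)
    qed
  qed
  let ?K = "G\<lparr>carrier := K\<rparr>"
  interpret K: group ?K using subgroup.subgroup_is_group[OF K] by (simp add: is_group)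
  have hyp: "hyperbolic_length ?K (dist_on W) (3 * (E + 1))" if "W \<in> ?E" for W
    using eyrie_in[OF that] that by (intro hyperbolic_length_dist_on[OF K]) (auto simp: K_def)
  have pow_eq: "x [^]\<^bsub>?K\<^esub> n = x [^] n" for x and n :: nat
    by (rule nat_pow_consistent[symmetric])
  \<comment> \<open>a loxodromic element permutes the finitely many eyries, so a power of it lies in \<open>K\<close>\<close>
  have "\<exists>g \<in> carrier ?K. hyperbolic_length.loxodromic ?K (dist_on W) (3 * (E + 1)) g" if W: "W \<in> ?E" for W
  proof -
    obtain g where g: "g \<in> H" "loxodromic_on G C act isom g W" using lox W by blast
    have gG: "g \<in> carrier G" using HG g by simp
    have g_pow: "g [^] (n::nat) \<in> H" for n
      using subgroup_int_pow_closed[OF H g(1), of "int n"] by (simp add: int_pow_int)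
    have "\<exists>r \<ge> (1::nat). act (g [^] r) V = V" if V: "V \<in> ?E" for V
    proof -
      have VS: "V \<in> \<SS>" using eyrie_in[OF V] .
      have "(\<lambda>n::nat. act (g [^] n) V) ` UNIV \<subseteq> ?E" using act_eyrie[OF H g_pow V] by auto
      then have "\<not> inj (\<lambda>n::nat. act (g [^] n) V)"
        using fin finite_subset finite_imageD infinite_UNIV_nat by metis
      then obtain m n :: nat where mn: "m < n" "act (g [^] m) V = act (g [^] n) V"
        unfolding inj_def by (metis nat_neq_iff)
      have "g [^] n = g [^] m \<otimes> g [^] (n - m)" using mn(1) gG by (simp add: nat_pow_mult)
      then have "act (g [^] m) (act (g [^] (n - m)) V) = act (g [^] m) V"
        using act_mult[of "g [^] m" "g [^] (n - m)" V] mn(2) gG VS by simp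
      then have "act (g [^] (n - m)) V = V" using act_inj[of "g [^] m"] gG VS by simp
      then show ?thesis using mn(1) by (intro exI[of _ "n - m"]) auto
    qed
    then obtain r :: "_ \<Rightarrow> nat" where r: "\<And>V. V \<in> ?E \<Longrightarrow> r V \<ge> 1 \<and> act (g [^] r V) V = V" by metis
    define q where "q = (\<Prod>V \<in> ?E. r V)"
    have q: "q \<ge> 1" unfolding q_def by (rule prod_ge_1) (use r in blast)
    have "act (g [^] q) V = V" if V: "V \<in> ?E" for V
    proof -
      have "r V dvd q" using V fin by (simp add: q_def dvd_prodI)
      then obtain j where "q = r V * j" by (auto elim: dvdE)
      then have "g [^] q = (g [^] r V) [^] int j" using gG by (simp add: nat_pow_pow int_pow_int)
      then show ?thesis using act_int_pow_fixes[of "g [^] r V" V "int j"] r[OF V] gG eyrie_in[OF V] by simp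
    qed
    then have qK: "g [^] q \<in> K" using g_pow by (simp add: K_def)
    obtain c b where c: "c > 0" "\<And>n::nat. dist_on W \<one> (g [^] n) \<ge> c * real n - b"
      using loxodromic_on_growth(2)[OF gG eyrie_in[OF W] g(2)] by blast
    have "dist_on W \<one> ((g [^] q) [^] n) \<ge> (c * real q) * real n - b" for n :: nat
      using c(2)[of "q * n"] gG by (simp add: nat_pow_pow mult.assoc)
    then have "hyperbolic_length.loxodromic ?K (dist_on W) (3 * (E + 1)) (g [^] q)"
      using qK c(1) q
      by (intro hyperbolic_length.loxodromic_if_linear_growth[OF hyp[OF W], of _ "c * real q" b])
        (auto simp: pow_eq)
    then show ?thesis using qK by auto
  qed
  from K.simultaneously_doubling[of ?E dist_on, OF fin hyp this]
  obtain h where h: "h \<in> K" "\<And>W. W \<in> ?E \<Longrightarrow> hyperbolic_length.doubles ?K (dist_on W) (3 * (E + 1)) h"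
    by auto
  have "dist_on W \<one> (h [^] (n + m)) \<ge> dist_on W \<one> (h [^] n) + real m" if W: "W \<in> ?E" for W and n m :: nat
  proof -
    interpret W: hyperbolic_length ?K "dist_on W" "3 * (E + 1)" by (rule hyp[OF W])
    define t where "t = 3 * (3 * (E + 1)) + 1"
    have "dist_on W \<one> (h [^] (n + m)) \<ge> dist_on W \<one> (h [^] n) + real m * (t - 2 * (3 * (E + 1)))"
      using W.doubling_growth_add[of h t n m] h(1) h(2)[OF W] unfolding W.doubles_def pow_eq
      by (simp add: t_def)
    moreover have "real m * 1 \<le> real m * (t - 2 * (3 * (E + 1)))"
      using E_ge_1 by (intro mult_left_mono) (auto simp: t_def)
    ultimately show ?thesis by simp
  qed
  then have "Big G \<SS> C \<pi> h = ?E" using h(1) by (intro Big_eq_eyries[OF H]) (auto simp: K_def)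
  then show ?thesis using h(1) by (auto simp: K_def)
qed

end

theorem corollary5p9:
  fixes G :: "('g, 'm) monoid_scheme"
    and A H :: "'g set"
    and \<SS> :: "'u set"
    and E :: real
    and C :: "'u \<Rightarrow> 'c metric"
    and \<pi> :: "'u \<Rightarrow> 'g \<Rightarrow> 'c"
    and nest orth :: "'u \<Rightarrow> 'u \<Rightarrow> bool"
    and \<rho> :: "'u \<Rightarrow> 'u \<Rightarrow> 'c set"
    and \<rho>m :: "'u \<Rightarrow> 'u \<Rightarrow> 'c \<Rightarrow> 'c set"
    and act :: "'g \<Rightarrow> 'u \<Rightarrow> 'u"
    and isom :: "'g \<Rightarrow> 'u \<Rightarrow> 'c \<Rightarrow> 'c"
  assumes "hierarchically_hyperbolic_group G A \<SS> E C \<pi> nest orth \<rho> \<rho>m act isom"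
    and "subgroup H G"
    and "\<forall>W \<in> eyries \<SS> C \<pi> nest H. \<exists>g \<in> H. loxodromic_on G C act isom g W"
  shows "\<exists>h \<in> H. Big G \<SS> C \<pi> h = eyries \<SS> C \<pi> nest H"
proof -
  interpret hierarchically_hyperbolic_group G A \<SS> E C \<pi> nest orth \<rho> \<rho>m act isom
    by (rule assms(1))
  show ?thesis
    using assms(3) by (intro exists_element_with_Big_eq_eyries[OF assms(2)]) blast
qed

end
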